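(* Let $W$ be a finite real reflection group acting on $\mathbb{R}^n$ with simple system spanning $\mathbb{R}^n$ and set of simple reflections $S$, and let $m(s,t)$ denote the order of $st$ in $W$. Let $W'$ be the group generated by $S$ subject only to the relations $s^2=1$ for all $s\in S$ and $st=ts$ for all $s,t\in S$ with $m(s,t)=2$ (i.e. the Coxeter group on $S$ with $m'(s,t)=m(s,t)$ if $m(s,t)\le 2$ and $m'(s,t)=\infty$ otherwise), and let $\varphi':W'\to W$ be the surjective homomorphism with $\varphi'(s)=s$ for all $s\in S$. Let $\mathscr{W}_{n,3}$ be the $3$-parabolic arrangement of $W$ and $\mathcal{M}(\mathscr{W}_{n,3})=\mathbb{R}^n\setminus\bigcup_{X\in\mathscr{W}_{n,3}}X$. Then $$\pi_1(\mathcal{M}(\mathscr{W}_{n,3}))\cong\ker\varphi'.$$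
   Context: A subgroup $G\subseteq W$ is parabolic if $G=\langle wTw^{-1}\rangle$ for some $T\subseteq S$, $w\in W$; its rank is $|T|$; it is irreducible if the Coxeter system $(G,wTw^{-1})$ is irreducible. $Fix(G)=\{x\in\mathbb{R}^n: gx=x\ \forall g\in G\}$. The $3$-parabolic arrangement is $\mathscr{W}_{n,3}=\{Fix(G): G \text{ an irreducible parabolic subgroup of } W \text{ of rank } 2\}$. *)

theory Defs
  imports "HOL-Analysis.Analysis" "HOL-Algebra.Multiplicative_Group" "HOL-Algebra.Generated_Groups"
begin

section \<open>Finite real reflection groups and their simple systems\<close>

definition orthogonal_group :: "('a::euclidean_space \<Rightarrow> 'a) monoid" where
  "orthogonal_group = \<lparr>carrier = {f. orthogonal_transformation f}, mult = (\<circ>), one = id\<rparr>"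

definition reflection :: "'a::euclidean_space \<Rightarrow> 'a \<Rightarrow> 'a" where
  "reflection a x = x - (2 * (x \<bullet> a) / (a \<bullet> a)) *\<^sub>R a"

text \<open>The zero vector has to be excluded because \<^term>\<open>reflection 0\<close> is the identity.\<close>

definition finite_reflection_group :: "('a::euclidean_space \<Rightarrow> 'a) monoid \<Rightarrow> bool" where
  "finite_reflection_group W \<longleftrightarrow>
     (\<exists>A. 0 \<notin> A \<and> W = orthogonal_group\<lparr>carrier := generate orthogonal_group (reflection ` A)\<rparr>)
     \<and> finite (carrier W)"

definition root_system :: "'a::euclidean_space set \<Rightarrow> bool" where
  "root_system \<Phi> \<longleftrightarrow> finite \<Phi> \<and> 0 \<notin> \<Phi> \<and>
     (\<forall>\<alpha>\<in>\<Phi>. \<Phi> \<inter> span {\<alpha>} = {\<alpha>, -\<alpha>} \<and> reflection \<alpha> ` \<Phi> = \<Phi>)"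

definition root_system_of :: "('a::euclidean_space \<Rightarrow> 'a) monoid \<Rightarrow> 'a set \<Rightarrow> bool" where
  "root_system_of W \<Phi> \<longleftrightarrow>
     root_system \<Phi> \<and> carrier W = generate orthogonal_group (reflection ` \<Phi>)"

definition simple_system :: "'a::euclidean_space set \<Rightarrow> 'a set \<Rightarrow> bool" where
  "simple_system \<Phi> \<Delta> \<longleftrightarrow> \<Delta> \<subseteq> \<Phi> \<and> independent \<Delta> \<and> span \<Delta> = span \<Phi> \<and>
     (\<forall>\<alpha>\<in>\<Phi>. \<exists>c. \<alpha> = (\<Sum>\<delta>\<in>\<Delta>. c \<delta> *\<^sub>R \<delta>) \<and>
        ((\<forall>\<delta>\<in>\<Delta>. 0 \<le> c \<delta>) \<or> (\<forall>\<delta>\<in>\<Delta>. c \<delta> \<le> 0)))"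


section \<open>Parabolic subgroups and the 3-parabolic arrangement\<close>

definition coxeter_m :: "('g, 'z) monoid_scheme \<Rightarrow> 'g \<Rightarrow> 'g \<Rightarrow> nat" where
  "coxeter_m W s t = group.ord W (s \<otimes>\<^bsub>W\<^esub> t)"

text \<open>Irreducibility of a Coxeter system is connectedness of its Coxeter graph, whose edges are the
  pairs with \<open>m(s,t) \<ge> 3\<close>, infinity included; the library encodes infinite order as \<open>0\<close>.\<close>

definition coxeter_edges :: "('g, 'z) monoid_scheme \<Rightarrow> 'g set \<Rightarrow> ('g \<times> 'g) set" where
  "coxeter_edges W T = {(s, t). s \<in> T \<and> t \<in> T \<and> (coxeter_m W s t \<ge> 3 \<or> coxeter_m W s t = 0)}"

definition irreducible_system :: "('g, 'z) monoid_scheme \<Rightarrow> 'g set \<Rightarrow> bool" where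
  "irreducible_system W T \<longleftrightarrow> T \<noteq> {} \<and> (\<forall>s\<in>T. \<forall>t\<in>T. (s, t) \<in> (coxeter_edges W T)\<^sup>*)"

definition conj_set :: "('g, 'z) monoid_scheme \<Rightarrow> 'g \<Rightarrow> 'g set \<Rightarrow> 'g set" where
  "conj_set W w T = (\<lambda>t. w \<otimes>\<^bsub>W\<^esub> t \<otimes>\<^bsub>W\<^esub> inv\<^bsub>W\<^esub> w) ` T"

definition irreducible_parabolic_of_rank ::
    "('g, 'z) monoid_scheme \<Rightarrow> 'g set \<Rightarrow> nat \<Rightarrow> 'g set \<Rightarrow> bool" where
  "irreducible_parabolic_of_rank W S k G \<longleftrightarrow>
     (\<exists>T w. T \<subseteq> S \<and> w \<in> carrier W \<and> G = generate W (conj_set W w T) \<and> card T = k \<and>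
        irreducible_system (W\<lparr>carrier := G\<rparr>) (conj_set W w T))"

definition Fix :: "('a \<Rightarrow> 'a) set \<Rightarrow> 'a set" where
  "Fix G = {x. \<forall>g\<in>G. g x = x}"

definition three_parabolic_arrangement ::
    "('a::euclidean_space \<Rightarrow> 'a) monoid \<Rightarrow> ('a \<Rightarrow> 'a) set \<Rightarrow> 'a set set" where
  "three_parabolic_arrangement W S = {Fix G | G. irreducible_parabolic_of_rank W S 2 G}"

definition arrangement_complement :: "'a set set \<Rightarrow> 'a set" where
  "arrangement_complement \<A> = UNIV - \<Union>\<A>"


section \<open>Groups given by generators and relations\<close>

text \<open>A word over \<open>X\<close> is a list of letters \<open>(x, b)\<close>, standing for \<open>x\<close> if \<open>b\<close> is true and for the
  inverse of \<open>x\<close> otherwise. A relation is a pair of words to be identified.\<close>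

type_synonym 's word = "('s \<times> bool) list"

abbreviation words :: "'s set \<Rightarrow> 's word set" where
  "words X \<equiv> lists (X \<times> UNIV)"

inductive pres_eq :: "'s set \<Rightarrow> ('s word \<times> 's word) set \<Rightarrow> 's word \<Rightarrow> 's word \<Rightarrow> bool"
  for X R where
  pres_refl: "u \<in> words X \<Longrightarrow> pres_eq X R u u"
| pres_sym: "pres_eq X R u v \<Longrightarrow> pres_eq X R v u"
| pres_trans: "pres_eq X R u v \<Longrightarrow> pres_eq X R v w \<Longrightarrow> pres_eq X R u w"
| pres_append: "pres_eq X R u v \<Longrightarrow> pres_eq X R u' v' \<Longrightarrow> pres_eq X R (u @ u') (v @ v')"
| pres_cancel: "x \<in> X \<Longrightarrow> pres_eq X R [(x, b), (x, \<not> b)] []"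
| pres_rel: "(u, v) \<in> R \<Longrightarrow> u \<in> words X \<Longrightarrow> v \<in> words X \<Longrightarrow> pres_eq X R u v"

definition pres_class :: "'s set \<Rightarrow> ('s word \<times> 's word) set \<Rightarrow> 's word \<Rightarrow> 's word set" where
  "pres_class X R u = {v. pres_eq X R u v}"

definition presented_group :: "'s set \<Rightarrow> ('s word \<times> 's word) set \<Rightarrow> 's word set monoid" where
  "presented_group X R =
     \<lparr>carrier = pres_class X R ` words X,
      mult = (\<lambda>A B. \<Union>u\<in>A. \<Union>v\<in>B. pres_class X R (u @ v)),
      one = pres_class X R []\<rparr>"

definition pres_gen :: "'s set \<Rightarrow> ('s word \<times> 's word) set \<Rightarrow> 's \<Rightarrow> 's word set" where
  "pres_gen X R x = pres_class X R [(x, True)]"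

definition commutation_relations ::
    "('g, 'z) monoid_scheme \<Rightarrow> 'g set \<Rightarrow> ('g word \<times> 'g word) set" where
  "commutation_relations W S =
     {([(s, True), (s, True)], []) | s. s \<in> S} \<union>
     {([(s, True), (t, True)], [(t, True), (s, True)]) | s t.
        s \<in> S \<and> t \<in> S \<and> coxeter_m W s t = 2}"

abbreviation commutation_group :: "('g, 'z) monoid_scheme \<Rightarrow> 'g set \<Rightarrow> 'g word set monoid" where
  "commutation_group W S \<equiv> presented_group S (commutation_relations W S)"

abbreviation commutation_gen :: "('g, 'z) monoid_scheme \<Rightarrow> 'g set \<Rightarrow> 'g \<Rightarrow> 'g word set" where
  "commutation_gen W S \<equiv> pres_gen S (commutation_relations W S)"


section \<open>The fundamental group\<close>

definition loops :: "'a::topological_space set \<Rightarrow> 'a \<Rightarrow> (real \<Rightarrow> 'a) set" where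
  "loops X x = {p. path p \<and> path_image p \<subseteq> X \<and> pathstart p = x \<and> pathfinish p = x}"

definition path_class :: "'a::topological_space set \<Rightarrow> (real \<Rightarrow> 'a) \<Rightarrow> (real \<Rightarrow> 'a) set" where
  "path_class X p = {q. homotopic_paths X p q}"

definition fundamental_group ::
    "'a::real_normed_vector set \<Rightarrow> 'a \<Rightarrow> (real \<Rightarrow> 'a) set monoid" where
  "fundamental_group X x =
     \<lparr>carrier = path_class X ` loops X x,
      mult = (\<lambda>A B. \<Union>p\<in>A. \<Union>q\<in>B. path_class X (p +++ q)),
      one = path_class X (linepath x x)\<rparr>"


section \<open>Well-definedness\<close>

lemma group_orthogonal_group: "group (orthogonal_group :: ('a::euclidean_space \<Rightarrow> 'a) monoid)"
proof (rule groupI)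
  fix f :: "'a \<Rightarrow> 'a"
  assume "f \<in> carrier orthogonal_group"
  then have f: "orthogonal_transformation f"
    by (simp add: orthogonal_group_def)
  then have "orthogonal_transformation (inv_into UNIV f)" "inv_into UNIV f \<circ> f = id"
    by (auto simp: orthogonal_transformation_inv orthogonal_transformation_inj)
  then show "\<exists>g\<in>carrier orthogonal_group. g \<otimes>\<^bsub>orthogonal_group\<^esub> f = \<one>\<^bsub>orthogonal_group\<^esub>"
    by (auto simp: orthogonal_group_def)
qed (auto simp: orthogonal_group_def orthogonal_transformation_compose id_def comp_assoc)

lemma reflection_orthogonal:
  fixes a :: "'a::euclidean_space"
  shows "reflection a \<in> carrier orthogonal_group"
proof -
  have "linear (reflection a)"
    by (rule linearI) (auto simp: reflection_def algebra_simps add_divide_distrib inner_add_left)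
  moreover have "reflection a v \<bullet> reflection a w = v \<bullet> w" for v w
    by (cases "a = 0")
       (auto simp: reflection_def inner_diff_left inner_diff_right inner_commute field_simps)
  ultimately show ?thesis
    by (auto simp: orthogonal_group_def orthogonal_transformation_def)
qed

lemma reflection_involution:
  fixes a :: "'a::euclidean_space"
  shows "reflection a \<circ> reflection a = id"
  by (cases "a = 0") (auto simp: fun_eq_iff reflection_def inner_diff_left algebra_simps)

lemma finite_reflection_group_imp_group:
  assumes "finite_reflection_group W"
  shows "group W"
proof -
  obtain A where W: "W = orthogonal_group\<lparr>carrier := generate orthogonal_group (reflection ` A)\<rparr>"
    using assms unfolding finite_reflection_group_def by blast
  have "subgroup (generate orthogonal_group (reflection ` A)) orthogonal_group"
    by (rule group.generate_is_subgroup[OF group_orthogonal_group])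
       (auto intro: reflection_orthogonal)
  then show ?thesis
    unfolding W by (rule subgroup.subgroup_is_group[OF _ group_orthogonal_group])
qed

lemma pres_eq_words: "pres_eq X R u v \<Longrightarrow> u \<in> words X \<and> v \<in> words X"
  by (induction rule: pres_eq.induct) auto

lemma pres_class_eq: "pres_eq X R u v \<Longrightarrow> pres_class X R u = pres_class X R v"
  unfolding pres_class_def by (blast intro: pres_eq.pres_sym pres_eq.pres_trans)

lemma UN_UN_constant:
  assumes "a \<in> A" "b \<in> B" "\<And>x y. x \<in> A \<Longrightarrow> y \<in> B \<Longrightarrow> K x y = C"
  shows "(\<Union>x\<in>A. \<Union>y\<in>B. K x y) = C"
proof -
  have "(\<Union>x\<in>A. \<Union>y\<in>B. K x y) = (\<Union>x\<in>A. \<Union>y\<in>B. C)"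
    using assms(3) by simp
  also have "\<dots> = C"
    using assms(1,2) by auto
  finally show ?thesis .
qed

lemma pres_mult:
  assumes "u \<in> words X" "v \<in> words X"
  shows "pres_class X R u \<otimes>\<^bsub>presented_group X R\<^esub> pres_class X R v = pres_class X R (u @ v)"
proof -
  have "pres_class X R (u' @ v') = pres_class X R (u @ v)"
    if "u' \<in> pres_class X R u" "v' \<in> pres_class X R v" for u' v'
    using that pres_class_eq[OF pres_eq.pres_append, of X R u u' v v'] by (simp add: pres_class_def)
  moreover have "u \<in> pres_class X R u" "v \<in> pres_class X R v"
    using assms by (auto simp: pres_class_def intro: pres_eq.pres_refl)
  ultimately show ?thesis
    unfolding presented_group_def monoid.simps by (intro UN_UN_constant)
qed

lemma pres_inverse:
  assumes "u \<in> words X"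
  shows "\<exists>v\<in>words X. pres_eq X R (v @ u) []"
  using assms
proof (induction u)
  case Nil
  show ?case by (auto intro!: bexI[of _ "[]"] pres_eq.pres_refl)
next
  case (Cons a u)
  obtain x b where a: "a = (x, b)" "x \<in> X" using Cons by (cases a) auto
  obtain v where v: "v \<in> words X" "pres_eq X R (v @ u) []" using Cons by auto
  have "pres_eq X R ([(x, \<not> b), (x, b)] @ u) ([] @ u)"
    using pres_eq.pres_cancel[of x X R "\<not> b"] a Cons by (intro pres_eq.pres_append pres_eq.pres_refl) auto
  then have "pres_eq X R (v @ [(x, \<not> b), (x, b)] @ u) (v @ u)"
    using v by (intro pres_eq.pres_append pres_eq.pres_refl) auto
  then have "pres_eq X R ((v @ [(x, \<not> b)]) @ a # u) []"
    using v a by (auto intro: pres_eq.pres_trans)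
  then show ?case using v a by (intro bexI[of _ "v @ [(x, \<not> b)]"]) auto
qed

lemma group_presented_group: "group (presented_group X R)"
proof (rule groupI)
  fix A assume "A \<in> carrier (presented_group X R)"
  then obtain u where u: "u \<in> words X" "A = pres_class X R u"
    by (auto simp: presented_group_def)
  obtain v where v: "v \<in> words X" "pres_eq X R (v @ u) []"
    using pres_inverse[OF u(1)] by blast
  have "pres_class X R v \<otimes>\<^bsub>presented_group X R\<^esub> A = pres_class X R []"
    unfolding u(2) pres_mult[OF v(1) u(1)] by (rule pres_class_eq[OF v(2)])
  then show "\<exists>B\<in>carrier (presented_group X R). B \<otimes>\<^bsub>presented_group X R\<^esub> A = \<one>\<^bsub>presented_group X R\<^esub>"
    using v(1) by (auto simp: presented_group_def)
next
  fix A assume "A \<in> carrier (presented_group X R)"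
  then obtain u where u: "u \<in> words X" "A = pres_class X R u"
    by (auto simp: presented_group_def)
  have "pres_class X R [] \<otimes>\<^bsub>presented_group X R\<^esub> A = A"
    unfolding u(2) using pres_mult[of "[]" X u R] u(1) by simp
  then show "\<one>\<^bsub>presented_group X R\<^esub> \<otimes>\<^bsub>presented_group X R\<^esub> A = A"
    by (simp add: presented_group_def)
next
  fix A B assume "A \<in> carrier (presented_group X R)" "B \<in> carrier (presented_group X R)"
  then obtain u v where u: "u \<in> words X" "A = pres_class X R u"
      and v: "v \<in> words X" "B = pres_class X R v"
    by (auto simp: presented_group_def)
  have "u @ v \<in> words X" using u v by auto
  then show "A \<otimes>\<^bsub>presented_group X R\<^esub> B \<in> carrier (presented_group X R)"
    unfolding u(2) v(2) pres_mult[OF u(1) v(1)] by (auto simp: presented_group_def)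
  fix C assume "C \<in> carrier (presented_group X R)"
  then obtain w where w: "w \<in> words X" "C = pres_class X R w"
    by (auto simp: presented_group_def)
  have vw: "v @ w \<in> words X" using v w by auto
  show "A \<otimes>\<^bsub>presented_group X R\<^esub> B \<otimes>\<^bsub>presented_group X R\<^esub> C
      = A \<otimes>\<^bsub>presented_group X R\<^esub> (B \<otimes>\<^bsub>presented_group X R\<^esub> C)"
    unfolding u(2) v(2) w(2) pres_mult[OF u(1) v(1)] pres_mult[OF v(1) w(1)]
      pres_mult[OF \<open>u @ v \<in> words X\<close> w(1)] pres_mult[OF u(1) vw] by simp
qed (auto simp: presented_group_def)

primrec word_eval :: "('g, 'z) monoid_scheme \<Rightarrow> ('s \<Rightarrow> 'g) \<Rightarrow> 's word \<Rightarrow> 'g" where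
  "word_eval H f [] = \<one>\<^bsub>H\<^esub>"
| "word_eval H f (a # u) =
     (if snd a then f (fst a) else inv\<^bsub>H\<^esub> f (fst a)) \<otimes>\<^bsub>H\<^esub> word_eval H f u"

lemma (in group) word_eval_closed:
  assumes "f ` X \<subseteq> carrier G" "u \<in> words X"
  shows "word_eval G f u \<in> carrier G"
  using assms(2,1) by (induction u) auto

lemma (in group) word_eval_append:
  assumes "f ` X \<subseteq> carrier G" "u \<in> words X" "v \<in> words X"
  shows "word_eval G f (u @ v) = word_eval G f u \<otimes> word_eval G f v"
  using assms(2)
proof (induction u)
  case Nil
  then show ?case using word_eval_closed[OF assms(1,3)] by simp
next
  case (Cons a u)
  then show ?case
    using word_eval_closed[OF assms(1,3)] word_eval_closed[OF assms(1), of u] assms(1)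
    by (auto simp: m_assoc image_subset_iff)
qed

lemma (in group) word_eval_pres_eq:
  assumes f: "f ` X \<subseteq> carrier G"
    and R: "\<And>u v. (u, v) \<in> R \<Longrightarrow> word_eval G f u = word_eval G f v"
    and "pres_eq X R u v"
  shows "word_eval G f u = word_eval G f v"
  using assms(3)
proof (induction rule: pres_eq.induct)
  case (pres_append u v u' v')
  then show ?case
    using pres_eq_words[of X R u v] pres_eq_words[of X R u' v'] by (simp add: word_eval_append[OF f])
next
  case (pres_cancel x b)
  then have "f x \<in> carrier G" using f by blast
  then show ?case by (cases b) auto
next
  case (pres_rel u v)
  show ?case by (rule R[OF pres_rel(1)])
qed simp_all

lemma (in group) presented_group_universal:
  assumes f: "f ` X \<subseteq> carrier G"
    and R: "\<And>u v. (u, v) \<in> R \<Longrightarrow> word_eval G f u = word_eval G f v"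
  obtains \<phi> where "\<phi> \<in> hom (presented_group X R) G" "\<And>x. x \<in> X \<Longrightarrow> \<phi> (pres_gen X R x) = f x"
    "\<And>u. u \<in> words X \<Longrightarrow> \<phi> (pres_class X R u) = word_eval G f u"
proof -
  define \<phi> where "\<phi> A = word_eval G f (SOME u. u \<in> A)" for A
  have *: "\<phi> (pres_class X R u) = word_eval G f u" if "u \<in> words X" for u
  proof -
    have "u \<in> pres_class X R u" using that by (simp add: pres_class_def pres_eq.pres_refl)
    then have "(SOME v. v \<in> pres_class X R u) \<in> pres_class X R u" by (rule someI)
    then have "pres_eq X R u (SOME v. v \<in> pres_class X R u)" by (simp add: pres_class_def)
    from word_eval_pres_eq[OF f R this] show ?thesis by (simp add: \<phi>_def)
  qed
  show ?thesis
  proof (rule that)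
    show "\<phi> \<in> hom (presented_group X R) G"
    proof (rule homI)
      fix A assume "A \<in> carrier (presented_group X R)"
      then obtain u where u: "u \<in> words X" "A = pres_class X R u"
        by (auto simp: presented_group_def)
      then show "\<phi> A \<in> carrier G" using * word_eval_closed[OF f] by simp
      fix B assume "B \<in> carrier (presented_group X R)"
      then obtain v where v: "v \<in> words X" "B = pres_class X R v"
        by (auto simp: presented_group_def)
      have uv: "u @ v \<in> words X" using u v by auto
      show "\<phi> (A \<otimes>\<^bsub>presented_group X R\<^esub> B) = \<phi> A \<otimes> \<phi> B"
        unfolding u(2) v(2) pres_mult[OF u(1) v(1)] *[OF uv] *[OF u(1)] *[OF v(1)]
        by (rule word_eval_append[OF f u(1) v(1)])
    qed
    show "\<phi> (pres_gen X R x) = f x" if "x \<in> X" for x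
    proof -
      have "f x \<in> carrier G" using that f by blast
      then show ?thesis using that by (simp add: pres_gen_def *)
    qed
  qed (fact *)
qed

lemma presented_group_hom_unique:
  assumes H: "group H" and \<phi>: "\<phi> \<in> hom (presented_group X R) H"
    and \<psi>: "\<psi> \<in> hom (presented_group X R) H"
    and eq: "\<And>x. x \<in> X \<Longrightarrow> \<phi> (pres_gen X R x) = \<psi> (pres_gen X R x)"
    and A: "A \<in> carrier (presented_group X R)"
  shows "\<phi> A = \<psi> A"
proof -
  let ?P = "presented_group X R"
  have P: "group ?P" by (rule group_presented_group)
  interpret \<phi>: group_hom ?P H \<phi> using P H \<phi> by (simp add: group_hom_def group_hom_axioms_def)
  interpret \<psi>: group_hom ?P H \<psi> using P H \<psi> by (simp add: group_hom_def group_hom_axioms_def)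
  have cl: "pres_class X R u \<in> carrier ?P" if "u \<in> words X" for u
    using that by (simp add: presented_group_def)
  have letter: "\<phi> (pres_class X R [(x, b)]) = \<psi> (pres_class X R [(x, b)])" if x: "x \<in> X" for x b
  proof (cases b)
    case True
    then show ?thesis using eq[OF x] by (simp add: pres_gen_def)
  next
    case False
    have "pres_class X R [(x, False)] \<otimes>\<^bsub>?P\<^esub> pres_gen X R x = \<one>\<^bsub>?P\<^esub>"
      using pres_mult[of "[(x, False)]" X "[(x, True)]" R] x
        pres_class_eq[OF pres_eq.pres_cancel[of x X R False]]
      by (simp add: pres_gen_def presented_group_def)
    then have "pres_class X R [(x, False)] = inv\<^bsub>?P\<^esub> pres_gen X R x"
      using cl[of "[(x, False)]"] cl[of "[(x, True)]"] x group.inv_equality[OF P]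
      by (simp add: pres_gen_def)
    then show ?thesis
      using False eq[OF x] cl[of "[(x, True)]"] x by (simp add: pres_gen_def)
  qed
  have "\<phi> (pres_class X R u) = \<psi> (pres_class X R u)" if "u \<in> words X" for u
    using that
  proof (induction u)
    case Nil
    then show ?case using \<phi>.hom_one \<psi>.hom_one by (simp add: presented_group_def)
  next
    case (Cons a u)
    then obtain x b where a: "a = (x, b)" "x \<in> X" by (cases a) auto
    have u: "u \<in> words X" and a': "[a] \<in> words X" using Cons a by auto
    have e: "pres_class X R (a # u) = pres_class X R [a] \<otimes>\<^bsub>?P\<^esub> pres_class X R u"
      using pres_mult[OF a' u] by simp
    show ?case
      unfolding e using letter[OF a(2), of b] Cons.IH cl[OF u] cl[OF a'] a(1) by simp
  qed
  then show ?thesis using A by (auto simp: presented_group_def)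
qed

lemma commutation_hom_exists:
  assumes W: "group W" and S: "S \<subseteq> carrier W" and gen: "carrier W = generate W S"
    and inv: "\<And>s. s \<in> S \<Longrightarrow> s \<otimes>\<^bsub>W\<^esub> s = \<one>\<^bsub>W\<^esub>"
  shows "\<exists>\<phi>. \<phi> \<in> epi (commutation_group W S) W \<and> (\<forall>s\<in>S. \<phi> (commutation_gen W S s) = s)"
proof -
  interpret W: group W by fact
  have comm: "s \<otimes>\<^bsub>W\<^esub> t = t \<otimes>\<^bsub>W\<^esub> s" if "s \<in> S" "t \<in> S" "coxeter_m W s t = 2" for s t
  proof -
    have st: "s \<in> carrier W" "t \<in> carrier W" using that S by auto
    have "(s \<otimes>\<^bsub>W\<^esub> t) [^]\<^bsub>W\<^esub> (2::nat) = \<one>\<^bsub>W\<^esub>"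
      using W.pow_ord_eq_1[of "s \<otimes>\<^bsub>W\<^esub> t"] st that(3) unfolding coxeter_m_def by (metis W.m_closed)
    then have "(s \<otimes>\<^bsub>W\<^esub> t) \<otimes>\<^bsub>W\<^esub> (s \<otimes>\<^bsub>W\<^esub> t) = \<one>\<^bsub>W\<^esub>"
      using st by (simp add: numeral_2_eq_2)
    then have "s \<otimes>\<^bsub>W\<^esub> t = inv\<^bsub>W\<^esub> (s \<otimes>\<^bsub>W\<^esub> t)"
      using W.inv_equality st by (metis W.m_closed)
    also have "\<dots> = inv\<^bsub>W\<^esub> t \<otimes>\<^bsub>W\<^esub> inv\<^bsub>W\<^esub> s" using st by (rule W.inv_mult_group)
    also have "\<dots> = t \<otimes>\<^bsub>W\<^esub> s"
      using W.inv_equality[OF inv[OF that(1)]] W.inv_equality[OF inv[OF that(2)]] st by simp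
    finally show ?thesis .
  qed
  have R: "word_eval W (\<lambda>s. s) u = word_eval W (\<lambda>s. s) v"
    if "(u, v) \<in> commutation_relations W S" for u v
  proof -
    have S': "s \<in> carrier W" if "s \<in> S" for s using that S by blast
    show ?thesis
      using that by (auto simp: commutation_relations_def S' inv intro: comm)
  qed
  obtain \<phi> where \<phi>: "\<phi> \<in> hom (commutation_group W S) W"
      "\<And>s. s \<in> S \<Longrightarrow> \<phi> (commutation_gen W S s) = s"
  proof (rule W.presented_group_universal[of "\<lambda>s. s" S "commutation_relations W S"])
    show "(\<lambda>s. s) ` S \<subseteq> carrier W" using S by simp
  qed (erule R, blast)
  interpret \<phi>: group_hom "commutation_group W S" W \<phi>
    using W group_presented_group \<phi>(1) by (simp add: group_hom_def group_hom_axioms_def)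
  have "S \<subseteq> \<phi> ` carrier (commutation_group W S)"
  proof
    fix s assume s: "s \<in> S"
    then have "commutation_gen W S s \<in> carrier (commutation_group W S)"
      by (simp add: pres_gen_def presented_group_def)
    then show "s \<in> \<phi> ` carrier (commutation_group W S)" using \<phi>(2)[OF s] by (metis imageI)
  qed
  then have "carrier W \<subseteq> \<phi> ` carrier (commutation_group W S)"
    unfolding gen using W.generate_subgroup_incl \<phi>.img_is_subgroup by blast
  then have "\<phi> \<in> epi (commutation_group W S) W"
    using \<phi>(1) by (auto simp: epi_def hom_def)
  then show ?thesis using \<phi>(2) by blast
qed

lemma path_class_eq: "homotopic_paths X p q \<Longrightarrow> path_class X p = path_class X q"
  unfolding path_class_def by (blast intro: homotopic_paths_sym homotopic_paths_trans)

lemma loops_join: "p \<in> loops X x \<Longrightarrow> q \<in> loops X x \<Longrightarrow> p +++ q \<in> loops X x"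
  by (auto simp: loops_def path_image_join)

lemma fundamental_mult:
  assumes "p \<in> loops X x" "q \<in> loops X x"
  shows "path_class X p \<otimes>\<^bsub>fundamental_group X x\<^esub> path_class X q = path_class X (p +++ q)"
proof -
  have "path_class X (p' +++ q') = path_class X (p +++ q)"
    if "p' \<in> path_class X p" "q' \<in> path_class X q" for p' q'
    using that assms path_class_eq[OF homotopic_paths_join, of X p p' q q']
    by (simp add: path_class_def loops_def)
  moreover have "p \<in> path_class X p" "q \<in> path_class X q"
    using assms by (auto simp: path_class_def loops_def)
  ultimately show ?thesis
    unfolding fundamental_group_def monoid.simps by (intro UN_UN_constant)
qed

lemma group_fundamental_group:
  assumes x: "x \<in> X"
  shows "group (fundamental_group X x)"
proof (rule groupI)
  have lin: "linepath x x \<in> loops X x" using x by (auto simp: loops_def)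
  show "\<one>\<^bsub>fundamental_group X x\<^esub> \<in> carrier (fundamental_group X x)"
    using lin by (auto simp: fundamental_group_def)
  fix A assume "A \<in> carrier (fundamental_group X x)"
  then obtain p where p: "p \<in> loops X x" "A = path_class X p"
    by (auto simp: fundamental_group_def)
  have "homotopic_paths X (linepath x x +++ p) p"
    using p homotopic_paths_lid[of p X] by (simp add: loops_def)
  then show "\<one>\<^bsub>fundamental_group X x\<^esub> \<otimes>\<^bsub>fundamental_group X x\<^esub> A = A"
    using fundamental_mult[OF lin p(1)] p(2) path_class_eq
    by (metis (no_types, lifting) fundamental_group_def monoid.select_convs(2))
  have rp: "reversepath p \<in> loops X x" using p by (simp add: loops_def)
  have "homotopic_paths X (reversepath p +++ p) (linepath x x)"
    using p homotopic_paths_linv[of p X] by (simp add: loops_def)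
  then have "path_class X (reversepath p) \<otimes>\<^bsub>fundamental_group X x\<^esub> A = path_class X (linepath x x)"
    unfolding p(2) fundamental_mult[OF rp p(1)] by (rule path_class_eq)
  then show "\<exists>B\<in>carrier (fundamental_group X x).
      B \<otimes>\<^bsub>fundamental_group X x\<^esub> A = \<one>\<^bsub>fundamental_group X x\<^esub>"
    using rp by (auto simp: fundamental_group_def)
  fix B assume "B \<in> carrier (fundamental_group X x)"
  then obtain q where q: "q \<in> loops X x" "B = path_class X q"
    by (auto simp: fundamental_group_def)
  show "A \<otimes>\<^bsub>fundamental_group X x\<^esub> B \<in> carrier (fundamental_group X x)"
    unfolding p(2) q(2) fundamental_mult[OF p(1) q(1)]
    using loops_join[OF p(1) q(1)] by (simp add: fundamental_group_def)
  fix C assume "C \<in> carrier (fundamental_group X x)"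
  then obtain r where r: "r \<in> loops X x" "C = path_class X r"
    by (auto simp: fundamental_group_def)
  have "homotopic_paths X (p +++ (q +++ r)) ((p +++ q) +++ r)"
    using p q r by (intro homotopic_paths_assoc) (auto simp: loops_def)
  then show "A \<otimes>\<^bsub>fundamental_group X x\<^esub> B \<otimes>\<^bsub>fundamental_group X x\<^esub> C
      = A \<otimes>\<^bsub>fundamental_group X x\<^esub> (B \<otimes>\<^bsub>fundamental_group X x\<^esub> C)"
    unfolding p(2) q(2) r(2) fundamental_mult[OF p(1) q(1)] fundamental_mult[OF q(1) r(1)]
      fundamental_mult[OF loops_join[OF p(1) q(1)] r(1)]
      fundamental_mult[OF p(1) loops_join[OF q(1) r(1)]]
    using path_class_eq by metis
qed

end

theory Submission
  imports Defs
begin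

text \<open>
  A point lies in the complement \<open>M\<close> of the arrangement iff the roots orthogonal to it are pairwise
  orthogonal or opposite, so the star of every point of \<open>M\<close> is an open convex subset of \<open>M\<close>, and
  the chambers containing a point of \<open>M\<close> differ by products of commuting simple reflections.

  Fix a point in the open fundamental chamber. A word in \<open>S\<close> determines a polygonal path through
  its images, and the defining relations of \<open>W'\<close> become homotopies inside stars, so elements of
  \<open>W'\<close> determine homotopy classes of paths in \<open>M\<close>. Pushing an arbitrary path into the open chambers
  one star at a time shows that every path between images of the base point arises this way.
  For injectivity, choose a chamber \<open>v\<^sub>x\<close> containing each \<open>x\<close> in \<open>M\<close>. Within a star, \<open>v\<^sub>x\<inverse> v\<^sub>y\<close> is a product
  of commuting simple reflections and hence lifts canonically to \<open>W'\<close>. These lifts form a cocycle,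
  whose holonomy is a homotopy invariant and recovers the element of \<open>W'\<close> from its path.
\<close>

text \<open>The difficulty is injectivity: a gallery that contracts in M must come from a word that
  is trivial in the infinite group W'. The holonomy takes the place of a solution of the word
  problem, since it assigns an element of W' to every path in M. The chamber chosen for a point
  jumps at walls, so no continuity can be asked of the cocycle; only the algebraic identity inside
  one star is available, and it suffices. That identity rests on one fact. At a point of M the walls
  of a chamber through the point are orthogonal, so their reflections generate the same elementary
  abelian 2-group in W and in W'. An element of this group is determined by the simple roots that it
  negates, so its lift to W' depends on the two chambers compared and not on the star in which they
  are compared. Where two nonorthogonal roots vanish, W has a longer dihedral relation that W'
  lacks, and the lift would be ambiguous; these are the points that the arrangement removes. The
  base point is the sum of the basis dual to the simple roots: each simple root has value 1 there,
  and the inner product of a root with it is the height of the root.\<close>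

section \<open>Holonomy of a locally defined cocycle\<close>

text \<open>Compactness of an interval in the form of bisection. It carries every subdivision
  argument below: uniqueness and existence of lifts, homotopy invariance of the holonomy, and the
  deformation of paths into galleries.\<close>

lemma Bolzano_within:
  fixes a b :: real
  assumes "a \<le> b"
    and "\<And>x y z. a \<le> x \<Longrightarrow> x \<le> y \<Longrightarrow> y \<le> z \<Longrightarrow> z \<le> b \<Longrightarrow> P x y \<Longrightarrow> P y z \<Longrightarrow> P x z"
    and "\<And>t. t \<in> {a..b} \<Longrightarrow> \<exists>d>0. \<forall>x y. x \<in> {a..b} \<and> y \<in> {a..b} \<and> x \<le> t \<and> t \<le> y \<and> y - x < d \<longrightarrow> P x y"
  shows "P a b"
proof -
  have "a \<le> a \<and> b \<le> b \<longrightarrow> P a b"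
  proof (rule Bolzano[where P = "\<lambda>x y. a \<le> x \<and> y \<le> b \<longrightarrow> P x y", OF assms(1)])
    fix t assume t: "a \<le> t" "t \<le> b"
    then obtain d where d: "d > 0" "\<And>x y. x \<in> {a..b} \<Longrightarrow> y \<in> {a..b} \<Longrightarrow> x \<le> t \<Longrightarrow> t \<le> y \<Longrightarrow> y - x < d \<Longrightarrow> P x y"
      using assms(3)[of t] by auto
    show "\<exists>d>0. \<forall>x y. x \<le> t \<and> t \<le> y \<and> y - x < d \<longrightarrow> a \<le> x \<and> y \<le> b \<longrightarrow> P x y"
      by (rule exI[of _ d]) (use d t in auto)
  qed (use assms(2) in \<open>meson order_trans\<close>)
  then show ?thesis by simp
qed

text \<open>The function \<open>g\<close> is defined for all pairs, but its values mean something
  only for two points in a common \<open>N z\<close>. Nothing like continuity is required of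
  \<open>g\<close>, because it will come from an arbitrary choice of chambers.\<close>

locale local_cocycle = group G for G :: "('b, 'c) monoid_scheme" (structure) +
  fixes M :: "'a::metric_space set" and N :: "'a \<Rightarrow> 'a set" and g :: "'a \<Rightarrow> 'a \<Rightarrow> 'b"
  assumes nbhd: "z \<in> M \<Longrightarrow> open (N z) \<and> z \<in> N z"
    and closed: "z \<in> M \<Longrightarrow> x \<in> N z \<Longrightarrow> y \<in> N z \<Longrightarrow> g x y \<in> carrier G"
    and cocycle: "z \<in> M \<Longrightarrow> x \<in> N z \<Longrightarrow> y \<in> N z \<Longrightarrow> y' \<in> N z \<Longrightarrow> g x y \<otimes> g y y' = g x y'"
begin

lemma cocycle_refl:
  assumes "z \<in> M" "x \<in> N z"
  shows "g x x = \<one>"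
  using cocycle[OF assms(1) assms(2) assms(2) assms(2)] closed[OF assms(1) assms(2) assms(2)]
  by (simp add: r_cancel_one)

text \<open>A lift of \<open>p\<close> is a section over \<open>p\<close> of the covering with fibre \<open>G\<close> whose transition functions
  are given by \<open>g\<close>.\<close>

definition lift :: "(real \<Rightarrow> 'a) \<Rightarrow> (real \<Rightarrow> 'b) \<Rightarrow> real \<Rightarrow> real \<Rightarrow> bool" where
  "lift p h a b \<longleftrightarrow> (\<forall>t\<in>{a..b}. h t \<in> carrier G \<and> (\<exists>d>0. \<forall>t'\<in>{a..b}. \<bar>t' - t\<bar> < d \<longrightarrow>
     g (p t) (p t') \<in> carrier G \<and> h t' = h t \<otimes> g (p t) (p t')))"

text \<open>The holonomy of \<open>p\<close> over an interval. It is a relation because a lift need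
  not exist over an arbitrary function \<open>p\<close>; uniqueness and existence are separate
  lemmas.\<close>

definition transport :: "(real \<Rightarrow> 'a) \<Rightarrow> real \<Rightarrow> real \<Rightarrow> 'b \<Rightarrow> bool" where
  "transport p a b u \<longleftrightarrow> (\<exists>h. lift p h a b \<and> h a = \<one> \<and> h b = u)"

lemma liftE:
  assumes "lift p h a b" "t \<in> {a..b}"
  obtains d where "d > 0" "\<And>t'. t' \<in> {a..b} \<Longrightarrow> \<bar>t' - t\<bar> < d \<Longrightarrow>
    g (p t) (p t') \<in> carrier G \<and> h t' = h t \<otimes> g (p t) (p t')"
  using assms unfolding lift_def by meson

lemma lift_closed: "lift p h a b \<Longrightarrow> t \<in> {a..b} \<Longrightarrow> h t \<in> carrier G"
  unfolding lift_def by blast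

text \<open>Near \<open>t\<close> both lifts arise from their values at \<open>t\<close> by right
  multiplication with the same element, so by cancellation the truth value of \<open>h = k\<close>
  is locally constant.\<close>

lemma lift_unique:
  assumes "lift p h a b" "lift p k a b" "h a = k a" "a \<le> b"
  shows "h b = k b"
proof -
  have "h a = k a \<longleftrightarrow> h b = k b"
  proof (rule Bolzano_within[where P = "\<lambda>x y. h x = k x \<longleftrightarrow> h y = k y", OF \<open>a \<le> b\<close>])
    fix t assume t: "t \<in> {a..b}"
    obtain d where d: "d > 0" "\<And>t'. t' \<in> {a..b} \<Longrightarrow> \<bar>t' - t\<bar> < d \<Longrightarrow>
        g (p t) (p t') \<in> carrier G \<and> h t' = h t \<otimes> g (p t) (p t')"
      using liftE[OF assms(1) t] by metis
    obtain e where e: "e > 0" "\<And>t'. t' \<in> {a..b} \<Longrightarrow> \<bar>t' - t\<bar> < e \<Longrightarrow>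
        g (p t) (p t') \<in> carrier G \<and> k t' = k t \<otimes> g (p t) (p t')"
      using liftE[OF assms(2) t] by metis
    have ht: "h t \<in> carrier G" "k t \<in> carrier G"
      using lift_closed[OF assms(1) t] lift_closed[OF assms(2) t] .
    have eq: "h t' = k t' \<longleftrightarrow> h t = k t" if "t' \<in> {a..b}" "\<bar>t' - t\<bar> < min d e" for t'
      using d(2)[of t'] e(2)[of t'] that ht by simp
    show "\<exists>d>0. \<forall>x y. x \<in> {a..b} \<and> y \<in> {a..b} \<and> x \<le> t \<and> t \<le> y \<and> y - x < d \<longrightarrow> (h x = k x \<longleftrightarrow> h y = k y)"
    proof (intro exI conjI allI impI)
      show "min d e > 0" using d e by simp
      fix x y assume xy: "x \<in> {a..b} \<and> y \<in> {a..b} \<and> x \<le> t \<and> t \<le> y \<and> y - x < min d e"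
      then have "x \<in> {a..b}" "\<bar>x - t\<bar> < min d e" "y \<in> {a..b}" "\<bar>y - t\<bar> < min d e" by auto
      then show "h x = k x \<longleftrightarrow> h y = k y" using eq[of x] eq[of y] by blast
    qed
  qed auto
  then show ?thesis using assms(3) by simp
qed

lemma transport_unique: "transport p a b u \<Longrightarrow> transport p a b v \<Longrightarrow> a \<le> b \<Longrightarrow> u = v"
  unfolding transport_def using lift_unique by metis

lemma transport_closed: "transport p a b u \<Longrightarrow> a \<le> b \<Longrightarrow> u \<in> carrier G"
  unfolding transport_def using lift_closed by force

text \<open>Lifts are constrained only by right multiplication, so left translation acts on them.
  This allows a lift to be restarted with any initial value.\<close>

lemma lift_mult_left:
  assumes "lift p h a b" "c \<in> carrier G"
  shows "lift p (\<lambda>t. c \<otimes> h t) a b"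
  unfolding lift_def
proof (intro ballI conjI)
  fix t assume t: "t \<in> {a..b}"
  show "c \<otimes> h t \<in> carrier G" using lift_closed[OF assms(1) t] assms(2) by simp
  obtain d where d: "d > 0" "\<And>t'. t' \<in> {a..b} \<Longrightarrow> \<bar>t' - t\<bar> < d \<Longrightarrow>
      g (p t) (p t') \<in> carrier G \<and> h t' = h t \<otimes> g (p t) (p t')"
    using liftE[OF assms(1) t] by metis
  show "\<exists>d>0. \<forall>t'\<in>{a..b}. \<bar>t' - t\<bar> < d \<longrightarrow>
      g (p t) (p t') \<in> carrier G \<and> c \<otimes> h t' = c \<otimes> h t \<otimes> g (p t) (p t')"
    using d lift_closed[OF assms(1) t] assms(2) by (metis m_assoc)
qed

lemma lift_glue:
  assumes h: "lift p h a b" and k: "lift p k b c" and eq: "h b = k b" and "a \<le> b" "b \<le> c"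
  shows "lift p (\<lambda>t. if t \<le> b then h t else k t) a c"
  unfolding lift_def
proof (intro ballI conjI)
  fix t assume t: "t \<in> {a..c}"
  show "(if t \<le> b then h t else k t) \<in> carrier G"
    using t lift_closed[OF h, of t] lift_closed[OF k, of t] by auto
  consider "t < b" | "t = b" | "t > b" by linarith
  then show "\<exists>d>0. \<forall>t'\<in>{a..c}. \<bar>t' - t\<bar> < d \<longrightarrow> g (p t) (p t') \<in> carrier G \<and>
      (if t' \<le> b then h t' else k t') = (if t \<le> b then h t else k t) \<otimes> g (p t) (p t')"
  proof cases
    case 1
    then have "t \<in> {a..b}" using t by simp
    from liftE[OF h this] obtain d where d: "d > 0" "\<And>t'. t' \<in> {a..b} \<Longrightarrow> \<bar>t' - t\<bar> < d \<Longrightarrow>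
        g (p t) (p t') \<in> carrier G \<and> h t' = h t \<otimes> g (p t) (p t')" by metis
    show ?thesis
      by (rule exI[of _ "min d (b - t)"]) (use d 1 in auto)
  next
    \<comment> \<open>At the junction the two one-sided conditions compare with the same value
      \<open>h b = k b\<close>, so the smaller radius serves both sides.\<close>
    case 2
    then have "t \<in> {a..b}" "t \<in> {b..c}" using t by auto
    from liftE[OF h this(1)] obtain d where d: "d > 0" "\<And>t'. t' \<in> {a..b} \<Longrightarrow> \<bar>t' - t\<bar> < d \<Longrightarrow>
        g (p t) (p t') \<in> carrier G \<and> h t' = h t \<otimes> g (p t) (p t')" by metis
    from liftE[OF k \<open>t \<in> {b..c}\<close>] obtain e where e: "e > 0" "\<And>t'. t' \<in> {b..c} \<Longrightarrow> \<bar>t' - t\<bar> < e \<Longrightarrow>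
        g (p t) (p t') \<in> carrier G \<and> k t' = k t \<otimes> g (p t) (p t')" by metis
    show ?thesis
    proof (intro exI[of _ "min d e"] conjI ballI impI)
      show "min d e > 0" using d(1) e(1) by simp
      fix t' assume t': "t' \<in> {a..c}" "\<bar>t' - t\<bar> < min d e"
      show "g (p t) (p t') \<in> carrier G" using d(2)[of t'] e(2)[of t'] t' by (cases "t' \<le> b") auto
      show "(if t' \<le> b then h t' else k t') = (if t \<le> b then h t else k t) \<otimes> g (p t) (p t')"
      proof (cases "t' \<le> b")
        case True
        then show ?thesis using d(2)[of t'] t' 2 by simp
      next
        case False
        then have "k t' = k b \<otimes> g (p t) (p t')" using e(2)[of t'] t' 2 by simp
        then show ?thesis using False 2 by (simp add: eq)
      qed
    qed
  next
    case 3
    then have "t \<in> {b..c}" using t by simp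
    from liftE[OF k this] obtain d where d: "d > 0" "\<And>t'. t' \<in> {b..c} \<Longrightarrow> \<bar>t' - t\<bar> < d \<Longrightarrow>
        g (p t) (p t') \<in> carrier G \<and> k t' = k t \<otimes> g (p t) (p t')" by metis
    show ?thesis
      by (rule exI[of _ "min d (t - b)"]) (use d 3 in auto)
  qed
qed

lemma transport_trans:
  assumes "transport p a b u" "transport p b c v" "a \<le> b" "b \<le> c"
  shows "transport p a c (u \<otimes> v)"
proof -
  obtain h k where h: "lift p h a b" "h a = \<one>" "h b = u" and k: "lift p k b c" "k b = \<one>" "k c = v"
    using assms unfolding transport_def by blast
  have u: "u \<in> carrier G" using transport_closed assms by blast
  have v: "v \<in> carrier G" using transport_closed assms by blast
  have l: "lift p (\<lambda>t. u \<otimes> k t) b c" by (rule lift_mult_left[OF k(1) u])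
  have l': "lift p (\<lambda>t. if t \<le> b then h t else u \<otimes> k t) a c"
    by (rule lift_glue[OF h(1) l]) (use assms h k u in auto)
  \<comment> \<open>If \<open>c = b\<close> the glued function takes its value from
    \<open>h\<close>; then \<open>v\<close> is the initial value \<one> of \<open>k\<close>.\<close>
  have "(if c \<le> b then h c else u \<otimes> k c) = u \<otimes> v"
    using k h assms r_one[OF u] by (cases "c = b") simp_all
  then show ?thesis unfolding transport_def
    by (intro exI[of _ "\<lambda>t. if t \<le> b then h t else u \<otimes> k t"]) (use l' h assms in auto)
qed

text \<open>Inside one neighbourhood the cocycle identity says that \<open>g (p a) (p t)\<close>, as
  a function of \<open>t\<close>, is a lift. The identity holds at every distance, hence the
  arbitrary radius 1.\<close>

lemma transport_in_nbhd:
  assumes "z \<in> M" "p ` {a..b} \<subseteq> N z" "a \<le> b"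
  shows "transport p a b (g (p a) (p b))"
proof -
  have "lift p (\<lambda>t. g (p a) (p t)) a b"
    unfolding lift_def
  proof (intro ballI conjI)
    fix t assume t: "t \<in> {a..b}"
    then have in_N: "p a \<in> N z" "p t \<in> N z" using assms by auto
    then show "g (p a) (p t) \<in> carrier G" using closed assms(1) by blast
    have "\<forall>t'\<in>{a..b}. \<bar>t' - t\<bar> < 1 \<longrightarrow> g (p t) (p t') \<in> carrier G \<and>
        g (p a) (p t') = g (p a) (p t) \<otimes> g (p t) (p t')"
      using in_N assms cocycle[OF assms(1) in_N] closed[OF assms(1)] by (metis image_subset_iff)
    then show "\<exists>d>0. \<forall>t'\<in>{a..b}. \<bar>t' - t\<bar> < d \<longrightarrow> g (p t) (p t') \<in> carrier G \<and>
        g (p a) (p t') = g (p a) (p t) \<otimes> g (p t) (p t')"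
      using zero_less_one by blast
  qed
  moreover have "g (p a) (p a) = \<one>" by (rule cocycle_refl[OF assms(1)]) (use assms in force)
  ultimately show ?thesis unfolding transport_def by blast
qed

lemma transport_exists:
  assumes "path p" "path_image p \<subseteq> M"
  shows "\<exists>u. transport p 0 1 u"
proof (rule Bolzano_within[where P = "\<lambda>x y. \<exists>u. transport p x y u"])
  fix t :: real assume t: "t \<in> {0..1}"
  then have z: "p t \<in> M" using assms by (auto simp: path_image_def)
  then obtain e where e: "e > 0" "ball (p t) e \<subseteq> N (p t)" using nbhd open_contains_ball by blast
  then obtain d where d: "d > 0" "\<And>t'. t' \<in> {0..1} \<Longrightarrow> dist t' t < d \<Longrightarrow> dist (p t') (p t) < e"
    using assms(1) t unfolding path_def continuous_on_iff by metis
  show "\<exists>d>0. \<forall>x y. x \<in> {0..1} \<and> y \<in> {0..1} \<and> x \<le> t \<and> t \<le> y \<and> y - x < d \<longrightarrow> (\<exists>u. transport p x y u)"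
  proof (intro exI[of _ d] conjI allI impI)
    fix x y assume xy: "x \<in> {0..1} \<and> y \<in> {0..1} \<and> x \<le> t \<and> t \<le> y \<and> y - x < d"
    have "p ` {x..y} \<subseteq> N (p t)"
    proof
      fix w assume "w \<in> p ` {x..y}"
      then obtain t' where t': "t' \<in> {x..y}" "w = p t'" by blast
      have "dist (p t') (p t) < e" by (rule d(2)) (use t' xy in \<open>auto simp: dist_real_def\<close>)
      then show "w \<in> N (p t)" using e t' by (auto simp: dist_commute)
    qed
    then show "\<exists>u. transport p x y u" using transport_in_nbhd[OF z] xy by (meson order_trans)
  qed (fact d)
next
  fix x y z :: real
  assume "x \<le> y" "y \<le> z" "\<exists>u. transport p x y u" "\<exists>u. transport p y z u"
  then show "\<exists>u. transport p x z u" using transport_trans by blast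
qed simp

text \<open>Slopes other than 1 serve the two halves of a joined path; \<open>m = 1\<close>,
  \<open>c = 0\<close> replaces a path by one that agrees with it on the interval.\<close>

lemma transport_reparam:
  assumes "transport p (m * a + c) (m * b + c) u" "m > 0" "\<And>t. t \<in> {a..b} \<Longrightarrow> q t = p (m * t + c)"
  shows "transport q a b u"
proof -
  obtain h where h: "lift p h (m * a + c) (m * b + c)" "h (m * a + c) = \<one>" "h (m * b + c) = u"
    using assms(1) unfolding transport_def by blast
  have "lift q (\<lambda>t. h (m * t + c)) a b"
    unfolding lift_def
  proof (intro ballI conjI)
    fix t assume t: "t \<in> {a..b}"
    then have t': "m * t + c \<in> {m * a + c..m * b + c}" using assms(2) by simp
    then show "h (m * t + c) \<in> carrier G" using lift_closed[OF h(1)] by blast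
    from liftE[OF h(1) t'] obtain d where d: "d > 0" "\<And>t'. t' \<in> {m * a + c..m * b + c} \<Longrightarrow>
        \<bar>t' - (m * t + c)\<bar> < d \<Longrightarrow> g (p (m * t + c)) (p t') \<in> carrier G \<and>
        h t' = h (m * t + c) \<otimes> g (p (m * t + c)) (p t')" by metis
    show "\<exists>d>0. \<forall>t'\<in>{a..b}. \<bar>t' - t\<bar> < d \<longrightarrow> g (q t) (q t') \<in> carrier G \<and>
        h (m * t' + c) = h (m * t + c) \<otimes> g (q t) (q t')"
    proof (intro exI[of _ "d / m"] conjI ballI impI)
      show "d / m > 0" using d assms by simp
      fix t' assume "t' \<in> {a..b}" "\<bar>t' - t\<bar> < d / m"
      moreover have "(m * t' + c) - (m * t + c) = m * (t' - t)" by (simp add: algebra_simps)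
      ultimately have "\<bar>(m * t' + c) - (m * t + c)\<bar> < d"
        using assms(2) by (simp only: abs_mult) (simp add: field_simps)
      moreover have "m * t' + c \<in> {m * a + c..m * b + c}" using \<open>t' \<in> {a..b}\<close> assms(2) by simp
      ultimately show "g (q t) (q t') \<in> carrier G" "h (m * t' + c) = h (m * t + c) \<otimes> g (q t) (q t')"
        using d(2) assms(3) t \<open>t' \<in> {a..b}\<close> by auto
    qed
  qed
  then show ?thesis unfolding transport_def using h by blast
qed

lemma transport_joinpaths:
  assumes "transport p 0 1 u" "transport q 0 1 v" "pathfinish p = pathstart q"
  shows "transport (p +++ q) 0 1 (u \<otimes> v)"
proof (rule transport_trans)
  show "transport (p +++ q) 0 (1/2) u"
    by (rule transport_reparam[of p 2 0 0]) (use assms in \<open>auto simp: joinpaths_def\<close>)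
  \<comment> \<open>At the midpoint \<open>+++\<close> takes its value from \<open>p\<close>, so the
    formula for the second half needs the common endpoint.\<close>
  have eq: "p 1 = q 0" using assms(3) by (simp add: pathstart_def pathfinish_def)
  show "transport (p +++ q) (1/2) 1 v"
  proof (rule transport_reparam[of q 2 _ "-1"])
    fix t :: real assume "t \<in> {1/2..1}"
    then show "(p +++ q) t = q (2 * t + -1)"
      using eq by (cases "2 * t = 1") (auto simp: joinpaths_def)
  qed (use assms in auto)
qed auto

text \<open>Take \<open>e\<close> to be a Lebesgue number of the cover by the sets
  \<open>N z\<close>. Then \<open>p t\<close> and \<open>q t\<close> always share a neighbourhood,
  and a lift \<open>h\<close> over \<open>p\<close> is carried to the lift
  \<open>h t \<otimes> g (p t) (q t)\<close> over \<open>q\<close>. The correction factor is trivial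
  at both ends because the endpoints agree.\<close>

lemma transport_nearby:
  assumes p: "path p" "path_image p \<subseteq> M"
  obtains e where "e > 0" "\<And>q u. path q \<Longrightarrow> pathstart q = pathstart p \<Longrightarrow> pathfinish q = pathfinish p \<Longrightarrow>
    (\<And>t. t \<in> {0..1} \<Longrightarrow> dist (p t) (q t) < e) \<Longrightarrow> transport p 0 1 u \<Longrightarrow> transport q 0 1 u"
proof -
  have "\<exists>e>0. \<forall>x\<in>path_image p. \<exists>B\<in>N ` M. ball x e \<subseteq> B"
    by (rule Heine_Borel_lemma[of "path_image p" "N ` M"])
       (use compact_path_image[OF p(1)] p nbhd in auto)
  then obtain e where e: "e > 0" "\<And>x. x \<in> path_image p \<Longrightarrow> \<exists>z\<in>M. ball x e \<subseteq> N z" by auto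
  show ?thesis
  proof (rule that[OF e(1)])
    fix q u assume q: "path q" "pathstart q = pathstart p" "pathfinish q = pathfinish p"
      and near: "\<And>t. t \<in> {0..1} \<Longrightarrow> dist (p t) (q t) < e" and "transport p 0 1 u"
    then obtain h where h: "lift p h 0 1" "h 0 = \<one>" "h 1 = u" unfolding transport_def by blast
    have one: "g (p t) (p t) = \<one>" if "t \<in> {0..1}" for t
    proof -
      have "p t \<in> M" using p(2) that unfolding path_image_def by blast
      then show ?thesis using cocycle_refl nbhd by blast
    qed
    have "lift q (\<lambda>t. h t \<otimes> g (p t) (q t)) 0 1"
      unfolding lift_def
    proof (intro ballI conjI)
      fix t :: real assume t: "t \<in> {0..1}"
      then obtain z where z: "z \<in> M" "ball (p t) e \<subseteq> N z"
        using e(2)[of "p t"] by (auto simp: path_image_def)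
      have ptN: "p t \<in> N z" "q t \<in> N z" using z near[OF t] e(1) by auto
      then show "h t \<otimes> g (p t) (q t) \<in> carrier G"
        using lift_closed[OF h(1) t] closed[OF z(1)] by simp
      have "continuous_on {0..1} p" "continuous_on {0..1} q" using p q by (auto simp: path_def)
      \<comment> \<open>With this radius the triangle inequality keeps \<open>q t'\<close> within
        \<open>e\<close> of \<open>p t\<close>, so \<open>p t\<close>, \<open>p t'\<close>,
        \<open>q t\<close> and \<open>q t'\<close> all lie in one \<open>N z\<close>.\<close>
      moreover have "e - dist (p t) (q t) > 0" using near[OF t] by simp
      ultimately obtain d1 d2 where d1: "d1 > 0" "\<And>t'. t' \<in> {0..1} \<Longrightarrow> dist t' t < d1 \<Longrightarrow> dist (p t') (p t) < e"
        and d2: "d2 > 0" "\<And>t'. t' \<in> {0..1} \<Longrightarrow> dist t' t < d2 \<Longrightarrow> dist (q t') (q t) < e - dist (p t) (q t)"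
        using t e(1) unfolding continuous_on_iff by metis
      from liftE[OF h(1) t] obtain d where d: "d > 0" "\<And>t'. t' \<in> {0..1} \<Longrightarrow> \<bar>t' - t\<bar> < d \<Longrightarrow>
        g (p t) (p t') \<in> carrier G \<and> h t' = h t \<otimes> g (p t) (p t')" by metis
      show "\<exists>d>0. \<forall>t'\<in>{0..1}. \<bar>t' - t\<bar> < d \<longrightarrow> g (q t) (q t') \<in> carrier G \<and>
          h t' \<otimes> g (p t') (q t') = h t \<otimes> g (p t) (q t) \<otimes> g (q t) (q t')"
      proof (intro exI[of _ "min d (min d1 d2)"] ballI impI conjI)
        show "min d (min d1 d2) > 0" using d d1 d2 by simp
        fix t' :: real assume t': "t' \<in> {0..1}" "\<bar>t' - t\<bar> < min d (min d1 d2)"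
        have "dist (p t) (p t') < e" using d1(2)[of t'] t' by (auto simp: dist_real_def dist_commute)
        moreover have "dist (p t) (q t') < e"
          using d2(2)[of t'] t' dist_triangle[of "p t" "q t'" "q t"] by (auto simp: dist_real_def dist_commute)
        ultimately have N': "p t' \<in> N z" "q t' \<in> N z" using z by auto
        show "g (q t) (q t') \<in> carrier G" using closed z ptN N' by blast
        have ht: "h t \<in> carrier G" using lift_closed[OF h(1) t] .
        have "h t' \<otimes> g (p t') (q t') = h t \<otimes> (g (p t) (p t') \<otimes> g (p t') (q t'))"
          using d(2)[of t'] t' ht closed[OF z(1)] N' ptN by (simp add: m_assoc)
        also have "\<dots> = h t \<otimes> (g (p t) (q t) \<otimes> g (q t) (q t'))"
          using cocycle[OF z(1)] N' ptN by simp
        finally show "h t' \<otimes> g (p t') (q t') = h t \<otimes> g (p t) (q t) \<otimes> g (q t) (q t')"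
          using ht closed[OF z(1)] N' ptN by (simp add: m_assoc)
      qed
    qed
    moreover have "q 0 = p 0" "q 1 = p 1" using q by (auto simp: pathstart_def pathfinish_def)
    moreover have "u \<in> carrier G" using lift_closed[OF h(1), of 1] h by simp
    ultimately show "transport q 0 1 u"
      unfolding transport_def using h one[of 0] one[of 1]
      by (intro exI[of _ "\<lambda>t. h t \<otimes> g (p t) (q t)"]) auto
  qed
qed

text \<open>The holonomy is locally constant in the homotopy parameter by
  \<open>transport_nearby\<close>, hence constant on the unit interval.\<close>

lemma transport_homotopic:
  assumes "homotopic_paths M p q" "transport p 0 1 u"
  shows "transport q 0 1 u"
proof -
  obtain H :: "real \<times> real \<Rightarrow> 'a" where "continuous_on ({0..1} \<times> {0..1}) H" "H ` ({0..1} \<times> {0..1}) \<subseteq> M"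
      "\<forall>x\<in>{0..1}. H (0, x) = p x" "\<forall>x\<in>{0..1}. H (1, x) = q x"
      "\<forall>s\<in>{0..1}. pathstart (H \<circ> Pair s) = pathstart p \<and> pathfinish (H \<circ> Pair s) = pathfinish p"
    using assms(1) unfolding homotopic_paths image_subset_iff_funcset[symmetric] by (elim exE conjE) metis
  then have H: "continuous_on ({0..1} \<times> {0..1}) H" "H ` ({0..1} \<times> {0..1}) \<subseteq> M"
      "x \<in> {0..1} \<Longrightarrow> H (0, x) = p x" "x \<in> {0..1} \<Longrightarrow> H (1, x) = q x"
      "s \<in> {0..1} \<Longrightarrow> pathstart (H \<circ> Pair s) = pathstart p \<and> pathfinish (H \<circ> Pair s) = pathfinish p"
    for x s by simp_all
  have pathH: "path (H \<circ> Pair s)" "path_image (H \<circ> Pair s) \<subseteq> M" if "s \<in> {0..1}" for s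
  proof -
    have "continuous_on {0..1} (H \<circ> Pair s)"
      by (intro continuous_on_compose continuous_intros continuous_on_subset[OF H(1)]) (use that in auto)
    then show "path (H \<circ> Pair s)" by (simp add: path_def)
    show "path_image (H \<circ> Pair s) \<subseteq> M" using H(2) that by (auto simp: path_image_def)
  qed
  \<comment> \<open>Uniformity makes neighbouring stages of the homotopy close at all times
    \<open>t\<close> at once.\<close>
  have unif: "uniformly_continuous_on ({0..1} \<times> {0..1}) H"
    using compact_uniformly_continuous[OF H(1)] by (simp add: compact_Times)
  have "\<forall>u. transport (H \<circ> Pair 0) 0 1 u \<longleftrightarrow> transport (H \<circ> Pair 1) 0 1 u"
  proof (rule Bolzano_within[where P = "\<lambda>x y. \<forall>u. transport (H \<circ> Pair x) 0 1 u \<longleftrightarrow> transport (H \<circ> Pair y) 0 1 u"])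
    fix s :: real assume s: "s \<in> {0..1}"
    obtain e where e: "e > 0" "\<And>q u. path q \<Longrightarrow> pathstart q = pathstart (H \<circ> Pair s) \<Longrightarrow>
      pathfinish q = pathfinish (H \<circ> Pair s) \<Longrightarrow> (\<And>t. t \<in> {0..1} \<Longrightarrow> dist ((H \<circ> Pair s) t) (q t) < e) \<Longrightarrow>
      transport (H \<circ> Pair s) 0 1 u \<Longrightarrow> transport q 0 1 u"
      using transport_nearby[OF pathH[OF s]] by metis
    obtain d where d: "d > 0" "\<And>x y. x \<in> {0..1} \<times> {0..1} \<Longrightarrow> y \<in> {0..1} \<times> {0..1} \<Longrightarrow> dist y x < d \<Longrightarrow> dist (H y) (H x) < e"
      using unif e(1) unfolding uniformly_continuous_on_def by metis
    have imp: "transport (H \<circ> Pair s') 0 1 u" if "s' \<in> {0..1}" "\<bar>s' - s\<bar> < d" "transport (H \<circ> Pair s) 0 1 u" for s' u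
    proof (rule e(2))
      show "dist ((H \<circ> Pair s) t) ((H \<circ> Pair s') t) < e" if "t \<in> {0..1}" for t
        using d(2)[of "(s', t)" "(s, t)"] that s \<open>s' \<in> _\<close> \<open>\<bar>s' - s\<bar> < d\<close>
        by (simp add: dist_Pair_Pair dist_real_def abs_minus_commute)
    qed (use that pathH H(5) s in simp_all)
    \<comment> \<open>The converse of \<open>imp\<close>: the path at stage \<open>s\<close> has
      some holonomy, \<open>imp\<close> carries it to stage \<open>s'\<close>, and uniqueness there
      identifies it with \<open>u\<close>.\<close>
    have iff: "transport (H \<circ> Pair s') 0 1 u \<longleftrightarrow> transport (H \<circ> Pair s) 0 1 u" if "s' \<in> {0..1}" "\<bar>s' - s\<bar> < d" for s' u
      using imp[OF that] transport_unique transport_exists[OF pathH[OF s]] zero_le_one by metis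
    show "\<exists>d>0. \<forall>x y. x \<in> {0..1} \<and> y \<in> {0..1} \<and> x \<le> s \<and> s \<le> y \<and> y - x < d \<longrightarrow>
        (\<forall>u. transport (H \<circ> Pair x) 0 1 u \<longleftrightarrow> transport (H \<circ> Pair y) 0 1 u)"
    proof (intro exI[of _ d] conjI allI impI)
      fix x y u assume xy: "x \<in> {0..1} \<and> y \<in> {0..1} \<and> x \<le> s \<and> s \<le> y \<and> y - x < d"
      show "transport (H \<circ> Pair x) 0 1 u \<longleftrightarrow> transport (H \<circ> Pair y) 0 1 u"
        using iff[of x u] iff[of y u] xy by auto
    qed (fact d)
  qed auto
  then have "transport (H \<circ> Pair 0) 0 1 u \<longleftrightarrow> transport (H \<circ> Pair 1) 0 1 u" by simp
  moreover have "transport (H \<circ> Pair 0) 0 1 u"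
    by (rule transport_reparam[of p 1 _ 0]) (use assms H in auto)
  moreover have "transport q 0 1 u" if "transport (H \<circ> Pair 1) 0 1 u"
    by (rule transport_reparam[of "H \<circ> Pair 1" 1 _ 0]) (use that H in auto)
  ultimately show ?thesis by blast
qed

end

section \<open>Change of base point\<close>

lemma homotopic_paths_in_convex:
  fixes K :: "'a::real_normed_vector set"
  assumes "convex K" "K \<subseteq> M" "path p" "path q" "path_image p \<subseteq> K" "path_image q \<subseteq> K"
    "pathstart p = pathstart q" "pathfinish p = pathfinish q"
  shows "homotopic_paths M p q"
proof (rule homotopic_paths_linear)
  fix t :: real assume t: "t \<in> {0..1}"
  then have "p t \<in> K" "q t \<in> K" using assms by (auto simp: path_image_def)
  then show "closed_segment (p t) (q t) \<subseteq> M" using assms closed_segment_subset by blast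
qed (use assms in auto)

lemma homotopic_paths_cancel_left:
  fixes X :: "'a::real_normed_vector set"
  assumes "path c" "path_image c \<subseteq> X" "path r" "path_image r \<subseteq> X" "pathstart r = pathfinish c"
  shows "homotopic_paths X (reversepath c +++ (c +++ r)) r"
proof -
  have "homotopic_paths X (reversepath c +++ (c +++ r)) ((reversepath c +++ c) +++ r)"
    using assms by (intro homotopic_paths_assoc) auto
  moreover have "homotopic_paths X ((reversepath c +++ c) +++ r) (linepath (pathfinish c) (pathfinish c) +++ r)"
    using assms homotopic_paths_linv[of c X] by (intro homotopic_paths_join) auto
  moreover have "homotopic_paths X (linepath (pathfinish c) (pathfinish c) +++ r) r"
    using homotopic_paths_lid[of r X] assms by simp
  ultimately show ?thesis by (meson homotopic_paths_trans)
qed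

text \<open>Reassociating brings \<open>reversepath c\<close> next to \<open>c\<close>, where they
  cancel. The free tail \<open>r\<close> lets one lemma serve both multiplicativity of conjugation
  by \<open>c\<close> and its invertibility.\<close>

lemma homotopic_paths_conjugate_join:
  fixes X :: "'a::real_normed_vector set"
  assumes c: "path c" "path_image c \<subseteq> X" and p: "p \<in> loops X (pathfinish c)"
    and r: "path r" "path_image r \<subseteq> X" "pathstart r = pathfinish c"
  shows "homotopic_paths X ((c +++ (p +++ reversepath c)) +++ (c +++ r)) (c +++ (p +++ r))"
proof -
  have p': "path p" "path_image p \<subseteq> X" "pathstart p = pathfinish c" "pathfinish p = pathfinish c"
    using p by (auto simp: loops_def)
  have "homotopic_paths X ((c +++ (p +++ reversepath c)) +++ (c +++ r)) (c +++ ((p +++ reversepath c) +++ (c +++ r)))"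
    using c p' r by (intro homotopic_paths_sym[OF homotopic_paths_assoc]) (auto simp: path_image_join)
  moreover have "homotopic_paths X (c +++ ((p +++ reversepath c) +++ (c +++ r))) (c +++ (p +++ (reversepath c +++ (c +++ r))))"
    using c p' r by (intro homotopic_paths_join homotopic_paths_sym[OF homotopic_paths_assoc]) (auto simp: path_image_join)
  moreover have "homotopic_paths X (c +++ (p +++ (reversepath c +++ (c +++ r)))) (c +++ (p +++ r))"
    using c p' r by (intro homotopic_paths_join homotopic_paths_cancel_left) auto
  ultimately show ?thesis by (meson homotopic_paths_trans)
qed

lemma homotopic_paths_conjugate_inverse:
  fixes X :: "'a::real_normed_vector set"
  assumes c: "path c" "path_image c \<subseteq> X" and p: "p \<in> loops X (pathfinish c)"
  shows "homotopic_paths X (reversepath c +++ ((c +++ (p +++ reversepath c)) +++ c)) p"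
proof -
  have p': "path p" "path_image p \<subseteq> X" "pathstart p = pathfinish c" "pathfinish p = pathfinish c"
    using p by (auto simp: loops_def)
  \<comment> \<open>A constant tail brings the final \<open>c\<close> into the form
    \<open>c +++ r\<close>.\<close>
  let ?y = "linepath (pathfinish c) (pathfinish c)"
  have y: "path_image ?y \<subseteq> X" using c pathfinish_in_path_image[of c] by auto
  have "homotopic_paths X ((c +++ (p +++ reversepath c)) +++ c) ((c +++ (p +++ reversepath c)) +++ (c +++ ?y))"
    using c p' homotopic_paths_rid[of c X]
    by (intro homotopic_paths_join) (auto simp: path_image_join homotopic_paths_sym)
  moreover have "homotopic_paths X ((c +++ (p +++ reversepath c)) +++ (c +++ ?y)) (c +++ (p +++ ?y))"
    using c p y by (intro homotopic_paths_conjugate_join) auto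
  moreover have "homotopic_paths X (c +++ (p +++ ?y)) (c +++ p)"
    using c p' homotopic_paths_rid[of p X] by (intro homotopic_paths_join) auto
  ultimately have "homotopic_paths X ((c +++ (p +++ reversepath c)) +++ c) (c +++ p)"
    by (meson homotopic_paths_trans)
  then have "homotopic_paths X (reversepath c +++ ((c +++ (p +++ reversepath c)) +++ c)) (reversepath c +++ (c +++ p))"
    using c p' by (intro homotopic_paths_join[of X "reversepath c"]) auto
  then show ?thesis
    using homotopic_paths_cancel_left[OF c p'(1,2)] p' by (meson homotopic_paths_trans)
qed

lemma path_class_SOME:
  assumes "path p" "path_image p \<subseteq> X"
  shows "homotopic_paths X p (SOME q. q \<in> path_class X p)"
proof -
  have "(SOME q. q \<in> path_class X p) \<in> path_class X p"
    by (rule someI[of _ p]) (use assms in \<open>simp add: path_class_def\<close>)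
  then show ?thesis by (simp add: path_class_def)
qed

lemma path_class_eq_iff:
  assumes "path p" "path_image p \<subseteq> X"
  shows "path_class X p = path_class X q \<longleftrightarrow> homotopic_paths X p q"
proof
  assume "path_class X p = path_class X q"
  moreover have "p \<in> path_class X p" using assms by (simp add: path_class_def)
  ultimately show "homotopic_paths X p q"
    by (simp add: path_class_def homotopic_paths_sym)
qed (rule path_class_eq)

lemma fundamental_group_change_basepoint:
  fixes X :: "'a::real_normed_vector set"
  assumes c: "path c" "path_image c \<subseteq> X" "pathstart c = x" "pathfinish c = y"
  shows "fundamental_group X y \<cong> fundamental_group X x"
proof -
  let ?c = "\<lambda>p. c +++ (p +++ reversepath c)"
  let ?d = "\<lambda>q. reversepath c +++ (q +++ c)"
  have loop_c: "?c p \<in> loops X x" if "p \<in> loops X y" for p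
    using that c by (auto simp: loops_def path_image_join)
  have loop_d: "?d q \<in> loops X y" if "q \<in> loops X x" for q
    using that c by (auto simp: loops_def path_image_join)
  have hom_c: "homotopic_paths X (?c p) (?c p')" if "homotopic_paths X p p'" "p \<in> loops X y" for p p'
    using that c by (intro homotopic_paths_join) (auto simp: loops_def)
  have hom_d: "homotopic_paths X (?d p) (?d p')" if "homotopic_paths X p p'" "p \<in> loops X x" for p p'
    using that c by (intro homotopic_paths_join) (auto simp: loops_def)
  have dc: "homotopic_paths X (?d (?c p)) p" if "p \<in> loops X y" for p
    using homotopic_paths_conjugate_inverse[of c X p] c that by simp
  have cd: "homotopic_paths X (?c (?d q)) q" if "q \<in> loops X x" for q
    using homotopic_paths_conjugate_inverse[of "reversepath c" X q] c that by simp
  define F where "F A = path_class X (?c (SOME p. p \<in> A))" for A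
  have F: "F (path_class X p) = path_class X (?c p)" if p: "p \<in> loops X y" for p
  proof -
    have "homotopic_paths X p (SOME q. q \<in> path_class X p)"
      by (rule path_class_SOME) (use p in \<open>auto simp: loops_def\<close>)
    from path_class_eq[OF hom_c[OF this p]] show ?thesis by (simp add: F_def)
  qed
  have "F \<in> iso (fundamental_group X y) (fundamental_group X x)"
  proof (rule isoI)
    show "F \<in> hom (fundamental_group X y) (fundamental_group X x)"
    proof (rule homI)
      fix A assume "A \<in> carrier (fundamental_group X y)"
      then obtain p where p: "p \<in> loops X y" "A = path_class X p" by (auto simp: fundamental_group_def)
      then show "F A \<in> carrier (fundamental_group X x)"
        using F loop_c by (auto simp: fundamental_group_def)
      fix B assume "B \<in> carrier (fundamental_group X y)"
      then obtain q where q: "q \<in> loops X y" "B = path_class X q" by (auto simp: fundamental_group_def)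
      have p': "path p" "path_image p \<subseteq> X" "pathstart p = y" "pathfinish p = y"
        using p by (auto simp: loops_def)
      have q': "path q" "path_image q \<subseteq> X" "pathstart q = y" "pathfinish q = y"
        using q by (auto simp: loops_def)
      have "homotopic_paths X (?c p +++ ?c q) (c +++ (p +++ (q +++ reversepath c)))"
        using c p(1) q' by (intro homotopic_paths_conjugate_join) (auto simp: path_image_join)
      moreover have "homotopic_paths X (c +++ (p +++ (q +++ reversepath c))) (?c (p +++ q))"
        using c p' q' by (intro homotopic_paths_join homotopic_paths_assoc) auto
      ultimately have "homotopic_paths X (?c (p +++ q)) (?c p +++ ?c q)"
        by (meson homotopic_paths_trans homotopic_paths_sym)
      then show "F (A \<otimes>\<^bsub>fundamental_group X y\<^esub> B) = F A \<otimes>\<^bsub>fundamental_group X x\<^esub> F B"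
        unfolding p(2) q(2) fundamental_mult[OF p(1) q(1)] F[OF p(1)] F[OF q(1)]
          F[OF loops_join[OF p(1) q(1)]] fundamental_mult[OF loop_c[OF p(1)] loop_c[OF q(1)]]
        by (rule path_class_eq)
    qed
    show "bij_betw F (carrier (fundamental_group X y)) (carrier (fundamental_group X x))"
    proof (rule bij_betw_imageI)
      show "inj_on F (carrier (fundamental_group X y))"
      proof (rule inj_onI)
        fix A B assume "A \<in> carrier (fundamental_group X y)" "B \<in> carrier (fundamental_group X y)" and FAB: "F A = F B"
        then obtain p q where p: "p \<in> loops X y" "A = path_class X p" and q: "q \<in> loops X y" "B = path_class X q"
          by (auto simp: fundamental_group_def)
        have "path_class X (?c p) = path_class X (?c q)" using FAB F p q by simp
        then have "homotopic_paths X (?c p) (?c q)"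
          using loop_c[OF p(1)] by (subst (asm) path_class_eq_iff) (auto simp: loops_def)
        from hom_d[OF this loop_c[OF p(1)]] have "homotopic_paths X p q"
          using dc[OF p(1)] dc[OF q(1)] by (meson homotopic_paths_trans homotopic_paths_sym)
        then show "A = B" using p q path_class_eq by blast
      qed
      have "B \<in> F ` carrier (fundamental_group X y)" if B: "B \<in> carrier (fundamental_group X x)" for B
      proof -
        obtain q where q: "q \<in> loops X x" "B = path_class X q" using B by (auto simp: fundamental_group_def)
        have "F (path_class X (?d q)) = B"
          using F[OF loop_d[OF q(1)]] path_class_eq[OF cd[OF q(1)]] q(2) by simp
        then show "B \<in> F ` carrier (fundamental_group X y)"
          using loop_d[OF q(1)] by (auto simp: fundamental_group_def)
      qed
      then show "F ` carrier (fundamental_group X y) = carrier (fundamental_group X x)"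
        using F loop_c by (auto simp: fundamental_group_def)
    qed
  qed
  then show ?thesis by (rule is_isoI)
qed

section \<open>Chambers of a finite reflection group\<close>

lemma reflection_inner: "reflection a x \<bullet> y = x \<bullet> y - 2 * (x \<bullet> a) / (a \<bullet> a) * (a \<bullet> y)"
  by (simp add: reflection_def inner_diff_left)

lemma orthogonal_reflection: "orthogonal_transformation (reflection a)"
  using reflection_orthogonal[of a] by (simp add: orthogonal_group_def)

lemma reflection_reflection [simp]: "reflection a (reflection a x) = x"
  using reflection_involution[of a] by (metis comp_apply id_apply)

lemma reflection_self: "reflection a a = - a"
  by (cases "a = 0") (auto simp: reflection_def algebra_simps scaleR_2)

lemma reflection_conj:
  assumes "orthogonal_transformation w"
  shows "reflection (w a) (w x) = w (reflection a x)"
  using assms by (simp add: reflection_def orthogonal_transformation_def linear_diff linear_cmul)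

text \<open>Words are lists of vectors rather than of reflections, so that length and letters are
  available for induction and the inverse is the reversed list.\<close>

primrec reflection_prod :: "'a::euclidean_space list \<Rightarrow> 'a \<Rightarrow> 'a" where
  "reflection_prod [] = id"
| "reflection_prod (a # xs) = reflection a \<circ> reflection_prod xs"

lemma reflection_prod_append: "reflection_prod (xs @ ys) = reflection_prod xs \<circ> reflection_prod ys"
  by (induction xs) (auto simp: comp_assoc)

lemma orthogonal_reflection_prod: "orthogonal_transformation (reflection_prod xs)"
proof (induction xs)
  case (Cons a xs)
  then show ?case
    using orthogonal_transformation_compose[OF orthogonal_reflection] by (simp only: reflection_prod.simps)
qed (simp add: id_def)

lemma reflection_prod_rev [simp]: "reflection_prod (rev xs) (reflection_prod xs x) = x"
  by (induction xs arbitrary: x) (auto simp: reflection_prod_append)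

lemma reflection_prod_rev' [simp]: "reflection_prod xs (reflection_prod (rev xs) x) = x"
  using reflection_prod_rev[of "rev xs"] by simp

text \<open>The finiteness condition concerns the group generated by the simple reflections. It
  serves to find a chamber by maximising over that group.\<close>

locale simple_roots =
  fixes \<Phi> \<Delta> :: "'a::euclidean_space set"
  assumes root_system: "root_system \<Phi>" and simple_system: "simple_system \<Phi> \<Delta>"
    and finite_prods: "finite (reflection_prod ` lists \<Delta>)"
begin

lemma simple_root: "\<delta> \<in> \<Delta> \<Longrightarrow> \<delta> \<in> \<Phi>"
  using simple_system by (auto simp: simple_system_def)

lemma finite_roots: "finite \<Phi>"
  using root_system by (simp add: root_system_def)

lemma finite_simple: "finite \<Delta>"
  using finite_roots simple_root by (meson finite_subset subsetI)

lemma root_nonzero: "\<alpha> \<in> \<Phi> \<Longrightarrow> \<alpha> \<noteq> 0"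
  using root_system by (auto simp: root_system_def)

lemma root_multiple: "\<alpha> \<in> \<Phi> \<Longrightarrow> c *\<^sub>R \<alpha> \<in> \<Phi> \<Longrightarrow> c *\<^sub>R \<alpha> = \<alpha> \<or> c *\<^sub>R \<alpha> = - \<alpha>"
  using root_system span_mul[OF span_base, of \<alpha> "{\<alpha>}" c] unfolding root_system_def by blast

lemma uminus_root: "\<alpha> \<in> \<Phi> \<Longrightarrow> - \<alpha> \<in> \<Phi>"
  using root_system unfolding root_system_def by blast

lemma reflection_root: "\<alpha> \<in> \<Phi> \<Longrightarrow> \<beta> \<in> \<Phi> \<Longrightarrow> reflection \<alpha> \<beta> \<in> \<Phi>"
  using root_system unfolding root_system_def by blast

section \<open>Coordinates and heights of roots\<close>

definition dual :: "'a \<Rightarrow> 'a" where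
  "dual \<delta> = (SOME \<omega>. \<forall>\<delta>'\<in>\<Delta>. \<delta>' \<bullet> \<omega> = (if \<delta>' = \<delta> then 1 else 0))"

text \<open>By independence a linear functional \<open>g\<close> with the prescribed values exists,
  and the vector \<open>adjoint g 1\<close> represents it.\<close>

lemma inner_dual:
  assumes "\<delta>' \<in> \<Delta>"
  shows "\<delta>' \<bullet> dual \<delta> = (if \<delta>' = \<delta> then 1 else 0)"
proof -
  have "independent \<Delta>" using simple_system by (simp add: simple_system_def)
  then obtain g :: "'a \<Rightarrow> real" where g: "linear g" "\<And>x. x \<in> \<Delta> \<Longrightarrow> g x = (if x = \<delta> then 1 else 0)"
    using real_vector.linear_independent_extend[of \<Delta> "\<lambda>x. if x = \<delta> then 1 else 0"] by auto
  have "\<forall>\<delta>'\<in>\<Delta>. \<delta>' \<bullet> adjoint g 1 = (if \<delta>' = \<delta> then 1 else 0)"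
    using g adjoint_works[OF g(1)] by simp
  then have "\<forall>\<delta>'\<in>\<Delta>. \<delta>' \<bullet> dual \<delta> = (if \<delta>' = \<delta> then 1 else 0)"
    unfolding dual_def by (rule someI)
  then show ?thesis using assms by blast
qed

lemma root_coords:
  assumes "\<alpha> \<in> \<Phi>"
  shows "\<alpha> = (\<Sum>\<delta>\<in>\<Delta>. (\<alpha> \<bullet> dual \<delta>) *\<^sub>R \<delta>)"
    and "(\<forall>\<delta>\<in>\<Delta>. 0 \<le> \<alpha> \<bullet> dual \<delta>) \<or> (\<forall>\<delta>\<in>\<Delta>. \<alpha> \<bullet> dual \<delta> \<le> 0)"
proof -
  obtain c where c: "\<alpha> = (\<Sum>\<delta>\<in>\<Delta>. c \<delta> *\<^sub>R \<delta>)" "(\<forall>\<delta>\<in>\<Delta>. 0 \<le> c \<delta>) \<or> (\<forall>\<delta>\<in>\<Delta>. c \<delta> \<le> 0)"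
    using assms simple_system unfolding simple_system_def by blast
  have eq: "\<alpha> \<bullet> dual \<delta> = c \<delta>" if "\<delta> \<in> \<Delta>" for \<delta>
  proof -
    have "\<alpha> \<bullet> dual \<delta> = (\<Sum>\<delta>'\<in>\<Delta>. c \<delta>' * (\<delta>' \<bullet> dual \<delta>))"
      by (subst c(1)) (simp add: inner_sum_left)
    also have "\<dots> = (\<Sum>\<delta>'\<in>\<Delta>. if \<delta>' = \<delta> then c \<delta>' else 0)"
      by (rule sum.cong) (auto simp: inner_dual)
    finally show ?thesis using that finite_simple by simp
  qed
  show "\<alpha> = (\<Sum>\<delta>\<in>\<Delta>. (\<alpha> \<bullet> dual \<delta>) *\<^sub>R \<delta>)"
    by (subst (1) c(1)) (rule sum.cong, auto simp: eq)
  show "(\<forall>\<delta>\<in>\<Delta>. 0 \<le> \<alpha> \<bullet> dual \<delta>) \<or> (\<forall>\<delta>\<in>\<Delta>. \<alpha> \<bullet> dual \<delta> \<le> 0)"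
    using c(2) eq by simp
qed

lemma root_inner_eq:
  assumes "\<alpha> \<in> \<Phi>" "orthogonal_transformation w"
  shows "w \<alpha> \<bullet> x = (\<Sum>\<delta>\<in>\<Delta>. (\<alpha> \<bullet> dual \<delta>) * (w \<delta> \<bullet> x))"
proof -
  have "w \<alpha> = w (\<Sum>\<delta>\<in>\<Delta>. (\<alpha> \<bullet> dual \<delta>) *\<^sub>R \<delta>)"
    using root_coords(1)[OF assms(1)] by simp
  also have "\<dots> = (\<Sum>\<delta>\<in>\<Delta>. (\<alpha> \<bullet> dual \<delta>) *\<^sub>R w \<delta>)"
    using assms(2) by (simp add: orthogonal_transformation_def linear_sum linear_cmul)
  finally show ?thesis by (simp add: inner_sum_left)
qed

text \<open>A point in the interior of the fundamental chamber, with the same value 1 under every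
  simple root; \<open>\<alpha> \<bullet> base\<close> is the sum of the coefficients of \<alpha>,
  that is, its height.\<close>

definition base :: 'a where "base = (\<Sum>\<delta>\<in>\<Delta>. dual \<delta>)"

lemma inner_base: "x \<bullet> base = (\<Sum>\<delta>\<in>\<Delta>. x \<bullet> dual \<delta>)"
  by (simp add: base_def inner_sum_right)

lemma simple_inner_base: "\<delta> \<in> \<Delta> \<Longrightarrow> \<delta> \<bullet> base = 1"
  by (simp add: inner_base inner_dual finite_simple)

text \<open>Positive and negative roots are thus told apart by the sign of the height. The
  coefficients of a root have one sign and do not all vanish, so their sum is nonzero of that
  sign.\<close>

lemma root_inner_base_nonneg_iff:
  assumes "\<alpha> \<in> \<Phi>"
  shows "\<alpha> \<bullet> base > 0 \<longleftrightarrow> (\<forall>\<delta>\<in>\<Delta>. 0 \<le> \<alpha> \<bullet> dual \<delta>)"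
    and "\<alpha> \<bullet> base < 0 \<longleftrightarrow> (\<forall>\<delta>\<in>\<Delta>. \<alpha> \<bullet> dual \<delta> \<le> 0)"
proof -
  have ne: "\<exists>\<delta>\<in>\<Delta>. \<alpha> \<bullet> dual \<delta> \<noteq> 0"
  proof (rule ccontr)
    assume "\<not> ?thesis"
    then have "\<alpha> = 0" by (subst root_coords(1)[OF assms]) simp
    then show False using root_nonzero[OF assms] by simp
  qed
  have pos: "\<alpha> \<bullet> base > 0" if "\<forall>\<delta>\<in>\<Delta>. 0 \<le> \<alpha> \<bullet> dual \<delta>"
    unfolding inner_base using ne that finite_simple
    by (metis (no_types, lifting) less_eq_real_def sum_nonneg_0 sum_nonneg)
  have neg: "\<alpha> \<bullet> base < 0" if "\<forall>\<delta>\<in>\<Delta>. \<alpha> \<bullet> dual \<delta> \<le> 0"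
  proof -
    have "0 \<le> (\<Sum>\<delta>\<in>\<Delta>. - (\<alpha> \<bullet> dual \<delta>))" using that by (intro sum_nonneg) simp
    moreover have "(\<Sum>\<delta>\<in>\<Delta>. - (\<alpha> \<bullet> dual \<delta>)) \<noteq> 0"
      using ne that finite_simple by (subst sum_nonneg_eq_0_iff) auto
    ultimately show ?thesis unfolding inner_base by (simp add: sum_negf)
  qed
  show "\<alpha> \<bullet> base > 0 \<longleftrightarrow> (\<forall>\<delta>\<in>\<Delta>. 0 \<le> \<alpha> \<bullet> dual \<delta>)" "\<alpha> \<bullet> base < 0 \<longleftrightarrow> (\<forall>\<delta>\<in>\<Delta>. \<alpha> \<bullet> dual \<delta> \<le> 0)"
    using pos neg root_coords(2)[OF assms] by (meson less_asym)+
qed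

lemma root_inner_base_nonzero: "\<alpha> \<in> \<Phi> \<Longrightarrow> \<alpha> \<bullet> base \<noteq> 0"
  using root_inner_base_nonneg_iff[of \<alpha>] root_coords(2)[of \<alpha>] by auto

lemma reflection_dual_other:
  assumes "\<delta> \<in> \<Delta>" "\<delta>' \<noteq> \<delta>"
  shows "reflection \<delta> x \<bullet> dual \<delta>' = x \<bullet> dual \<delta>'"
  using assms by (simp add: reflection_inner inner_dual)

text \<open>The reflection changes only the \<delta>-coefficient. If the image of a positive root is
  negative, all other coefficients are both nonnegative and nonpositive, so the root is a multiple
  of \<delta>.\<close>

lemma simple_reflection_positive:
  assumes \<delta>: "\<delta> \<in> \<Delta>" and \<alpha>: "\<alpha> \<in> \<Phi>" and pos: "\<alpha> \<bullet> base > 0" and neg: "reflection \<delta> \<alpha> \<bullet> base < 0"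
  shows "\<alpha> = \<delta>"
proof -
  have \<alpha>0: "\<alpha> \<bullet> dual \<delta>' = 0" if "\<delta>' \<in> \<Delta>" "\<delta>' \<noteq> \<delta>" for \<delta>'
  proof -
    have "reflection \<delta> \<alpha> \<in> \<Phi>" using reflection_root simple_root \<delta> \<alpha> by blast
    then have "reflection \<delta> \<alpha> \<bullet> dual \<delta>' \<le> 0" using neg root_inner_base_nonneg_iff(2) that by blast
    moreover have "0 \<le> \<alpha> \<bullet> dual \<delta>'" using pos root_inner_base_nonneg_iff(1)[OF \<alpha>] that by blast
    ultimately show ?thesis using reflection_dual_other[OF \<delta>] that by simp
  qed
  have eq: "\<alpha> = (\<alpha> \<bullet> dual \<delta>) *\<^sub>R \<delta>"
  proof -
    have "\<alpha> = (\<Sum>\<delta>'\<in>\<Delta>. if \<delta>' = \<delta> then (\<alpha> \<bullet> dual \<delta>') *\<^sub>R \<delta>' else 0)"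
      by (subst (1) root_coords(1)[OF \<alpha>]) (rule sum.cong, auto simp: \<alpha>0)
    then show ?thesis using \<delta> finite_simple by simp
  qed
  then have "\<alpha> = \<delta> \<or> \<alpha> = - \<delta>" using root_multiple[OF simple_root[OF \<delta>], of "\<alpha> \<bullet> dual \<delta>"] \<alpha> by simp
  then show ?thesis using pos simple_inner_base[OF \<delta>] by auto
qed

section \<open>The group generated by the simple reflections and its chambers\<close>

definition W0 :: "('a \<Rightarrow> 'a) set" where "W0 = reflection_prod ` lists \<Delta>"

lemma W0_id: "id \<in> W0"
  unfolding W0_def by (rule image_eqI[of _ _ "[]"]) auto

lemma W0_reflection: "v \<in> W0 \<Longrightarrow> \<delta> \<in> \<Delta> \<Longrightarrow> v \<circ> reflection \<delta> \<in> W0"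
proof -
  assume "v \<in> W0" "\<delta> \<in> \<Delta>"
  then obtain xs where "xs \<in> lists \<Delta>" "v = reflection_prod xs" by (auto simp: W0_def)
  then show ?thesis unfolding W0_def
    using \<open>\<delta> \<in> \<Delta>\<close> by (intro image_eqI[of _ _ "xs @ [\<delta>]"]) (auto simp: reflection_prod_append)
qed

lemma W0_orthogonal: "v \<in> W0 \<Longrightarrow> orthogonal_transformation v"
  by (auto simp: W0_def orthogonal_reflection_prod)

lemma W0_inner: "v \<in> W0 \<Longrightarrow> v x \<bullet> v y = x \<bullet> y"
  using W0_orthogonal by (auto simp: orthogonal_transformation_def)

lemma W0_uminus: "v \<in> W0 \<Longrightarrow> v (- x) = - v x"
  using W0_orthogonal by (auto simp: orthogonal_transformation_def linear_neg)

lemma W0_inj: "v \<in> W0 \<Longrightarrow> v x = v y \<longleftrightarrow> x = y"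
  using W0_orthogonal orthogonal_transformation_inj by (metis injD)

lemma W0_simple_distinct:
  assumes v: "v \<in> W0" and \<delta>: "\<delta> \<in> \<Delta>" "\<epsilon> \<in> \<Delta>" "\<delta> \<noteq> \<epsilon>"
  shows "v \<delta> \<noteq> v \<epsilon>" "v \<delta> \<noteq> - v \<epsilon>"
proof -
  show "v \<delta> \<noteq> v \<epsilon>" using \<delta> W0_inj[OF v] by simp
  have "\<delta> \<bullet> base \<noteq> (- \<epsilon>) \<bullet> base" using \<delta> by (simp add: simple_inner_base)
  then have "\<delta> \<noteq> - \<epsilon>" by metis
  then show "v \<delta> \<noteq> - v \<epsilon>" using W0_inj[OF v, of \<delta> "- \<epsilon>"] W0_uminus[OF v] by simp
qed

lemma reflection_prod_root: "xs \<in> lists \<Delta> \<Longrightarrow> \<alpha> \<in> \<Phi> \<Longrightarrow> reflection_prod xs \<alpha> \<in> \<Phi>"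
  by (induction xs) (auto intro: reflection_root simple_root)

lemma W0_root: "v \<in> W0 \<Longrightarrow> \<alpha> \<in> \<Phi> \<Longrightarrow> v \<alpha> \<in> \<Phi>"
  using reflection_prod_root unfolding W0_def by blast

lemma W0_root_preimage:
  assumes "v \<in> W0" "\<beta> \<in> \<Phi>"
  obtains \<alpha> where "\<alpha> \<in> \<Phi>" "\<beta> = v \<alpha>"
proof -
  obtain xs where xs: "xs \<in> lists \<Delta>" "v = reflection_prod xs" using assms by (auto simp: W0_def)
  then have "rev xs \<in> lists \<Delta>" by auto
  from reflection_prod_root[OF this assms(2)] show ?thesis
    by (rule that) (simp add: xs)
qed

text \<open>Apply the letters from the right. The root \<delta> starts positive and ends negative;
  at the letter \<epsilon> where the sign changes, the tail of the word sends \<delta> to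
  \<epsilon>. Hence the tail followed by the reflection in \<epsilon> equals the reflection in
  \<delta> followed by the tail, and this letter can be deleted.\<close>

lemma exchange:
  assumes "xs \<in> lists \<Delta>" "\<delta> \<in> \<Delta>" "reflection_prod xs \<delta> \<bullet> base < 0"
  shows "\<exists>ys\<in>lists \<Delta>. length ys < length xs \<and> reflection_prod ys = reflection_prod xs \<circ> reflection \<delta>"
  using assms
proof (induction xs)
  case Nil
  then show ?case by (simp add: simple_inner_base)
next
  case (Cons \<epsilon> xs)
  then have \<epsilon>: "\<epsilon> \<in> \<Delta>" and xs: "xs \<in> lists \<Delta>" by auto
  have r: "reflection_prod xs \<delta> \<in> \<Phi>" using reflection_prod_root[OF xs] simple_root Cons.prems by blast
  show ?case
  proof (cases "reflection_prod xs \<delta> \<bullet> base < 0")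
    case True
    then obtain ys where "ys \<in> lists \<Delta>" "length ys < length xs" "reflection_prod ys = reflection_prod xs \<circ> reflection \<delta>"
      using Cons xs by blast
    then show ?thesis using \<epsilon> by (intro bexI[of _ "\<epsilon> # ys"]) (auto simp: comp_assoc)
  next
    case False
    then have "reflection_prod xs \<delta> \<bullet> base > 0" using root_inner_base_nonzero[OF r] by simp
    then have "reflection_prod xs \<delta> = \<epsilon>"
      using simple_reflection_positive[OF \<epsilon> r] Cons.prems by simp
    then have "reflection \<epsilon> (reflection_prod xs x) = reflection_prod xs (reflection \<delta> x)" for x
      using reflection_conj[OF orthogonal_reflection_prod, of xs \<delta>] by metis
    then have "reflection_prod (\<epsilon> # xs) \<circ> reflection \<delta> = reflection_prod xs"
      by (metis (no_types, opaque_lifting) comp_apply ext reflection_prod.simps(2) reflection_reflection)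
    then show ?thesis by (intro bexI[OF _ xs]) (simp del: reflection_prod.simps)
  qed
qed

text \<open>Induction on the word. If \<open>w\<close> makes a simple root \<delta> negative, then
  \<open>\<delta> \<bullet> x = w \<delta> \<bullet> w x\<close> is at most 0, so \<delta> vanishes
  at \<open>x\<close>; the exchange argument shortens the word of \<open>w\<close> times the
  reflection in \<delta>, which has the same effect on \<open>x\<close>.\<close>

lemma stabilizer_in_fundamental_chamber:
  assumes "xs \<in> lists \<Delta>" "\<And>\<delta>. \<delta> \<in> \<Delta> \<Longrightarrow> 0 \<le> \<delta> \<bullet> x" "\<And>\<delta>. \<delta> \<in> \<Delta> \<Longrightarrow> 0 \<le> \<delta> \<bullet> reflection_prod xs x"
  shows "\<exists>ys\<in>lists {\<delta>\<in>\<Delta>. \<delta> \<bullet> x = 0}. reflection_prod xs = reflection_prod ys"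
  using assms
proof (induction "length xs" arbitrary: xs rule: less_induct)
  case less
  let ?w = "reflection_prod xs"
  show ?case
  proof (cases "\<exists>\<delta>\<in>\<Delta>. ?w \<delta> \<bullet> base < 0")
    case True
    then obtain \<delta> where \<delta>: "\<delta> \<in> \<Delta>" "?w \<delta> \<bullet> base < 0" by blast
    have r: "?w \<delta> \<in> \<Phi>" using reflection_prod_root less \<delta> simple_root by blast
    have "\<delta> \<bullet> x = ?w \<delta> \<bullet> ?w x"
      using orthogonal_reflection_prod[of xs] by (simp add: orthogonal_transformation_def)
    also have "\<dots> = (\<Sum>\<epsilon>\<in>\<Delta>. (?w \<delta> \<bullet> dual \<epsilon>) * (\<epsilon> \<bullet> ?w x))"
      using root_inner_eq[OF r, of id "?w x"] by (simp add: orthogonal_transformation_id[unfolded id_def] id_def)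
    also have "\<dots> \<le> 0"
      using root_inner_base_nonneg_iff(2)[OF r] \<delta>(2) less.prems(3)
      by (intro sum_nonpos mult_nonpos_nonneg) auto
    finally have \<delta>x: "\<delta> \<bullet> x = 0" using less.prems(2)[OF \<delta>(1)] by simp
    then have fix_x: "reflection \<delta> x = x" by (simp add: reflection_def inner_commute)
    obtain ys where ys: "ys \<in> lists \<Delta>" "length ys < length xs" "reflection_prod ys = ?w \<circ> reflection \<delta>"
      using exchange[OF less.prems(1) \<delta>] by blast
    obtain zs where zs: "zs \<in> lists {\<delta>\<in>\<Delta>. \<delta> \<bullet> x = 0}" "reflection_prod ys = reflection_prod zs"
      using less.hyps[OF ys(2,1)] less.prems fix_x ys(3) by auto
    have "?w = reflection_prod zs \<circ> reflection \<delta>"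
      using ys(3) zs(2) by (simp add: fun_eq_iff)
    then show ?thesis using zs(1) \<delta>(1) \<delta>x
      by (intro bexI[of _ "zs @ [\<delta>]"]) (auto simp: reflection_prod_append)
  next
    \<comment> \<open>No simple root becomes negative. Then a nonempty word is not reduced: its
      initial part without the last letter \<delta> sends \<delta> to a negative root, and the
      exchange argument gives a shorter word for the same \<open>w\<close>.\<close>
    case False
    show ?thesis
    proof (cases xs rule: rev_cases)
      case Nil
      then show ?thesis by (intro bexI[of _ "[]"]) auto
    next
      case (snoc ys \<delta>)
      then have ys: "ys \<in> lists \<Delta>" and \<delta>: "\<delta> \<in> \<Delta>" using less.prems by auto
      have "?w \<delta> = - reflection_prod ys \<delta>"
        using orthogonal_reflection_prod[of ys] snoc
        by (simp add: reflection_prod_append reflection_self orthogonal_transformation_def linear_neg)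
      moreover have "?w \<delta> \<bullet> base > 0"
        using False \<delta> root_inner_base_nonzero[OF reflection_prod_root[OF less.prems(1) simple_root[OF \<delta>]]]
        by (meson linorder_cases)
      ultimately have "reflection_prod ys \<delta> \<bullet> base < 0" by simp
      then obtain zs where "zs \<in> lists \<Delta>" "length zs < length ys" "reflection_prod zs = reflection_prod ys \<circ> reflection \<delta>"
        using exchange[OF ys \<delta>] by blast
      moreover have "?w = reflection_prod ys \<circ> reflection \<delta>" using snoc by (simp add: reflection_prod_append)
      ultimately show ?thesis using less.hyps[of zs] less.prems snoc by auto
    qed
  qed
qed

definition chamber :: "('a \<Rightarrow> 'a) \<Rightarrow> 'a set" where
  "chamber v = {x. \<forall>\<delta>\<in>\<Delta>. 0 \<le> v \<delta> \<bullet> x}"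

text \<open>Put \<open>?c\<close> = v^-1 x. Then w^-1 v sends \<open>?c\<close> to w^-1 x, both in
  the closed fundamental chamber, so it is a product of simple reflections fixing \<open>?c\<close>.
  Solving for \<open>w\<close> reverses that word.\<close>

lemma chambers_share_point:
  assumes "v \<in> W0" "w \<in> W0" "x \<in> chamber v" "x \<in> chamber w"
  shows "\<exists>ys\<in>lists {\<delta>\<in>\<Delta>. v \<delta> \<bullet> x = 0}. w = v \<circ> reflection_prod ys"
proof -
  obtain vs ws where vs: "vs \<in> lists \<Delta>" "v = reflection_prod vs" and ws: "ws \<in> lists \<Delta>" "w = reflection_prod ws"
    using assms by (auto simp: W0_def)
  have tr: "\<delta> \<bullet> reflection_prod (rev us) x = reflection_prod us \<delta> \<bullet> x" for us \<delta>
    using orthogonal_reflection_prod[of us] unfolding orthogonal_transformation_def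
    by (metis reflection_prod_rev')
  let ?c = "reflection_prod (rev vs) x"
  have "rev ws @ vs \<in> lists \<Delta>" using vs ws by auto
  then obtain ys where ys: "ys \<in> lists {\<delta>\<in>\<Delta>. \<delta> \<bullet> ?c = 0}" "reflection_prod (rev ws @ vs) = reflection_prod ys"
    using stabilizer_in_fundamental_chamber[of "rev ws @ vs" ?c] vs ws assms(3,4)
    by (auto simp: chamber_def tr reflection_prod_append simp del: in_lists_conv_set)
  have "reflection_prod (rev ws) \<circ> reflection_prod vs = reflection_prod ys"
    using ys(2) by (simp add: reflection_prod_append)
  then have "reflection_prod (rev ws) (reflection_prod vs (reflection_prod (rev ys) y)) = y" for y
    by (metis comp_apply reflection_prod_rev')
  then have "reflection_prod vs (reflection_prod (rev ys) y) = w y" for y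
    unfolding ws(2) by (metis reflection_prod_rev')
  then have "w = v \<circ> reflection_prod (rev ys)" using vs by auto
  then show ?thesis using ys(1) vs tr by (intro bexI[of _ "rev ys"]) auto
qed

text \<open>Choose \<open>v\<close> maximising \<open>v base \<bullet> x\<close>. If
  \<open>v \<delta> \<bullet> x\<close> were negative, \<open>v\<close> composed with the reflection
  in \<delta> would give a larger value, since \<open>\<delta> \<bullet> base = 1\<close>.\<close>

lemma chamber_exists: "\<exists>v\<in>W0. x \<in> chamber v"
proof -
  have "finite W0" "W0 \<noteq> {}" using finite_prods W0_id by (auto simp: W0_def)
  then have "finite ((\<lambda>v. v base \<bullet> x) ` W0)" "(\<lambda>v. v base \<bullet> x) ` W0 \<noteq> {}" by auto
  from Max_in[OF this] obtain v where v: "v \<in> W0" "Max ((\<lambda>v. v base \<bullet> x) ` W0) = v base \<bullet> x" by auto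
  have "0 \<le> v \<delta> \<bullet> x" if \<delta>: "\<delta> \<in> \<Delta>" for \<delta>
  proof -
    have "(v \<circ> reflection \<delta>) base \<bullet> x \<le> v base \<bullet> x"
      using v(2) W0_reflection[OF v(1) \<delta>] \<open>finite W0\<close> by (metis (no_types, lifting) Max_ge finite_imageI imageI)
    moreover have "v (reflection \<delta> base) = v base - (2 / (\<delta> \<bullet> \<delta>)) *\<^sub>R v \<delta>"
      using W0_orthogonal[OF v(1)] simple_inner_base[OF \<delta>]
      by (simp add: reflection_def orthogonal_transformation_def linear_diff linear_cmul inner_commute)
    ultimately have "0 \<le> 2 / (\<delta> \<bullet> \<delta>) * (v \<delta> \<bullet> x)" by (simp add: inner_diff_left)
    moreover have "2 / (\<delta> \<bullet> \<delta>) > 0" using root_nonzero[OF simple_root[OF \<delta>]] by simp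
    ultimately show ?thesis by (simp only: zero_le_mult_iff) linarith
  qed
  then show ?thesis using v(1) by (auto simp: chamber_def)
qed

lemma base_in_chamber: "v \<in> W0 \<Longrightarrow> v base \<in> chamber v"
  by (auto simp: chamber_def W0_inner simple_inner_base)

lemma chamber_of_base:
  assumes "v \<in> W0" "w \<in> W0" "v base \<in> chamber w"
  shows "w = v"
proof -
  obtain ys where ys: "ys \<in> lists {\<delta>\<in>\<Delta>. v \<delta> \<bullet> v base = 0}" "w = v \<circ> reflection_prod ys"
    using chambers_share_point[OF assms(1,2) base_in_chamber[OF assms(1)] assms(3)] by blast
  have "{\<delta>\<in>\<Delta>. v \<delta> \<bullet> v base = 0} = {}" using assms(1) by (auto simp: W0_inner simple_inner_base)
  then show ?thesis using ys by (cases ys) auto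
qed

text \<open>Crossing a wall through \<open>z\<close> changes each \<open>v x\<close> by a multiple
  of \<open>v \<delta>\<close>, which is orthogonal to \<open>z\<close>. The second claim shows that
  the neighbouring chamber has walls through \<open>z\<close> with the same labels in \<Delta>, so
  one label set serves all chambers at \<open>z\<close>.\<close>

lemma chamber_step:
  assumes "v \<in> W0" "z \<in> chamber v" "\<delta> \<in> \<Delta>" "v \<delta> \<bullet> z = 0"
  shows "z \<in> chamber (v \<circ> reflection \<delta>)" "(v \<circ> reflection \<delta>) x \<bullet> z = v x \<bullet> z"
proof -
  have eq: "(v \<circ> reflection \<delta>) x \<bullet> z = v x \<bullet> z" for x
    using W0_orthogonal[OF assms(1)] assms(4)
    by (simp add: reflection_def orthogonal_transformation_def linear_diff linear_cmul inner_diff_left)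
  then show "z \<in> chamber (v \<circ> reflection \<delta>)" "(v \<circ> reflection \<delta>) x \<bullet> z = v x \<bullet> z"
    using assms(2) by (auto simp: chamber_def)
qed

lemma chamber_steps:
  assumes "v \<in> W0" "z \<in> chamber v" "ys \<in> lists {\<delta>\<in>\<Delta>. v \<delta> \<bullet> z = 0}"
  shows "z \<in> chamber (v \<circ> reflection_prod ys) \<and> (\<forall>x. (v \<circ> reflection_prod ys) x \<bullet> z = v x \<bullet> z)"
  using assms
proof (induction ys arbitrary: v)
  case (Cons \<delta> ys)
  then have \<delta>: "\<delta> \<in> \<Delta>" "v \<delta> \<bullet> z = 0" by auto
  note st = chamber_step[OF Cons.prems(1,2) \<delta>]
  have "ys \<in> lists {\<delta>'\<in>\<Delta>. (v \<circ> reflection \<delta>) \<delta>' \<bullet> z = 0}" using Cons.prems(3) st(2) by auto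
  from Cons.IH[OF W0_reflection[OF Cons.prems(1) \<delta>(1)] st(1) this]
  show ?case using st(2) by (simp add: comp_assoc)
qed simp

section \<open>The complement of the arrangement\<close>

text \<open>The complement of the arrangement in terms of roots alone;
  \<open>arrangement_complement_eq\<close> proves the agreement.\<close>

definition cmpl :: "'a set" where
  "cmpl = {x. \<forall>\<alpha>\<in>\<Phi>. \<forall>\<beta>\<in>\<Phi>. \<alpha> \<bullet> x = 0 \<and> \<beta> \<bullet> x = 0 \<longrightarrow> \<alpha> \<bullet> \<beta> = 0 \<or> \<alpha> = \<beta> \<or> \<alpha> = - \<beta>}"

text \<open>The union of the open faces whose closure contains \<open>z\<close>.\<close>

definition star :: "'a \<Rightarrow> 'a set" where
  "star z = {y. \<forall>\<beta>\<in>\<Phi>. \<beta> \<bullet> z > 0 \<longrightarrow> \<beta> \<bullet> y > 0}"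

lemma mem_star: "z \<in> star z"
  by (simp add: star_def)

lemma star_eq: "star z = (\<Inter>\<beta>\<in>{\<beta>\<in>\<Phi>. \<beta> \<bullet> z > 0}. {y. \<beta> \<bullet> y > 0})"
  by (auto simp: star_def)

lemma open_star: "open (star z)"
  unfolding star_eq using finite_roots by (intro open_INT) (auto simp: open_halfspace_gt)

lemma convex_star: "convex (star z)"
  unfolding star_eq by (intro convex_INT convex_halfspace_gt)

text \<open>Roots come in opposite pairs, so a root that is nonzero at \<open>z\<close> keeps its
  sign throughout the star.\<close>

lemma root_star_zero:
  assumes "\<beta> \<in> \<Phi>" "y \<in> star z" "\<beta> \<bullet> y = 0"
  shows "\<beta> \<bullet> z = 0"
  using assms uminus_root[OF assms(1)] unfolding star_def
  by (metis (mono_tags, lifting) inner_minus_left less_irrefl linorder_neqE_linordered_idom mem_Collect_eq neg_0_less_iff_less neg_equal_0_iff_equal)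

lemma star_subset_cmpl: "z \<in> cmpl \<Longrightarrow> star z \<subseteq> cmpl"
  using root_star_zero unfolding cmpl_def by blast

text \<open>A root negative at \<open>z\<close> has a positive opposite and so stays negative on the
  star. Hence all chambers met inside \<open>star z\<close> share the point \<open>z\<close>, where
  \<open>chambers_share_point\<close> can compare them.\<close>

lemma chamber_star:
  assumes "v \<in> W0" "y \<in> chamber v" "y \<in> star z"
  shows "z \<in> chamber v"
proof (unfold chamber_def, intro CollectI ballI)
  fix \<delta> assume \<delta>: "\<delta> \<in> \<Delta>"
  then have "- v \<delta> \<in> \<Phi>" using W0_root simple_root assms(1) uminus_root by blast
  then show "0 \<le> v \<delta> \<bullet> z" using assms(2,3) \<delta> unfolding star_def chamber_def
    by (metis (mono_tags, lifting) inner_minus_left leD linorder_not_le mem_Collect_eq neg_0_less_iff_less)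
qed

text \<open>A root positive at \<open>z\<close> cannot be nonpositive in the coordinates of the
  chamber \<open>v\<close>, so its height there is positive.\<close>

lemma base_in_star:
  assumes "v \<in> W0" "z \<in> chamber v"
  shows "v base \<in> star z"
proof (unfold star_def, intro CollectI ballI impI)
  fix \<beta> assume \<beta>: "\<beta> \<in> \<Phi>" "\<beta> \<bullet> z > 0"
  obtain \<alpha> where \<alpha>: "\<alpha> \<in> \<Phi>" "\<beta> = v \<alpha>" using W0_root_preimage[OF assms(1) \<beta>(1)] .
  have "\<not> (\<forall>\<delta>\<in>\<Delta>. \<alpha> \<bullet> dual \<delta> \<le> 0)"
  proof
    assume "\<forall>\<delta>\<in>\<Delta>. \<alpha> \<bullet> dual \<delta> \<le> 0"
    then have "v \<alpha> \<bullet> z \<le> 0"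
      unfolding root_inner_eq[OF \<alpha>(1) W0_orthogonal[OF assms(1)]] using assms(2)
      by (intro sum_nonpos mult_nonpos_nonneg) (auto simp: chamber_def)
    then show False using \<beta> \<alpha> by simp
  qed
  then have "\<alpha> \<bullet> base > 0" using root_inner_base_nonneg_iff(1)[OF \<alpha>(1)] root_coords(2)[OF \<alpha>(1)] by blast
  then show "\<beta> \<bullet> v base > 0" using \<alpha> assms(1) by (simp add: W0_inner)
qed

text \<open>By orthogonality, reflecting in \<delta> negates the \<delta>-coefficient of \<alpha>
  and keeps the others. Both \<alpha> and its image have coefficients of one sign, so a nonzero
  \<delta>-coefficient forces the others to vanish.\<close>

lemma root_in_orthogonal_face:
  assumes D: "D \<subseteq> \<Delta>" "\<And>\<delta> \<epsilon>. \<delta> \<in> D \<Longrightarrow> \<epsilon> \<in> D \<Longrightarrow> \<delta> \<noteq> \<epsilon> \<Longrightarrow> \<delta> \<bullet> \<epsilon> = 0"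
    and \<alpha>: "\<alpha> \<in> \<Phi>" "\<And>\<delta>. \<delta> \<in> \<Delta> \<Longrightarrow> \<delta> \<notin> D \<Longrightarrow> \<alpha> \<bullet> dual \<delta> = 0"
  shows "\<exists>\<delta>\<in>D. \<alpha> = \<delta> \<or> \<alpha> = - \<delta>"
proof -
  have "\<exists>\<delta>\<in>\<Delta>. \<alpha> \<bullet> dual \<delta> \<noteq> 0"
  proof (rule ccontr)
    assume "\<not> ?thesis"
    then have "\<alpha> = 0" by (subst root_coords(1)[OF \<alpha>(1)]) simp
    then show False using root_nonzero[OF \<alpha>(1)] by simp
  qed
  then obtain \<delta> where \<delta>: "\<delta> \<in> D" "\<alpha> \<bullet> dual \<delta> \<noteq> 0" using \<alpha>(2) by blast
  then have \<delta>\<Delta>: "\<delta> \<in> \<Delta>" using D by blast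
  have n: "\<delta> \<bullet> \<delta> \<noteq> 0" using root_nonzero[OF simple_root[OF \<delta>\<Delta>]] by simp
  have "\<alpha> \<bullet> \<delta> = (\<Sum>\<epsilon>\<in>\<Delta>. (\<alpha> \<bullet> dual \<epsilon>) * (\<epsilon> \<bullet> \<delta>))"
    using root_inner_eq[OF \<alpha>(1), of id \<delta>] by (simp add: id_def)
  also have "\<dots> = (\<Sum>\<epsilon>\<in>\<Delta>. if \<epsilon> = \<delta> then (\<alpha> \<bullet> dual \<delta>) * (\<delta> \<bullet> \<delta>) else 0)"
    by (rule sum.cong) (use D(2) \<delta> \<alpha>(2) in auto)
  finally have "\<alpha> \<bullet> \<delta> = (\<alpha> \<bullet> dual \<delta>) * (\<delta> \<bullet> \<delta>)" using \<delta>\<Delta> finite_simple by simp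
  then have refl\<delta>: "reflection \<delta> \<alpha> \<bullet> dual \<delta> = - (\<alpha> \<bullet> dual \<delta>)"
    using n \<delta>\<Delta> by (simp add: reflection_inner inner_dual)
  have other: "\<alpha> \<bullet> dual \<epsilon> = 0" if \<epsilon>: "\<epsilon> \<in> \<Delta>" "\<epsilon> \<noteq> \<delta>" for \<epsilon>
  proof -
    have "reflection \<delta> \<alpha> \<in> \<Phi>" using reflection_root simple_root \<delta>\<Delta> \<alpha> by blast
    from root_coords(2)[OF this] root_coords(2)[OF \<alpha>(1)] show ?thesis
      using refl\<delta> reflection_dual_other[OF \<delta>\<Delta> \<epsilon>(2), of \<alpha>] \<epsilon>(1) \<delta>\<Delta> \<delta>(2)
      by (metis neg_0_le_iff_le neg_le_0_iff_le order_antisym)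
  qed
  have "\<alpha> = (\<Sum>\<epsilon>\<in>\<Delta>. if \<epsilon> = \<delta> then (\<alpha> \<bullet> dual \<epsilon>) *\<^sub>R \<epsilon> else 0)"
    by (subst (1) root_coords(1)[OF \<alpha>(1)]) (rule sum.cong, auto simp: other)
  then have "\<alpha> = (\<alpha> \<bullet> dual \<delta>) *\<^sub>R \<delta>" using \<delta>\<Delta> finite_simple by simp
  then show ?thesis using root_multiple[OF simple_root[OF \<delta>\<Delta>], of "\<alpha> \<bullet> dual \<delta>"] \<alpha>(1) \<delta>(1) by auto
qed

text \<open>Membership can be tested on the walls of one chamber at \<open>x\<close>. A root
  vanishing at \<open>x\<close> is a combination, with coefficients of one sign, of the nonnegative
  numbers \<open>v \<delta> \<bullet> x\<close>, so only simple roots vanishing at \<open>x\<close>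
  occur in it; if these are orthogonal, the root is one of them up to sign.\<close>

lemma cmpl_iff:
  assumes v: "v \<in> W0" "x \<in> chamber v"
  shows "x \<in> cmpl \<longleftrightarrow> (\<forall>\<delta>\<in>\<Delta>. \<forall>\<epsilon>\<in>\<Delta>. v \<delta> \<bullet> x = 0 \<and> v \<epsilon> \<bullet> x = 0 \<and> \<delta> \<noteq> \<epsilon> \<longrightarrow> \<delta> \<bullet> \<epsilon> = 0)"
proof
  assume x: "x \<in> cmpl"
  show "\<forall>\<delta>\<in>\<Delta>. \<forall>\<epsilon>\<in>\<Delta>. v \<delta> \<bullet> x = 0 \<and> v \<epsilon> \<bullet> x = 0 \<and> \<delta> \<noteq> \<epsilon> \<longrightarrow> \<delta> \<bullet> \<epsilon> = 0"
  proof (intro ballI impI)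
    fix \<delta> \<epsilon> assume *: "\<delta> \<in> \<Delta>" "\<epsilon> \<in> \<Delta>" "v \<delta> \<bullet> x = 0 \<and> v \<epsilon> \<bullet> x = 0 \<and> \<delta> \<noteq> \<epsilon>"
    then have "v \<delta> \<in> \<Phi>" "v \<epsilon> \<in> \<Phi>" using W0_root simple_root v by auto
    then have "v \<delta> \<bullet> v \<epsilon> = 0 \<or> v \<delta> = v \<epsilon> \<or> v \<delta> = - v \<epsilon>"
      using x * by (auto simp: cmpl_def)
    then show "\<delta> \<bullet> \<epsilon> = 0" using W0_inner[OF v(1)] W0_simple_distinct[OF v(1) *(1,2)] * by auto
  qed
next
  assume orth: "\<forall>\<delta>\<in>\<Delta>. \<forall>\<epsilon>\<in>\<Delta>. v \<delta> \<bullet> x = 0 \<and> v \<epsilon> \<bullet> x = 0 \<and> \<delta> \<noteq> \<epsilon> \<longrightarrow> \<delta> \<bullet> \<epsilon> = 0"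
  define D where "D = {\<delta>\<in>\<Delta>. v \<delta> \<bullet> x = 0}"
  have D: "\<exists>\<delta>\<in>D. \<alpha> = v \<delta> \<or> \<alpha> = - v \<delta>" if \<alpha>: "\<alpha> \<in> \<Phi>" "\<alpha> \<bullet> x = 0" for \<alpha>
  proof -
    obtain \<gamma> where \<gamma>: "\<gamma> \<in> \<Phi>" "\<alpha> = v \<gamma>" using W0_root_preimage[OF v(1) \<alpha>(1)] .
    have s0: "(\<Sum>\<delta>\<in>\<Delta>. (\<gamma> \<bullet> dual \<delta>) * (v \<delta> \<bullet> x)) = 0"
      using root_inner_eq[OF \<gamma>(1) W0_orthogonal[OF v(1)], of x] \<gamma> \<alpha> by simp
    have vx: "\<And>\<delta>. \<delta> \<in> \<Delta> \<Longrightarrow> 0 \<le> v \<delta> \<bullet> x" using v(2) by (auto simp: chamber_def)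
    have "(\<gamma> \<bullet> dual \<delta>) * (v \<delta> \<bullet> x) = 0" if "\<delta> \<in> \<Delta>" for \<delta>
      using root_coords(2)[OF \<gamma>(1)]
    proof
      assume "\<forall>\<delta>\<in>\<Delta>. 0 \<le> \<gamma> \<bullet> dual \<delta>"
      then show ?thesis using s0 sum_nonneg_eq_0_iff[OF finite_simple, of "\<lambda>\<delta>. (\<gamma> \<bullet> dual \<delta>) * (v \<delta> \<bullet> x)"] vx that by simp
    next
      assume "\<forall>\<delta>\<in>\<Delta>. \<gamma> \<bullet> dual \<delta> \<le> 0"
      then have "\<forall>\<delta>\<in>\<Delta>. - ((\<gamma> \<bullet> dual \<delta>) * (v \<delta> \<bullet> x)) = 0"
        using s0 vx by (subst sum_nonneg_eq_0_iff[OF finite_simple, symmetric])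
          (auto simp: mult_nonpos_nonneg sum_negf)
      then show ?thesis using that by simp
    qed
    then have "\<exists>\<delta>\<in>D. \<gamma> = \<delta> \<or> \<gamma> = - \<delta>"
      using orth by (intro root_in_orthogonal_face \<gamma>) (auto simp: D_def)
    then show ?thesis using \<gamma>(2) W0_uminus[OF v(1)] by auto
  qed
  show "x \<in> cmpl" unfolding cmpl_def
  proof (intro CollectI ballI impI)
    fix \<alpha> \<beta> assume "\<alpha> \<in> \<Phi>" "\<beta> \<in> \<Phi>" "\<alpha> \<bullet> x = 0 \<and> \<beta> \<bullet> x = 0"
    then obtain \<delta> \<epsilon> where "\<delta> \<in> D" "\<alpha> = v \<delta> \<or> \<alpha> = - v \<delta>" "\<epsilon> \<in> D" "\<beta> = v \<epsilon> \<or> \<beta> = - v \<epsilon>" using D by metis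
    moreover from this have "\<delta> = \<epsilon> \<or> v \<delta> \<bullet> v \<epsilon> = 0" using orth by (auto simp: D_def W0_inner[OF v(1)])
    ultimately show "\<alpha> \<bullet> \<beta> = 0 \<or> \<alpha> = \<beta> \<or> \<alpha> = - \<beta>" by auto
  qed
qed

text \<open>The sum of the dual vectors other than those of \<delta> and \<epsilon> vanishes on
  exactly these two simple roots. The case \<open>\<delta> = \<epsilon>\<close> gives a generic
  point of a wall.\<close>

lemma face_point:
  assumes v: "v \<in> W0" and \<delta>: "\<delta> \<in> \<Delta>" "\<epsilon> \<in> \<Delta>" "\<delta> = \<epsilon> \<or> \<delta> \<bullet> \<epsilon> = 0"
  obtains z where "z \<in> cmpl" "z \<in> chamber v" "v \<delta> \<bullet> z = 0" "v \<epsilon> \<bullet> z = 0"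
proof -
  define c where "c = (\<Sum>\<eta>\<in>\<Delta> - {\<delta>, \<epsilon>}. dual \<eta>)"
  have c: "\<eta> \<bullet> c = (if \<eta> = \<delta> \<or> \<eta> = \<epsilon> then 0 else 1)" if "\<eta> \<in> \<Delta>" for \<eta>
    using that finite_simple by (simp add: c_def inner_sum_right inner_dual)
  have ch: "v c \<in> chamber v" using c by (auto simp: chamber_def W0_inner[OF v])
  show ?thesis
  proof (rule that[of "v c"])
    show "v c \<in> cmpl"
      unfolding cmpl_iff[OF v ch] W0_inner[OF v] using c \<delta> by (auto simp: inner_commute split: if_splits)
  qed (use ch c \<delta> in \<open>auto simp: W0_inner[OF v]\<close>)
qed

lemma base_in_cmpl: "v \<in> W0 \<Longrightarrow> v base \<in> cmpl"
  by (auto simp: cmpl_iff[OF _ base_in_chamber] W0_inner simple_inner_base)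

end

section \<open>Orders of products of two reflections\<close>

lemma reflection_scaleR: "c \<noteq> 0 \<Longrightarrow> reflection (c *\<^sub>R a) = reflection a"
  by (rule ext) (simp add: reflection_def)

lemma reflection_fixes_iff: "a \<noteq> 0 \<Longrightarrow> reflection a x = x \<longleftrightarrow> a \<bullet> x = 0"
  by (simp add: reflection_def inner_commute)

text \<open>Stated for any group \<open>H\<close> of maps under composition, because orders are
  needed both in W and in the subgroups generated by two reflections.\<close>

lemma coxeter_m_reflections:
  fixes H :: "('a::euclidean_space \<Rightarrow> 'a) monoid"
  assumes H: "group H" "mult H = (\<circ>)" "one H = id"
    and r: "reflection \<alpha> \<in> carrier H" "reflection \<beta> \<in> carrier H" "\<alpha> \<noteq> 0" "\<beta> \<noteq> 0"
  shows "coxeter_m H (reflection \<alpha>) (reflection \<beta>) = 2 \<longleftrightarrow> \<alpha> \<bullet> \<beta> = 0"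
    and "coxeter_m H (reflection \<alpha>) (reflection \<beta>) = 1 \<longleftrightarrow> reflection \<alpha> = reflection \<beta>"
proof -
  interpret group H by fact
  let ?s = "reflection \<alpha>" and ?t = "reflection \<beta>"
  have st: "?s \<circ> ?t \<in> carrier H" using m_closed[OF r(1,2)] H by simp
  have one: "?s \<circ> ?t = id \<longleftrightarrow> ?s = ?t"
    by (metis comp_assoc comp_id id_comp reflection_involution)
  have m1: "coxeter_m H ?s ?t = 1 \<longleftrightarrow> ?s = ?t"
    using ord_eq_1[OF st] H one by (simp add: coxeter_m_def)
  then show "coxeter_m H ?s ?t = 1 \<longleftrightarrow> ?s = ?t" .
  have "(?s \<circ> ?t) [^]\<^bsub>H\<^esub> (2::nat) = (?s \<circ> ?t) \<circ> (?s \<circ> ?t)"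
    using st H by (simp add: numeral_2_eq_2 nat_pow_Suc)
  then have dvd2: "(?s \<circ> ?t) \<circ> (?s \<circ> ?t) = id \<longleftrightarrow> coxeter_m H ?s ?t dvd 2"
    using pow_eq_id[OF st, of 2] H by (simp add: coxeter_m_def)
  have m2: "coxeter_m H ?s ?t = 2 \<longleftrightarrow> (?s \<circ> ?t) \<circ> (?s \<circ> ?t) = id \<and> ?s \<noteq> ?t"
    unfolding dvd2 m1[symmetric] using two_is_prime_nat by (auto simp: prime_nat_iff)
  show "coxeter_m H ?s ?t = 2 \<longleftrightarrow> \<alpha> \<bullet> \<beta> = 0"
    unfolding m2
  proof
    assume orth: "\<alpha> \<bullet> \<beta> = 0"
    have c: "?s (?t x) = ?t (?s x)" for x
      using orth by (simp add: reflection_def inner_diff_left inner_commute[of \<beta> \<alpha>])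
    have "(?s \<circ> ?t) \<circ> (?s \<circ> ?t) = id"
      by (rule ext) (simp add: c)
    moreover have "?s \<alpha> \<noteq> ?t \<alpha>"
    proof
      assume "?s \<alpha> = ?t \<alpha>"
      moreover have "?t \<alpha> = \<alpha>" using orth by (simp add: reflection_def)
      ultimately have "\<alpha> + \<alpha> = 0" by (metis add.right_inverse reflection_self)
      then show False using r(3) by (simp add: scaleR_2[symmetric])
    qed
    ultimately show "(?s \<circ> ?t) \<circ> (?s \<circ> ?t) = id \<and> ?s \<noteq> ?t" by metis
  next
    assume *: "(?s \<circ> ?t) \<circ> (?s \<circ> ?t) = id \<and> ?s \<noteq> ?t"
    \<comment> \<open>If the product of the reflections \<open>?s\<close>, \<open>?t\<close> squares
      to the identity, then \<open>?t\<close> negates \<open>y\<close>, so \<open>y\<close> is a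
      multiple of \<beta>. As \<open>y\<close> is \<beta> minus \<open>k\<close> times \<alpha>, a
      nonzero \<open>k\<close> would make \<alpha> and \<beta> parallel and the two reflections
      equal.\<close>
    define y where "y = ?s \<beta>"
    define k where "k = 2 * (\<beta> \<bullet> \<alpha>) / (\<alpha> \<bullet> \<alpha>)"
    have "?s (?t (?s (?t \<beta>))) = \<beta>" using * by (metis comp_apply id_apply)
    then have "?t (?s (- \<beta>)) = ?s \<beta>" by (metis reflection_reflection reflection_self)
    moreover have "?s (- \<beta>) = - y"
      using orthogonal_reflection[of \<alpha>] by (simp add: y_def orthogonal_transformation_def linear_neg)
    moreover have "?t (- y) = - ?t y"
      using orthogonal_reflection[of \<beta>] by (simp add: orthogonal_transformation_def linear_neg)
    ultimately have "?t y = - y" by (metis minus_minus y_def)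
    then have "2 *\<^sub>R y = (2 * (y \<bullet> \<beta>) / (\<beta> \<bullet> \<beta>)) *\<^sub>R \<beta>"
      by (simp add: reflection_def scaleR_2 algebra_simps)
    then have "2 *\<^sub>R y = 2 *\<^sub>R (((y \<bullet> \<beta>) / (\<beta> \<bullet> \<beta>)) *\<^sub>R \<beta>)" by simp
    define c where "c = (y \<bullet> \<beta>) / (\<beta> \<bullet> \<beta>)"
    have "y = c *\<^sub>R \<beta>"
      using \<open>2 *\<^sub>R y = 2 *\<^sub>R _\<close> unfolding c_def by (simp only: scaleR_cancel_left) simp
    moreover have "y = \<beta> - k *\<^sub>R \<alpha>" by (simp add: y_def k_def reflection_def)
    ultimately have k\<alpha>: "k *\<^sub>R \<alpha> = (1 - c) *\<^sub>R \<beta>" by (simp add: algebra_simps)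
    show "\<alpha> \<bullet> \<beta> = 0"
    proof (rule ccontr)
      assume "\<alpha> \<bullet> \<beta> \<noteq> 0"
      then have k: "k \<noteq> 0" using r by (simp add: k_def inner_commute)
      then have "k *\<^sub>R \<alpha> \<noteq> 0" using r by simp
      then have "1 - c \<noteq> 0" using k\<alpha> by auto
      then have "reflection \<alpha> = reflection \<beta>" using reflection_scaleR k k\<alpha> by metis
      then show False using * by simp
    qed
  qed
qed

locale reflection_presentation = simple_roots \<Phi> \<Delta> for \<Phi> \<Delta> :: "'a::euclidean_space set" +
  fixes W :: "('a \<Rightarrow> 'a) monoid"
  assumes group_W: "group W" and carrier_W: "carrier W = W0"
    and mult_W: "mult W = (\<circ>)" and one_W: "one W = id"
begin

definition S :: "('a \<Rightarrow> 'a) set" where "S = reflection ` \<Delta>"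

abbreviation Rel where "Rel \<equiv> commutation_relations W S"

abbreviation G' where "G' \<equiv> commutation_group W S"

lemma reflection_in_W0: "\<delta> \<in> \<Delta> \<Longrightarrow> reflection \<delta> \<in> W0"
  using W0_reflection[OF W0_id] by simp

lemma coxeter_m_simple:
  assumes "\<delta> \<in> \<Delta>" "\<epsilon> \<in> \<Delta>"
  shows "coxeter_m W (reflection \<delta>) (reflection \<epsilon>) = 2 \<longleftrightarrow> \<delta> \<bullet> \<epsilon> = 0"
  using assms reflection_in_W0 root_nonzero simple_root
  by (intro coxeter_m_reflections group_W mult_W one_W) (auto simp: carrier_W)

section \<open>Irreducible parabolic subgroups of rank two in terms of roots\<close>

lemma conj_reflection:
  assumes v: "v \<in> W0"
  shows "v \<otimes>\<^bsub>W\<^esub> reflection a \<otimes>\<^bsub>W\<^esub> inv\<^bsub>W\<^esub> v = reflection (v a)"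
proof -
  interpret W: group W by (rule group_W)
  have "v ((inv\<^bsub>W\<^esub> v) x) = x" for x
    using W.r_inv[of v] v by (simp add: carrier_W mult_W one_W fun_eq_iff)
  then have "v (reflection a ((inv\<^bsub>W\<^esub> v) x)) = reflection (v a) x" for x
    using reflection_conj[OF W0_orthogonal[OF v], of a "(inv\<^bsub>W\<^esub> v) x"] by simp
  then show ?thesis by (auto simp: mult_W)
qed

lemma reflection_root_inj:
  assumes "\<alpha> \<in> \<Phi>" "\<beta> \<in> \<Phi>" "reflection \<alpha> = reflection \<beta>"
  shows "\<alpha> = \<beta> \<or> \<alpha> = - \<beta>"
proof -
  have "reflection \<beta> \<alpha> = - \<alpha>" using assms(3) reflection_self by metis
  then have "2 *\<^sub>R \<alpha> = (2 * (\<alpha> \<bullet> \<beta>) / (\<beta> \<bullet> \<beta>)) *\<^sub>R \<beta>"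
    by (simp add: reflection_def scaleR_2 algebra_simps)
  then have "2 *\<^sub>R \<alpha> = 2 *\<^sub>R (((\<alpha> \<bullet> \<beta>) / (\<beta> \<bullet> \<beta>)) *\<^sub>R \<beta>)" by simp
  then have "\<alpha> = ((\<alpha> \<bullet> \<beta>) / (\<beta> \<bullet> \<beta>)) *\<^sub>R \<beta>" by (simp only: scaleR_cancel_left) simp
  then show ?thesis using root_multiple[OF assms(2)] assms(1) by metis
qed

lemma simple_reflection_inj:
  assumes "\<delta> \<in> \<Delta>" "\<epsilon> \<in> \<Delta>" "reflection \<delta> = reflection \<epsilon>"
  shows "\<delta> = \<epsilon>"
  using reflection_root_inj[of \<delta> \<epsilon>] simple_root W0_simple_distinct[OF W0_id assms(1,2)] assms by auto

lemma reflection_conj_in_W0: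
  assumes "v \<in> W0" "\<delta> \<in> \<Delta>"
  shows "reflection (v \<delta>) \<in> W0"
proof -
  interpret W: group W by (rule group_W)
  have "v \<otimes>\<^bsub>W\<^esub> reflection \<delta> \<otimes>\<^bsub>W\<^esub> inv\<^bsub>W\<^esub> v \<in> carrier W"
    using assms reflection_in_W0 by (intro W.m_closed W.inv_closed) (auto simp: carrier_W)
  then show ?thesis using conj_reflection[OF assms(1)] carrier_W by simp
qed

lemma irreducible_pair_iff:
  assumes v: "v \<in> W0" and \<delta>: "\<delta> \<in> \<Delta>" "\<epsilon> \<in> \<Delta>" "\<delta> \<noteq> \<epsilon>"
  defines "T \<equiv> {reflection (v \<delta>), reflection (v \<epsilon>)}"
  shows "irreducible_system (W\<lparr>carrier := generate W T\<rparr>) T \<longleftrightarrow> \<delta> \<bullet> \<epsilon> \<noteq> 0"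
proof -
  interpret W: group W by (rule group_W)
  let ?H = "W\<lparr>carrier := generate W T\<rparr>"
  let ?a = "reflection (v \<delta>)" and ?b = "reflection (v \<epsilon>)"
  have T: "T \<subseteq> carrier W" using reflection_conj_in_W0[OF v] \<delta> by (auto simp: T_def carrier_W)
  have H: "group ?H"
    using subgroup.subgroup_is_group[OF W.generate_is_subgroup[OF T] group_W] .
  have root: "v \<delta> \<in> \<Phi>" "v \<epsilon> \<in> \<Phi>" using v \<delta> W0_root simple_root by auto
  have mem: "?a \<in> carrier ?H" "?b \<in> carrier ?H" by (auto simp: T_def intro: generate.incl)
  have ab: "?a \<noteq> ?b" using reflection_root_inj[OF root] W0_simple_distinct[OF v \<delta>] by blast
  have m: "coxeter_m ?H ?a ?b = 2 \<longleftrightarrow> \<delta> \<bullet> \<epsilon> = 0" "coxeter_m ?H ?a ?b \<noteq> 1"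
      "coxeter_m ?H ?b ?a = 2 \<longleftrightarrow> \<delta> \<bullet> \<epsilon> = 0" "coxeter_m ?H ?b ?a \<noteq> 1"
    using coxeter_m_reflections[OF H _ _ mem] coxeter_m_reflections[OF H _ _ mem(2,1)]
      root[THEN root_nonzero] ab
    by (simp_all add: mult_W one_W W0_inner[OF v] inner_commute)
  have maa: "coxeter_m ?H ?a ?a = 1"
    using coxeter_m_reflections(2)[OF H _ _ mem(1,1)] root[THEN root_nonzero] by (simp add: mult_W one_W)
  \<comment> \<open>The order 0 stands for infinity, so an edge is missing exactly for orders 1 and
    2, and order 1 is excluded for two distinct reflections.\<close>
  have edge_iff: "k \<ge> 3 \<or> k = 0 \<longleftrightarrow> k \<noteq> 1 \<and> k \<noteq> 2" for k :: nat by auto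
  have edge: "(?a, ?b) \<in> coxeter_edges ?H T \<longleftrightarrow> \<delta> \<bullet> \<epsilon> \<noteq> 0" "(?b, ?a) \<in> coxeter_edges ?H T \<longleftrightarrow> \<delta> \<bullet> \<epsilon> \<noteq> 0"
    using m unfolding coxeter_edges_def edge_iff by (simp_all add: T_def)
  show ?thesis
  proof
    assume "irreducible_system ?H T"
    then have "(?a, ?b) \<in> (coxeter_edges ?H T)\<^sup>*" by (auto simp: irreducible_system_def T_def)
    \<comment> \<open>The first edge on the way from \<open>?a\<close> to \<open>?b\<close> cannot
      be a loop, since \<open>?a\<close> squared has order 1; it therefore ends in
      \<open>?b\<close>.\<close>
    then obtain y where y: "(?a, y) \<in> coxeter_edges ?H T" using ab by (meson converse_rtranclE)
    then have "y = ?a \<or> y = ?b" by (auto simp: coxeter_edges_def T_def)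
    moreover have "y \<noteq> ?a" using y maa by (auto simp: coxeter_edges_def)
    ultimately show "\<delta> \<bullet> \<epsilon> \<noteq> 0" using y edge(1) by blast
  next
    assume "\<delta> \<bullet> \<epsilon> \<noteq> 0"
    then have "(?a, ?b) \<in> coxeter_edges ?H T" "(?b, ?a) \<in> coxeter_edges ?H T" using edge by auto
    then show "irreducible_system ?H T" by (auto simp: irreducible_system_def T_def)
  qed
qed

lemma Fix_generate_reflections:
  assumes "v \<in> W0" "\<delta> \<in> \<Delta>" "\<epsilon> \<in> \<Delta>"
  shows "x \<in> Fix (generate W {reflection (v \<delta>), reflection (v \<epsilon>)}) \<longleftrightarrow> v \<delta> \<bullet> x = 0 \<and> v \<epsilon> \<bullet> x = 0"
proof -
  interpret W: group W by (rule group_W)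
  let ?T = "{reflection (v \<delta>), reflection (v \<epsilon>)}"
  have nz: "v \<delta> \<noteq> 0" "v \<epsilon> \<noteq> 0" using assms W0_root simple_root root_nonzero by auto
  have fixed: "g x = x" if "\<forall>r\<in>?T. r x = x" "g \<in> generate W ?T" for g
    using that(2)
  proof (induction rule: generate.induct)
    case (inv r)
    then have r: "r \<in> carrier W" using reflection_conj_in_W0 assms by (auto simp: carrier_W)
    have "(inv\<^bsub>W\<^esub> r) (r x) = x" using W.l_inv[OF r] by (metis comp_apply id_apply mult_W one_W)
    then show ?case using that(1) inv by metis
  qed (use that(1) in \<open>auto simp: one_W mult_W\<close>)
  have "x \<in> Fix (generate W ?T) \<longleftrightarrow> (\<forall>r\<in>?T. r x = x)"
  proof
    assume x: "x \<in> Fix (generate W ?T)"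
    show "\<forall>r\<in>?T. r x = x"
    proof
      fix r assume "r \<in> ?T"
      then have "r \<in> generate W ?T" by (rule generate.incl)
      then show "r x = x" using x by (simp add: Fix_def)
    qed
  next
    assume "\<forall>r\<in>?T. r x = x"
    then show "x \<in> Fix (generate W ?T)" using fixed unfolding Fix_def by blast
  qed
  also have "\<dots> \<longleftrightarrow> v \<delta> \<bullet> x = 0 \<and> v \<epsilon> \<bullet> x = 0" using nz by (simp add: reflection_fixes_iff)
  finally show ?thesis .
qed

text \<open>Both sides are compared with the condition that two distinct, nonorthogonal simple
  roots, moved by a common \<open>v\<close>, vanish at \<open>x\<close>. For a point outside
  \<open>cmpl\<close> the element \<open>v\<close> is any chamber containing it, by
  \<open>cmpl_iff\<close>.\<close>

lemma arrangement_complement_eq: "arrangement_complement (three_parabolic_arrangement W S) = cmpl"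
proof (rule Set.set_eqI)
  fix x
  have conj: "conj_set W v {reflection \<delta>, reflection \<epsilon>} = {reflection (v \<delta>), reflection (v \<epsilon>)}" if "v \<in> W0" for v \<delta> \<epsilon>
    by (simp add: conj_set_def conj_reflection[OF that])
  have "(\<exists>X\<in>three_parabolic_arrangement W S. x \<in> X) \<longleftrightarrow>
      (\<exists>v\<in>W0. \<exists>\<delta>\<in>\<Delta>. \<exists>\<epsilon>\<in>\<Delta>. \<delta> \<noteq> \<epsilon> \<and> \<delta> \<bullet> \<epsilon> \<noteq> 0 \<and> v \<delta> \<bullet> x = 0 \<and> v \<epsilon> \<bullet> x = 0)"
  proof
    assume "\<exists>X\<in>three_parabolic_arrangement W S. x \<in> X"
    then obtain T v where T: "T \<subseteq> S" "card T = 2" "v \<in> W0" "x \<in> Fix (generate W (conj_set W v T))"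
        "irreducible_system (W\<lparr>carrier := generate W (conj_set W v T)\<rparr>) (conj_set W v T)"
      by (auto simp: three_parabolic_arrangement_def irreducible_parabolic_of_rank_def carrier_W)
    obtain s t where st: "T = {s, t}" "s \<noteq> t" using T(2) by (auto simp: card_2_iff)
    then obtain \<delta> \<epsilon> where \<delta>: "\<delta> \<in> \<Delta>" "\<epsilon> \<in> \<Delta>" "s = reflection \<delta>" "t = reflection \<epsilon>"
      using T(1) by (auto simp: S_def)
    have "\<delta> \<noteq> \<epsilon>" using st \<delta> by blast
    then show "\<exists>v\<in>W0. \<exists>\<delta>\<in>\<Delta>. \<exists>\<epsilon>\<in>\<Delta>. \<delta> \<noteq> \<epsilon> \<and> \<delta> \<bullet> \<epsilon> \<noteq> 0 \<and> v \<delta> \<bullet> x = 0 \<and> v \<epsilon> \<bullet> x = 0"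
      using T(3-5) \<delta> st irreducible_pair_iff[OF T(3) \<delta>(1,2)] Fix_generate_reflections[OF T(3) \<delta>(1,2)]
        conj[OF T(3), of \<delta> \<epsilon>] by auto
  next
    assume "\<exists>v\<in>W0. \<exists>\<delta>\<in>\<Delta>. \<exists>\<epsilon>\<in>\<Delta>. \<delta> \<noteq> \<epsilon> \<and> \<delta> \<bullet> \<epsilon> \<noteq> 0 \<and> v \<delta> \<bullet> x = 0 \<and> v \<epsilon> \<bullet> x = 0"
    then obtain v \<delta> \<epsilon> where v: "v \<in> W0" "\<delta> \<in> \<Delta>" "\<epsilon> \<in> \<Delta>" "\<delta> \<noteq> \<epsilon>" "\<delta> \<bullet> \<epsilon> \<noteq> 0" "v \<delta> \<bullet> x = 0" "v \<epsilon> \<bullet> x = 0"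
      by blast
    let ?T = "{reflection \<delta>, reflection \<epsilon>}"
    have "irreducible_parabolic_of_rank W S 2 (generate W (conj_set W v ?T))"
      unfolding irreducible_parabolic_of_rank_def
    proof (intro exI conjI)
      show "?T \<subseteq> S" using v by (auto simp: S_def)
      show "v \<in> carrier W" using v carrier_W by simp
      show "card ?T = 2" using simple_reflection_inj v by (auto simp: card_2_iff)
      show "irreducible_system (W\<lparr>carrier := generate W (conj_set W v ?T)\<rparr>) (conj_set W v ?T)"
        using irreducible_pair_iff[OF v(1-4)] conj[OF v(1)] v(5) by simp
    qed simp
    moreover have "x \<in> Fix (generate W (conj_set W v ?T))"
      using Fix_generate_reflections[OF v(1-3)] conj[OF v(1)] v by simp
    ultimately show "\<exists>X\<in>three_parabolic_arrangement W S. x \<in> X"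
      unfolding three_parabolic_arrangement_def by blast
  qed
  also have "\<dots> \<longleftrightarrow> x \<notin> cmpl"
  proof
    assume "\<exists>v\<in>W0. \<exists>\<delta>\<in>\<Delta>. \<exists>\<epsilon>\<in>\<Delta>. \<delta> \<noteq> \<epsilon> \<and> \<delta> \<bullet> \<epsilon> \<noteq> 0 \<and> v \<delta> \<bullet> x = 0 \<and> v \<epsilon> \<bullet> x = 0"
    then obtain v \<delta> \<epsilon> where v: "v \<in> W0" "\<delta> \<in> \<Delta>" "\<epsilon> \<in> \<Delta>" "\<delta> \<noteq> \<epsilon>" "\<delta> \<bullet> \<epsilon> \<noteq> 0" "v \<delta> \<bullet> x = 0" "v \<epsilon> \<bullet> x = 0"
      by blast
    have r: "v \<delta> \<in> \<Phi>" "v \<epsilon> \<in> \<Phi>" using v W0_root simple_root by auto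
    moreover have "v \<delta> \<bullet> v \<epsilon> \<noteq> 0" using v W0_inner[OF v(1)] by simp
    ultimately show "x \<notin> cmpl" using v W0_simple_distinct[OF v(1-4)] unfolding cmpl_def by blast
  next
    assume "x \<notin> cmpl"
    moreover obtain v where "v \<in> W0" "x \<in> chamber v" using chamber_exists by blast
    ultimately show "\<exists>v\<in>W0. \<exists>\<delta>\<in>\<Delta>. \<exists>\<epsilon>\<in>\<Delta>. \<delta> \<noteq> \<epsilon> \<and> \<delta> \<bullet> \<epsilon> \<noteq> 0 \<and> v \<delta> \<bullet> x = 0 \<and> v \<epsilon> \<bullet> x = 0"
      using cmpl_iff by blast
  qed
  finally show "x \<in> arrangement_complement (three_parabolic_arrangement W S) \<longleftrightarrow> x \<in> cmpl"
    by (auto simp: arrangement_complement_def)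
qed

end

section \<open>Polygonal paths through the chambers\<close>

text \<open>Exponents are ignored, which is harmless when the letters are involutions.\<close>

primrec word_map :: "('a \<Rightarrow> 'a) word \<Rightarrow> 'a \<Rightarrow> 'a" where
  "word_map [] = id"
| "word_map (a # u) = fst a \<circ> word_map u"

lemma word_map_append: "word_map (u @ u') = word_map u \<circ> word_map u'"
  by (induction u) (auto simp: comp_assoc)

lemma word_map_image: "word_map ` words (reflection ` \<Delta>) = reflection_prod ` lists \<Delta>"
proof (intro equalityI image_subsetI)
  fix u assume "u \<in> words (reflection ` \<Delta>)"
  then show "word_map u \<in> reflection_prod ` lists \<Delta>"
  proof (induction u)
    case Nil
    show ?case by (rule image_eqI[of _ _ "[]"]) auto
  next
    case (Cons a u)
    then obtain \<delta> xs where "\<delta> \<in> \<Delta>" "fst a = reflection \<delta>" "xs \<in> lists \<Delta>" "word_map u = reflection_prod xs"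
      by (metis fst_conv imageE mem_Sigma_iff prod.collapse)
    then show ?case by (intro image_eqI[of _ _ "\<delta> # xs"]) auto
  qed
next
  fix xs assume "xs \<in> lists \<Delta>"
  then show "reflection_prod xs \<in> word_map ` words (reflection ` \<Delta>)"
  proof (induction xs)
    case Nil
    show ?case by (rule image_eqI[of _ _ "[]"]) auto
  next
    case (Cons \<delta> xs)
    then obtain u where "u \<in> words (reflection ` \<Delta>)" "reflection_prod xs = word_map u" by (elim imageE)
    then show ?case using Cons.hyps(1) by (intro image_eqI[of _ _ "(reflection \<delta>, True) # u"]) auto
  qed
qed

text \<open>The relation s^2 = 1 gives s^-1 = s^-1 s s = s, which justifies ignoring
  exponents.\<close>

lemma pres_class_commutation_letter:
  assumes "s \<in> S"
  shows "pres_class S (commutation_relations W S) [(s, b)] = commutation_gen W S s"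
proof (cases b)
  case False
  let ?R = "commutation_relations W S"
  have "pres_eq S ?R ([(s, False)] @ []) ([(s, False)] @ [(s, True), (s, True)])"
    using assms by (intro pres_eq.pres_append pres_eq.pres_refl pres_eq.pres_sym[OF pres_eq.pres_rel])
      (auto simp: commutation_relations_def)
  moreover have "pres_eq S ?R ([(s, False), (s, True)] @ [(s, True)]) ([] @ [(s, True)])"
    using assms pres_eq.pres_cancel[OF assms, of ?R False]
    by (intro pres_eq.pres_append pres_eq.pres_refl) auto
  ultimately have "pres_eq S ?R [(s, False)] [(s, True)]" by (auto intro: pres_eq.pres_trans)
  from pres_class_eq[OF this] show ?thesis using False by (simp add: pres_gen_def)
qed (simp add: pres_gen_def)

text \<open>Reduces the homomorphism to evaluation of words, the form in which the kernel
  computation receives it.\<close>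

lemma commutation_hom_word_map:
  assumes W: "group W" "mult W = (\<circ>)" "one W = id"
    and \<phi>: "\<phi> \<in> hom (commutation_group W S) W" "\<And>s. s \<in> S \<Longrightarrow> \<phi> (commutation_gen W S s) = s"
    and u: "u \<in> words S"
  shows "\<phi> (pres_class S (commutation_relations W S) u) = word_map u"
  using u
proof (induction u)
  case Nil
  interpret group_hom "commutation_group W S" W \<phi>
    using W \<phi>(1) group_presented_group by (simp add: group_hom_def group_hom_axioms_def)
  show ?case using hom_one W(3) by (simp add: presented_group_def)
next
  case (Cons a u)
  let ?c = "pres_class S (commutation_relations W S)"
  have w: "[a] \<in> words S" "u \<in> words S" and a: "fst a \<in> S" using Cons.hyps by auto
  have "?c (a # u) = ?c [a] \<otimes>\<^bsub>commutation_group W S\<^esub> ?c u" using pres_mult[OF w] by simp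
  moreover have "?c [a] \<in> carrier (commutation_group W S)" "?c u \<in> carrier (commutation_group W S)"
    using w unfolding presented_group_def partial_object.simps by blast+
  ultimately have "\<phi> (?c (a # u)) = \<phi> (?c [a]) \<circ> \<phi> (?c u)"
    using hom_mult[OF \<phi>(1)] W(2) by simp
  moreover have "\<phi> (?c [a]) = fst a"
    using pres_class_commutation_letter[OF a, of W "snd a"] \<phi>(2)[OF a] by simp
  ultimately show ?case using Cons.IH by simp
qed

context reflection_presentation
begin

text \<open>The exponents of the letters are ignored because reflections are involutions.\<close>

primrec gallery :: "('a \<Rightarrow> 'a) \<Rightarrow> ('a \<Rightarrow> 'a) word \<Rightarrow> real \<Rightarrow> 'a" where
  "gallery v [] = linepath (v base) (v base)"
| "gallery v (a # u) = linepath (v base) (v (fst a base)) +++ gallery (v \<circ> fst a) u"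

definition word_of :: "'a list \<Rightarrow> ('a \<Rightarrow> 'a) word" where
  "word_of xs = map (\<lambda>\<delta>. (reflection \<delta>, True)) xs"

lemma word_map_word_of: "word_map (word_of xs) = reflection_prod xs"
  by (induction xs) (auto simp: word_of_def)

lemma word_of_words: "xs \<in> lists \<Delta> \<Longrightarrow> word_of xs \<in> words S"
  by (auto simp: word_of_def S_def)

lemma word_of_append: "word_of (xs @ ys) = word_of xs @ word_of ys"
  by (simp add: word_of_def)

lemma word_map_in_W0: "v \<in> W0 \<Longrightarrow> u \<in> words S \<Longrightarrow> v \<circ> word_map u \<in> W0"
proof (induction u arbitrary: v)
  case (Cons a u)
  then obtain \<delta> where "\<delta> \<in> \<Delta>" "fst a = reflection \<delta>" by (auto simp: S_def)
  then show ?case using Cons W0_reflection[of v \<delta>] by (auto simp: comp_assoc[symmetric] simp del: comp_apply)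
qed simp

lemma gallery_ends [simp]:
  "pathstart (gallery v u) = v base" "pathfinish (gallery v u) = v (word_map u base)"
  by (induction u arbitrary: v) auto

lemma path_gallery [simp]: "path (gallery v u)"
  by (induction u arbitrary: v) auto

text \<open>Each letter crosses a wall through \<open>z\<close>, and \<open>chamber_step\<close>
  keeps the label set unchanged, so all vertices of the gallery lie in the convex set
  \<open>star z\<close>.\<close>

lemma gallery_in_star:
  assumes "v \<in> W0" "z \<in> chamber v" "u \<in> words (reflection ` {\<delta>\<in>\<Delta>. v \<delta> \<bullet> z = 0})"
  shows "path_image (gallery v u) \<subseteq> star z \<and> z \<in> chamber (v \<circ> word_map u)"
  using assms
proof (induction u arbitrary: v)
  case Nil
  then show ?case using base_in_star by simp
next
  case (Cons a u)
  then obtain \<delta> where \<delta>: "\<delta> \<in> \<Delta>" "v \<delta> \<bullet> z = 0" "fst a = reflection \<delta>" by auto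
  let ?v = "v \<circ> reflection \<delta>"
  note st = chamber_step[OF Cons.prems(1,2) \<delta>(1,2)]
  have v: "?v \<in> W0" using W0_reflection Cons \<delta> by blast
  have "u \<in> words (reflection ` {\<delta>'\<in>\<Delta>. ?v \<delta>' \<bullet> z = 0})" using Cons.prems(3) st(2) by auto
  from Cons.IH[OF v st(1) this] have IH: "path_image (gallery ?v u) \<subseteq> star z" "z \<in> chamber (?v \<circ> word_map u)"
    by blast+
  have "path_image (linepath (v base) (?v base)) \<subseteq> star z"
    using base_in_star[OF Cons.prems(1,2)] base_in_star[OF v st(1)] convex_star[of z]
    by (simp add: closed_segment_subset)
  then have "path_image (gallery v (a # u)) \<subseteq> star z"
    using IH(1) \<delta>(3) by (simp add: path_image_join)
  then show ?case using IH \<delta>(3) by (simp only: word_map.simps comp_assoc)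
qed

lemma edge_in_star:
  assumes "v \<in> W0" "\<delta> \<in> \<Delta>"
  obtains z where "z \<in> cmpl" "z \<in> chamber v" "v \<delta> \<bullet> z = 0"
    "path_image (linepath (v base) (v (reflection \<delta> base))) \<subseteq> star z"
proof -
  obtain z where z: "z \<in> cmpl" "z \<in> chamber v" "v \<delta> \<bullet> z = 0"
    using face_point[OF assms assms(2)] by blast
  have "path_image (gallery v [(reflection \<delta>, True)]) \<subseteq> star z"
    using gallery_in_star[OF assms(1) z(2), of "[(reflection \<delta>, True)]"] z assms by auto
  then show ?thesis using that[OF z] by (simp add: path_image_join)
qed

lemma gallery_in_cmpl: "v \<in> W0 \<Longrightarrow> u \<in> words S \<Longrightarrow> path_image (gallery v u) \<subseteq> cmpl"
proof (induction u arbitrary: v)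
  case Nil
  then show ?case using base_in_cmpl by simp
next
  case (Cons a u)
  then obtain \<delta> where \<delta>: "\<delta> \<in> \<Delta>" "fst a = reflection \<delta>" by (auto simp: S_def)
  obtain z where "z \<in> cmpl" "path_image (linepath (v base) (v (reflection \<delta> base))) \<subseteq> star z"
    using edge_in_star[OF Cons.prems(1) \<delta>(1)] by blast
  then have "path_image (linepath (v base) (v (reflection \<delta> base))) \<subseteq> cmpl" using star_subset_cmpl by blast
  moreover have "path_image (gallery (v \<circ> reflection \<delta>) u) \<subseteq> cmpl"
    using Cons W0_reflection \<delta> by auto
  ultimately show ?case using \<delta>(2) by (simp add: path_image_join)
qed

lemma gallery_append:
  assumes "v \<in> W0" "u \<in> words S" "u' \<in> words S"
  shows "homotopic_paths cmpl (gallery v (u @ u')) (gallery v u +++ gallery (v \<circ> word_map u) u')"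
  using assms
proof (induction u arbitrary: v)
  case Nil
  have "homotopic_paths cmpl (gallery v u') (gallery v [] +++ gallery v u')"
    using homotopic_paths_lid[of "gallery v u'" cmpl] gallery_in_cmpl[OF Nil(1,3)] homotopic_paths_sym by force
  then show ?case by (simp only: append_Nil word_map.simps comp_id)
next
  case (Cons a u)
  then obtain \<delta> where \<delta>: "\<delta> \<in> \<Delta>" "fst a = reflection \<delta>" by (auto simp: S_def)
  let ?v = "v \<circ> reflection \<delta>" and ?l = "linepath (v base) (v (reflection \<delta> base))"
  have v: "?v \<in> W0" using W0_reflection Cons \<delta> by blast
  have u: "u \<in> words S" using Cons by simp
  have l: "path_image ?l \<subseteq> cmpl"
    using gallery_in_cmpl[of v "[a]"] Cons.prems \<delta> by (simp add: path_image_join)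
  have i: "path_image (gallery ?v u) \<subseteq> cmpl" "path_image (gallery (?v \<circ> word_map u) u') \<subseteq> cmpl"
    using gallery_in_cmpl word_map_in_W0 v u Cons.prems by blast+
  have eq: "v \<circ> word_map (a # u) = ?v \<circ> word_map u" using \<delta>(2) by (simp only: word_map.simps comp_assoc)
  have "homotopic_paths cmpl (?l +++ gallery ?v (u @ u')) (?l +++ (gallery ?v u +++ gallery (?v \<circ> word_map u) u'))"
    using l by (intro homotopic_paths_join Cons.IH[OF v u Cons.prems(3)]) auto
  moreover have "homotopic_paths cmpl (?l +++ (gallery ?v u +++ gallery (?v \<circ> word_map u) u'))
      ((?l +++ gallery ?v u) +++ gallery (?v \<circ> word_map u) u')"
    using l i by (intro homotopic_paths_assoc) auto
  ultimately show ?case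
    unfolding append_Cons gallery.simps \<delta>(2) eq by (rule homotopic_paths_trans)
qed

lemma gallery_homotopic_in_star:
  assumes "v \<in> W0" "z \<in> cmpl" "z \<in> chamber v" "word_map u = word_map u'"
    "u \<in> words (reflection ` {\<delta>\<in>\<Delta>. v \<delta> \<bullet> z = 0})" "u' \<in> words (reflection ` {\<delta>\<in>\<Delta>. v \<delta> \<bullet> z = 0})"
  shows "homotopic_paths cmpl (gallery v u) (gallery v u')"
  using gallery_in_star[OF assms(1,3,5)] gallery_in_star[OF assms(1,3,6)] assms(4)
  by (intro homotopic_paths_in_convex[OF convex_star star_subset_cmpl[OF assms(2)]]) auto

text \<open>Both galleries stay in the star of a generic point of the common face. The case
  \<open>\<delta> = \<epsilon>\<close> covers cancellation and s^2 = 1, the orthogonal case covers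
  commutation.\<close>

lemma gallery_homotopic_pair:
  assumes v: "v \<in> W0" and \<delta>: "\<delta> \<in> \<Delta>" "\<epsilon> \<in> \<Delta>" "\<delta> = \<epsilon> \<or> \<delta> \<bullet> \<epsilon> = 0" and u: "word_map u = word_map u'"
    "u \<in> words {reflection \<delta>, reflection \<epsilon>}" "u' \<in> words {reflection \<delta>, reflection \<epsilon>}"
  shows "homotopic_paths cmpl (gallery v u) (gallery v u')"
proof -
  obtain z where z: "z \<in> cmpl" "z \<in> chamber v" "v \<delta> \<bullet> z = 0" "v \<epsilon> \<bullet> z = 0"
    using face_point[OF v \<delta>] by blast
  have "{reflection \<delta>, reflection \<epsilon>} \<times> UNIV \<subseteq> (reflection ` {\<delta>\<in>\<Delta>. v \<delta> \<bullet> z = 0}) \<times> (UNIV :: bool set)"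
    using z \<delta> by auto
  from lists_mono[OF this] show ?thesis
    using gallery_homotopic_in_star[OF v z(1,2) u(1)] u(2,3) by blast
qed

text \<open>The starting chamber is universally quantified because in a concatenation the second
  gallery starts where the first one ends. Equality of the evaluations is carried along to make
  these starting chambers agree.\<close>

lemma gallery_pres_eq:
  assumes "pres_eq S Rel u u'"
  shows "word_map u = word_map u' \<and> (\<forall>v\<in>W0. homotopic_paths cmpl (gallery v u) (gallery v u'))"
  using assms
proof (induction rule: pres_eq.induct)
  case (pres_refl u)
  then show ?case using gallery_in_cmpl by simp
next
  case (pres_sym u u')
  then show ?case by (auto intro: homotopic_paths_sym)
next
  case (pres_trans u u' u'')
  then show ?case by (auto intro: homotopic_paths_trans)
next
  case (pres_append u1 u2 u1' u2')
  have w: "u1 \<in> words S" "u2 \<in> words S" "u1' \<in> words S" "u2' \<in> words S"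
    using pres_append pres_eq_words by blast+
  show ?case
  proof (intro conjI ballI)
    show "word_map (u1 @ u1') = word_map (u2 @ u2')" using pres_append by (simp add: word_map_append)
    fix v assume v: "v \<in> W0"
    have "homotopic_paths cmpl (gallery v u1 +++ gallery (v \<circ> word_map u1) u1') (gallery v u2 +++ gallery (v \<circ> word_map u2) u2')"
      using pres_append v word_map_in_W0[OF v w(1)] by (intro homotopic_paths_join) auto
    then show "homotopic_paths cmpl (gallery v (u1 @ u1')) (gallery v (u2 @ u2'))"
      using gallery_append[OF v w(1,3)] gallery_append[OF v w(2,4)]
      by (meson homotopic_paths_sym homotopic_paths_trans)
  qed
next
  case (pres_cancel s b)
  then obtain \<delta> where \<delta>: "\<delta> \<in> \<Delta>" "s = reflection \<delta>" by (auto simp: S_def)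
  have "word_map [(s, b), (s, \<not> b)] = word_map []" using \<delta> by (simp add: reflection_involution)
  then show ?case
    using gallery_homotopic_pair[OF _ \<delta>(1) \<delta>(1), of _ "[(s, b), (s, \<not> b)]" "[]"] \<delta>(2)
    by (simp del: gallery.simps word_map.simps)
next
  case (pres_rel u u')
  then consider s where "s \<in> S" "u = [(s, True), (s, True)]" "u' = []"
    | s t where "s \<in> S" "t \<in> S" "coxeter_m W s t = 2" "u = [(s, True), (t, True)]" "u' = [(t, True), (s, True)]"
    unfolding commutation_relations_def by blast
  then show ?case
  proof cases
    case 1
    then obtain \<delta> where \<delta>: "\<delta> \<in> \<Delta>" "s = reflection \<delta>" by (auto simp: S_def)
    have "word_map u = word_map u'" using 1 \<delta> by (simp add: reflection_involution)
    then show ?thesis using gallery_homotopic_pair[OF _ \<delta>(1) \<delta>(1), of _ u u'] \<delta>(2) 1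
      by (simp del: gallery.simps word_map.simps)
  next
    case 2
    then obtain \<delta> \<epsilon> where \<delta>: "\<delta> \<in> \<Delta>" "\<epsilon> \<in> \<Delta>" "s = reflection \<delta>" "t = reflection \<epsilon>" by (auto simp: S_def)
    have orth: "\<delta> \<bullet> \<epsilon> = 0" using 2 \<delta> coxeter_m_simple by simp
    then have "word_map u = word_map u'"
      using 2 \<delta> by (auto simp: fun_eq_iff reflection_def inner_diff_left inner_commute[of \<epsilon> \<delta>])
    then show ?thesis using gallery_homotopic_pair[OF _ \<delta>(1,2), of _ u u'] orth \<delta> 2
      by (simp del: gallery.simps word_map.simps)
  qed
qed

lemma path_homotopic_gallery:
  assumes p: "path p" "path_image p \<subseteq> cmpl" "pathstart p = base"
  shows "\<exists>u\<in>words S. pathfinish p \<in> chamber (word_map u) \<and>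
    homotopic_paths cmpl p (gallery id u +++ linepath (word_map u base) (pathfinish p))"
proof -
  \<comment> \<open>\<open>Q t\<close> says that the path up to time \<open>t\<close> deforms into a
    gallery followed by a straight segment inside the last chamber.\<close>
  define Q where "Q t \<longleftrightarrow> (\<exists>u\<in>words S. p t \<in> chamber (word_map u) \<and>
    homotopic_paths cmpl (subpath 0 t p) (gallery id u +++ linepath (word_map u base) (p t)))" for t
  have cont: "\<exists>d>0. \<forall>t'\<in>{0..1}. \<bar>t' - t\<bar> < d \<longrightarrow> p t' \<in> star (p t)" if t: "t \<in> {0..1}" for t
  proof -
    obtain e where e: "e > 0" "ball (p t) e \<subseteq> star (p t)"
      using open_star mem_star open_contains_ball by blast
    then obtain d where "d > 0" "\<And>t'. t' \<in> {0..1} \<Longrightarrow> dist t' t < d \<Longrightarrow> dist (p t') (p t) < e"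
      using p(1) t unfolding path_def continuous_on_iff by metis
    then show ?thesis using e(2) by (intro exI[of _ d]) (auto simp: dist_real_def dist_commute subset_iff)
  qed
  have p0: "p 0 = base" using p(3) by (simp add: pathstart_def)
  have "Q 0"
    unfolding Q_def
  proof (intro bexI[of _ "[]"] conjI)
    show "p 0 \<in> chamber (word_map [])" using base_in_chamber[OF W0_id] p0 by simp
    have b: "base \<in> cmpl" using base_in_cmpl[OF W0_id] by simp
    have "subpath 0 0 p = linepath base base" using p0 by (auto simp: subpath_def linepath_refl)
    then show "homotopic_paths cmpl (subpath 0 0 p) (gallery id [] +++ linepath (word_map [] base) (p 0))"
      using b p0 homotopic_paths_lid[of "linepath base base" cmpl] by (simp add: homotopic_paths_sym)
  qed simp
  moreover have "Q 0 \<longrightarrow> Q 1"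
  \<comment> \<open>An implication is transitive, so it suffices to extend the gallery over short
    intervals whose image lies in one star.\<close>
  proof (rule Bolzano_within[where P = "\<lambda>t t'. Q t \<longrightarrow> Q t'"])
    fix t0 :: real assume t0: "t0 \<in> {0..1}"
    define z where "z = p t0"
    have z: "z \<in> cmpl" using p t0 by (auto simp: z_def path_image_def)
    obtain d where d: "d > 0" "\<And>t. t \<in> {0..1} \<Longrightarrow> \<bar>t - t0\<bar> < d \<Longrightarrow> p t \<in> star z"
      using cont[OF t0] unfolding z_def by blast
    show "\<exists>d>0. \<forall>x y. x \<in> {0..1} \<and> y \<in> {0..1} \<and> x \<le> t0 \<and> t0 \<le> y \<and> y - x < d \<longrightarrow> (Q x \<longrightarrow> Q y)"
    proof (intro exI[of _ d] conjI allI impI)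
      fix x y assume xy: "x \<in> {0..1} \<and> y \<in> {0..1} \<and> x \<le> t0 \<and> t0 \<le> y \<and> y - x < d" and "Q x"
      then obtain u where u: "u \<in> words S" "p x \<in> chamber (word_map u)"
          "homotopic_paths cmpl (subpath 0 x p) (gallery id u +++ linepath (word_map u base) (p x))"
        unfolding Q_def by blast
      define v where "v = word_map u"
      have v: "v \<in> W0" using word_map_in_W0[OF W0_id u(1)] by (simp add: v_def)
      have near: "p t \<in> star z" if "t \<in> {x..y}" for t using d(2)[of t] that xy by auto
      have zv: "z \<in> chamber v" using chamber_star[OF v _ near[of x]] u(2) xy by (auto simp: v_def)
      obtain w where w: "w \<in> W0" "p y \<in> chamber w" using chamber_exists by blast
      have zw: "z \<in> chamber w" using chamber_star[OF w near[of y]] xy by auto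
      obtain ys where ys: "ys \<in> lists {\<delta>\<in>\<Delta>. v \<delta> \<bullet> z = 0}" "w = v \<circ> reflection_prod ys"
        using chambers_share_point[OF v w(1) zv zw] by blast
      define u' where "u' = word_of ys"
      have u'words: "u' \<in> words (reflection ` {\<delta>\<in>\<Delta>. v \<delta> \<bullet> z = 0})" using ys(1) by (auto simp: u'_def word_of_def)
      have u'S: "u' \<in> words S" using ys(1) by (auto simp: u'_def intro!: word_of_words)
      have wm: "word_map (u @ u') = w" by (simp add: word_map_append u'_def word_map_word_of ys(2) v_def)
      have g': "path_image (gallery v u') \<subseteq> star z" using gallery_in_star[OF v zv u'words] by blast
      have sub: "path_image (subpath x y p) \<subseteq> star z" "path (subpath x y p)"
        using near xy p(1) by (auto simp: path_image_subpath)
      have bv: "v base \<in> star z" "w base \<in> star z" using base_in_star v w zv zw by auto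
      have l: "path_image (linepath (v base) (p x)) \<subseteq> star z" "path_image (linepath (w base) (p y)) \<subseteq> star z"
        using bv near[of x] near[of y] xy convex_star[of z] by (auto simp: closed_segment_subset)
      have vw: "v (word_map u' base) = w base" by (simp add: u'_def word_map_word_of ys(2))
      \<comment> \<open>Both routes from \<open>v base\<close> to \<open>p y\<close> stay in the
        convex set \<open>star z\<close>: one via \<open>p x\<close> along the path, the other along
        the new letters to \<open>w base\<close>.\<close>
      have local: "homotopic_paths cmpl (linepath (v base) (p x) +++ subpath x y p) (gallery v u' +++ linepath (w base) (p y))"
        using l sub g' vw by (intro homotopic_paths_in_convex[OF convex_star star_subset_cmpl[OF z]])
          (auto simp: path_image_join)
      have starM: "star z \<subseteq> cmpl" using star_subset_cmpl[OF z] .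
      have gu: "path_image (gallery id u) \<subseteq> cmpl" using gallery_in_cmpl[OF W0_id u(1)] .
      have fin: "pathfinish (gallery id u) = v base" by (simp add: v_def)
      have 1: "homotopic_paths cmpl (subpath 0 y p) (subpath 0 x p +++ subpath x y p)"
        using homotopic_join_subpaths[OF p(1,2), of 0 x y] xy by (simp add: homotopic_paths_sym)
      have 2: "homotopic_paths cmpl (subpath 0 x p +++ subpath x y p)
          ((gallery id u +++ linepath (v base) (p x)) +++ subpath x y p)"
        using u(3) sub starM by (intro homotopic_paths_join) (auto simp: v_def)
      have 3: "homotopic_paths cmpl ((gallery id u +++ linepath (v base) (p x)) +++ subpath x y p)
          (gallery id u +++ (linepath (v base) (p x) +++ subpath x y p))"
        using gu fin l sub starM by (intro homotopic_paths_sym[OF homotopic_paths_assoc]) auto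
      have 4: "homotopic_paths cmpl (gallery id u +++ (linepath (v base) (p x) +++ subpath x y p))
          (gallery id u +++ (gallery v u' +++ linepath (w base) (p y)))"
        using gu fin local by (intro homotopic_paths_join[of _ "gallery id u"]) auto
      have 5: "homotopic_paths cmpl (gallery id u +++ (gallery v u' +++ linepath (w base) (p y)))
          ((gallery id u +++ gallery v u') +++ linepath (w base) (p y))"
        using gu fin g' l starM vw by (intro homotopic_paths_assoc) auto
      have 6: "homotopic_paths cmpl ((gallery id u +++ gallery v u') +++ linepath (w base) (p y))
          (gallery id (u @ u') +++ linepath (w base) (p y))"
        using homotopic_paths_sym[OF gallery_append[OF W0_id u(1) u'S]] l starM vw
        by (intro homotopic_paths_join) (auto simp: v_def)
      have "homotopic_paths cmpl (subpath 0 y p) (gallery id (u @ u') +++ linepath (w base) (p y))"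
        using 1 2 3 4 5 6 by (meson homotopic_paths_trans)
      then show "Q y" unfolding Q_def using u(1) u'S w(2) wm by (intro bexI[of _ "u @ u'"]) auto
    qed (fact d(1))
  qed auto
  ultimately have "Q 1" by blast
  then show ?thesis unfolding Q_def by (simp add: pathfinish_def)
qed

section \<open>Holonomy with values in the commutation group\<close>

definition cls :: "'a list \<Rightarrow> ('a \<Rightarrow> 'a) word set" where
  "cls xs = pres_class S Rel (word_of xs)"

lemma pres_class_eq_iff:
  assumes "u \<in> words S"
  shows "pres_class S Rel u = pres_class S Rel u' \<longleftrightarrow> pres_eq S Rel u u'"
proof
  assume "pres_class S Rel u = pres_class S Rel u'"
  moreover have "u \<in> pres_class S Rel u" using assms by (simp add: pres_class_def pres_eq.pres_refl)
  ultimately show "pres_eq S Rel u u'" by (simp add: pres_class_def pres_eq.pres_sym)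
qed (rule pres_class_eq)

lemma cls_append: "xs \<in> lists \<Delta> \<Longrightarrow> ys \<in> lists \<Delta> \<Longrightarrow> cls (xs @ ys) = cls xs \<otimes>\<^bsub>G'\<^esub> cls ys"
  unfolding cls_def word_of_append by (simp add: pres_mult word_of_words del: in_lists_conv_set)

lemma cls_closed: "xs \<in> lists \<Delta> \<Longrightarrow> cls xs \<in> carrier G'"
  unfolding cls_def presented_group_def using word_of_words by simp

lemma cls_cong_append:
  assumes "cls xs = cls ys" "xs \<in> lists \<Delta>" "ys \<in> lists \<Delta>" "zs \<in> lists \<Delta>"
  shows "cls (xs @ zs) = cls (ys @ zs)" "cls (zs @ xs) = cls (zs @ ys)"
  using assms by (simp_all add: cls_append del: in_lists_conv_set)

lemma cls_reflection_prod:
  assumes "cls xs = cls ys" "xs \<in> lists \<Delta>"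
  shows "reflection_prod xs = reflection_prod ys"
  using assms pres_class_eq_iff[OF word_of_words] gallery_pres_eq unfolding cls_def
  by (metis word_map_word_of)

lemma cls_square: "\<delta> \<in> \<Delta> \<Longrightarrow> cls [\<delta>, \<delta>] = cls []"
  unfolding cls_def
  by (intro pres_class_eq pres_eq.pres_rel) (auto simp: word_of_def commutation_relations_def S_def)

lemma cls_swap:
  assumes "\<delta> \<in> \<Delta>" "\<epsilon> \<in> \<Delta>" "\<delta> \<bullet> \<epsilon> = 0"
  shows "cls [\<delta>, \<epsilon>] = cls [\<epsilon>, \<delta>]"
proof -
  have "coxeter_m W (reflection \<delta>) (reflection \<epsilon>) = 2" using coxeter_m_simple assms by simp
  then have "(word_of [\<delta>, \<epsilon>], word_of [\<epsilon>, \<delta>]) \<in> Rel"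
    using assms unfolding commutation_relations_def S_def word_of_def by auto
  then show ?thesis
    unfolding cls_def using assms by (intro pres_class_eq pres_eq.pres_rel word_of_words) auto
qed

lemma pres_class_letter: "\<delta> \<in> \<Delta> \<Longrightarrow> pres_class S Rel [(reflection \<delta>, b)] = cls [\<delta>]"
  using pres_class_commutation_letter[of "reflection \<delta>" S W b]
  by (simp add: cls_def word_of_def pres_gen_def S_def)

section \<open>Products of orthogonal simple reflections in the commutation group\<close>

context
  fixes D assumes D: "D \<subseteq> \<Delta>" "\<forall>\<delta>\<in>D. \<forall>\<epsilon>\<in>D. \<delta> \<noteq> \<epsilon> \<longrightarrow> \<delta> \<bullet> \<epsilon> = 0"
begin

lemma lists_D: "xs \<in> lists D \<Longrightarrow> xs \<in> lists \<Delta>"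
  using lists_mono[OF D(1)] by blast

lemma cls_move:
  assumes "\<delta> \<in> D" "xs \<in> lists D" "ys \<in> lists D"
  shows "cls (xs @ \<delta> # ys) = cls (\<delta> # xs @ ys)"
  using assms(2)
proof (induction xs)
  case (Cons \<epsilon> xs)
  then have \<epsilon>: "\<epsilon> \<in> D" and xs: "xs \<in> lists D" by auto
  have l: "xs @ ys \<in> lists \<Delta>" "[\<delta>] \<in> lists \<Delta>" "[\<epsilon>] \<in> lists \<Delta>"
    using lists_D[of "xs @ ys"] xs assms \<epsilon> D(1) by auto
  have "cls ([\<epsilon>] @ (xs @ \<delta> # ys)) = cls ([\<epsilon>] @ (\<delta> # xs @ ys))"
    using Cons.IH xs assms D(1) \<epsilon> by (intro cls_cong_append(2)) (auto intro: lists_D)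
  also have "\<dots> = cls ([\<epsilon>, \<delta>] @ (xs @ ys))" by simp
  also have "\<dots> = cls ([\<delta>, \<epsilon>] @ (xs @ ys))"
  proof (cases "\<epsilon> = \<delta>")
    case False
    then have "cls [\<epsilon>, \<delta>] = cls [\<delta>, \<epsilon>]" using cls_swap D assms(1) \<epsilon> by blast
    then show ?thesis using l by (intro cls_cong_append(1)) auto
  qed simp
  finally show ?case by simp
qed simp

lemma cls_distinct_set_cong:
  assumes "ys \<in> lists D" "distinct xs" "distinct ys" "set xs = set ys"
  shows "cls xs = cls ys"
  using assms
proof (induction xs arbitrary: ys)
  case (Cons \<delta> xs)
  then obtain as bs where ys: "ys = as @ \<delta> # bs" by (metis list.set_intros(1) split_list)
  have \<delta>: "\<delta> \<in> D" using Cons.prems(1) ys by simp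
  have ab: "as \<in> lists D" "bs \<in> lists D" using Cons.prems(1) ys by auto
  have set_xs: "set xs = set (as @ bs)" using Cons.prems ys by auto
  then have "cls xs = cls (as @ bs)" using Cons ys by (intro Cons.IH) auto
  then have "cls ([\<delta>] @ xs) = cls ([\<delta>] @ (as @ bs))"
  proof (intro cls_cong_append(2))
    show "xs \<in> lists \<Delta>" by (rule lists_D) (use set_xs ab in \<open>auto simp: in_lists_conv_set\<close>)
    show "as @ bs \<in> lists \<Delta>" by (rule lists_D) (use ab in simp)
    show "[\<delta>] \<in> lists \<Delta>" using \<delta> D(1) by auto
  qed
  also have "\<dots> = cls ys" using cls_move[OF \<delta> ab] ys by simp
  finally show ?case by simp
qed auto

text \<open>A repeated letter is moved to the front, where it cancels against its copy. With
  \<open>cls_distinct_set_cong\<close>, a class over \<open>D\<close> is therefore described by a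
  subset of \<open>D\<close>.\<close>

lemma cls_reduce:
  assumes "xs \<in> lists D"
  shows "\<exists>ys\<in>lists D. distinct ys \<and> cls xs = cls ys"
  using assms
proof (induction xs)
  case Nil
  then show ?case by (intro bexI[of _ "[]"]) auto
next
  case (Cons \<delta> xs)
  then have \<delta>: "\<delta> \<in> D" "\<delta> \<in> \<Delta>" and xs: "xs \<in> lists D" using D(1) by auto
  obtain ys where ys: "ys \<in> lists D" "distinct ys" "cls xs = cls ys" using Cons by auto
  have "cls ([\<delta>] @ xs) = cls ([\<delta>] @ ys)"
    using ys xs \<delta> lists_D[OF xs] lists_D[OF ys(1)] by (intro cls_cong_append(2)) auto
  then have eq: "cls (\<delta> # xs) = cls (\<delta> # ys)" by simp
  show ?case
  proof (cases "\<delta> \<in> set ys")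
    case True
    then obtain as bs where as: "ys = as @ \<delta> # bs" by (metis split_list)
    have ab: "as @ bs \<in> lists D" "as \<in> lists D" "bs \<in> lists D" using ys as by auto
    have "cls ([\<delta>] @ ys) = cls ([\<delta>] @ (\<delta> # as @ bs))"
      using cls_move[OF \<delta>(1) ab(2,3)] as ys(1) \<delta> lists_D[OF ys(1)] lists_D[OF ab(1)]
      by (intro cls_cong_append(2)) auto
    also have "\<dots> = cls ([\<delta>, \<delta>] @ (as @ bs))" by simp
    also have "\<dots> = cls ([] @ (as @ bs))"
      using cls_square \<delta> lists_D[OF ab(1)] by (intro cls_cong_append(1)) auto
    finally have "cls (\<delta> # xs) = cls (as @ bs)" using eq by simp
    then show ?thesis using ab ys(2) as by (intro bexI[of _ "as @ bs"]) auto
  next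
    case False
    then show ?thesis using eq ys \<delta> by (intro bexI[of _ "\<delta> # ys"]) auto
  qed
qed

lemma reflection_prod_orthogonal:
  assumes "\<And>\<epsilon>. \<epsilon> \<in> set ys \<Longrightarrow> \<delta> \<bullet> \<epsilon> = 0"
  shows "reflection_prod ys \<delta> = \<delta>"
  using assms by (induction ys) (auto simp: reflection_def)

lemma reflection_prod_dual_other:
  assumes "ys \<in> lists \<Delta>" "\<delta> \<notin> set ys"
  shows "reflection_prod ys x \<bullet> dual \<delta> = x \<bullet> dual \<delta>"
  using assms
proof (induction ys)
  case (Cons \<epsilon> ys)
  then show ?case using reflection_dual_other[of \<epsilon> \<delta>] by auto
qed simp

text \<open>This recovers the subset of letters from the action on roots. A simple root that is not
  a letter keeps its own coordinate 1; a letter is negated by its own reflection and fixed by the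
  others, which are orthogonal to it.\<close>

lemma reflection_prod_negates_iff:
  assumes ys: "ys \<in> lists D" "distinct ys" and \<delta>: "\<delta> \<in> \<Delta>"
  shows "reflection_prod ys \<delta> = - \<delta> \<longleftrightarrow> \<delta> \<in> set ys"
proof
  assume *: "reflection_prod ys \<delta> = - \<delta>"
  show "\<delta> \<in> set ys"
  proof (rule ccontr)
    assume "\<delta> \<notin> set ys"
    then have "reflection_prod ys \<delta> \<bullet> dual \<delta> = 1"
      using reflection_prod_dual_other[OF lists_D[OF ys(1)]] inner_dual[OF \<delta>, of \<delta>] by simp
    then show False using * inner_dual[OF \<delta>, of \<delta>] by simp
  qed
next
  assume "\<delta> \<in> set ys"
  then show "reflection_prod ys \<delta> = - \<delta>"
    using ys
  proof (induction ys)
    case (Cons \<epsilon> ys)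
    show ?case
    proof (cases "\<delta> = \<epsilon>")
      case True
      then have "reflection_prod ys \<delta> = \<delta>"
        using Cons.prems(2,3) D(2) by (intro reflection_prod_orthogonal) (metis Cons_in_lists_iff distinct.simps(2) in_lists_conv_set)
      then show ?thesis using True by (simp add: reflection_self)
    next
      case False
      then have "reflection_prod ys \<delta> = - \<delta>" "\<delta> \<bullet> \<epsilon> = 0" using Cons D(2) by auto
      then show ?thesis by (simp add: reflection_def)
    qed
  qed simp
qed

end

text \<open>If \<open>w\<close> is \<open>v\<close> times a product of distinct commuting simple reflections, then the simple roots
  negated by \<open>v\<inverse> w\<close> are exactly those of the factors.\<close>

definition \<tau> :: "('a \<Rightarrow> 'a) \<Rightarrow> ('a \<Rightarrow> 'a) \<Rightarrow> ('a \<Rightarrow> 'a) word set" where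
  "\<tau> v w = cls (SOME xs. distinct xs \<and> set xs = {\<delta>\<in>\<Delta>. w \<delta> = - v \<delta>})"

text \<open>Any word over the walls at \<open>z\<close> computes \<tau>, although \<open>z\<close>
  does not occur in the definition of \<tau>. This independence lets one global function act as a
  cocycle in all stars.\<close>

lemma \<tau>_eq:
  assumes v: "v \<in> W0" and z: "z \<in> cmpl" "z \<in> chamber v" and ys: "ys \<in> lists {\<delta>\<in>\<Delta>. v \<delta> \<bullet> z = 0}"
  shows "\<tau> v (v \<circ> reflection_prod ys) = cls ys"
proof -
  let ?D = "{\<delta>\<in>\<Delta>. v \<delta> \<bullet> z = 0}"
  have D: "?D \<subseteq> \<Delta>" "\<forall>\<delta>\<in>?D. \<forall>\<epsilon>\<in>?D. \<delta> \<noteq> \<epsilon> \<longrightarrow> \<delta> \<bullet> \<epsilon> = 0"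
    using z(1) unfolding cmpl_iff[OF v z(2)] by blast+
  obtain xs where xs: "xs \<in> lists ?D" "distinct xs" "cls ys = cls xs"
    using cls_reduce[OF D ys] by blast
  have eq: "reflection_prod ys = reflection_prod xs"
    using cls_reflection_prod[OF xs(3) lists_D[OF D ys]] .
  have set_eq: "{\<delta>\<in>\<Delta>. (v \<circ> reflection_prod ys) \<delta> = - v \<delta>} = set xs"
  proof (intro equalityI subsetI CollectI conjI)
    fix \<delta> assume "\<delta> \<in> {\<delta>\<in>\<Delta>. (v \<circ> reflection_prod ys) \<delta> = - v \<delta>}"
    then have "\<delta> \<in> \<Delta>" "v (reflection_prod xs \<delta>) = v (- \<delta>)" using eq W0_uminus[OF v] by auto
    then show "\<delta> \<in> set xs" using reflection_prod_negates_iff[OF D xs(1,2)] W0_inj[OF v] by blast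
  next
    fix \<delta> assume "\<delta> \<in> set xs"
    moreover from this show "\<delta> \<in> \<Delta>" using xs(1) by auto
    ultimately have "reflection_prod ys \<delta> = - \<delta>"
      using reflection_prod_negates_iff[OF D xs(1,2), of \<delta>] unfolding eq by simp
    then show "(v \<circ> reflection_prod ys) \<delta> = - v \<delta>" using W0_uminus[OF v] by simp
  qed
  \<comment> \<open>The choice in \<tau> may list the letters of \<open>xs\<close> in another order;
    commutation makes the classes equal.\<close>
  define l where "l = (SOME l. distinct l \<and> set l = set xs)"
  have l: "distinct l \<and> set l = set xs" unfolding l_def by (rule someI[of _ xs]) (use xs in simp)
  then have "cls l = cls xs" using xs by (intro cls_distinct_set_cong[OF D]) auto
  then show ?thesis unfolding \<tau>_def set_eq using xs(3) by (simp add: l_def)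
qed

definition chamber_of :: "'a \<Rightarrow> 'a \<Rightarrow> 'a" where
  "chamber_of x = (SOME v. v \<in> W0 \<and> x \<in> chamber v)"

lemma chamber_of: "chamber_of x \<in> W0" "x \<in> chamber (chamber_of x)"
proof -
  have "\<exists>v. v \<in> W0 \<and> x \<in> chamber v" using chamber_exists by blast
  then have "chamber_of x \<in> W0 \<and> x \<in> chamber (chamber_of x)" unfolding chamber_of_def by (rule someI_ex)
  then show "chamber_of x \<in> W0" "x \<in> chamber (chamber_of x)" by auto
qed

text \<open>Points \<open>v base\<close> lie on no wall, so the arbitrary choice is forced there.
  This makes the holonomy of galleries computable.\<close>

lemma chamber_of_base: "v \<in> W0 \<Longrightarrow> chamber_of (v base) = v"
  using simple_roots.chamber_of_base[OF simple_roots_axioms] chamber_of by blast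

definition transition :: "'a \<Rightarrow> 'a \<Rightarrow> ('a \<Rightarrow> 'a) word set" where
  "transition x y = \<tau> (chamber_of x) (chamber_of y)"

lemma transition_eq:
  assumes "z \<in> cmpl" "x \<in> star z" "y \<in> star z"
  obtains ys where "ys \<in> lists {\<delta>\<in>\<Delta>. chamber_of x \<delta> \<bullet> z = 0}"
    "chamber_of y = chamber_of x \<circ> reflection_prod ys" "transition x y = cls ys"
    "\<forall>\<delta>. chamber_of y \<delta> \<bullet> z = chamber_of x \<delta> \<bullet> z"
proof -
  have x: "z \<in> chamber (chamber_of x)" using chamber_star[OF chamber_of assms(2)] .
  have y: "z \<in> chamber (chamber_of y)" using chamber_star[OF chamber_of assms(3)] .
  obtain ys where ys: "ys \<in> lists {\<delta>\<in>\<Delta>. chamber_of x \<delta> \<bullet> z = 0}" "chamber_of y = chamber_of x \<circ> reflection_prod ys"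
    using chambers_share_point[OF chamber_of(1) chamber_of(1) x y] by blast
  have "transition x y = cls ys" using \<tau>_eq[OF chamber_of(1) assms(1) x ys(1)] ys(2) by (simp add: transition_def)
  moreover have "chamber_of y \<delta> \<bullet> z = chamber_of x \<delta> \<bullet> z" for \<delta>
    using chamber_steps[OF chamber_of(1) x ys(1)] ys(2) by simp
  ultimately show ?thesis using that ys by blast
qed

sublocale local_cocycle G' cmpl star transition
proof (intro local_cocycle.intro local_cocycle_axioms.intro)
  show "group G'" by (rule group_presented_group)
  fix z assume z: "z \<in> cmpl"
  show "open (star z) \<and> z \<in> star z" using open_star mem_star by blast
  fix x y assume xy: "x \<in> star z" "y \<in> star z"
  obtain ys where ys: "ys \<in> lists {\<delta>\<in>\<Delta>. chamber_of x \<delta> \<bullet> z = 0}"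
      "chamber_of y = chamber_of x \<circ> reflection_prod ys" "transition x y = cls ys"
      "\<forall>\<delta>. chamber_of y \<delta> \<bullet> z = chamber_of x \<delta> \<bullet> z"
    using transition_eq[OF z xy] .
  have ys\<Delta>: "ys \<in> lists \<Delta>" using ys(1) by auto
  then show "transition x y \<in> carrier G'" using ys(3) cls_closed by simp
  fix y' assume y': "y' \<in> star z"
  obtain ys' where ys': "ys' \<in> lists {\<delta>\<in>\<Delta>. chamber_of y \<delta> \<bullet> z = 0}"
      "chamber_of y' = chamber_of y \<circ> reflection_prod ys'" "transition y y' = cls ys'"
      "\<forall>\<delta>. chamber_of y' \<delta> \<bullet> z = chamber_of y \<delta> \<bullet> z"
    using transition_eq[OF z xy(2) y'] .
  have x: "z \<in> chamber (chamber_of x)" using chamber_star[OF chamber_of xy(1)] .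
  \<comment> \<open>The chambers of \<open>x\<close> and \<open>y\<close> have the same wall labels
    at \<open>z\<close>, so the concatenation is again a word over the walls of the first chamber
    and \<tau> of the outer pair is the product of the two lifts.\<close>
  have l: "ys @ ys' \<in> lists {\<delta>\<in>\<Delta>. chamber_of x \<delta> \<bullet> z = 0}" using ys(1,4) ys'(1) by auto
  have "chamber_of y' = chamber_of x \<circ> reflection_prod (ys @ ys')"
    using ys(2) ys'(2) by (simp add: reflection_prod_append comp_assoc)
  then have "transition x y' = cls (ys @ ys')" using \<tau>_eq[OF chamber_of(1) z x l] by (simp add: transition_def)
  then show "transition x y \<otimes>\<^bsub>G'\<^esub> transition y y' = transition x y'"
    using cls_append[OF ys\<Delta>, of ys'] ys(3) ys'(1,3) by auto
qed

text \<open>Each edge lies in the star of a generic point of the wall it crosses and contributes the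
  generator of that wall, so the holonomy spells the word in W'.\<close>

lemma transport_gallery:
  assumes "v \<in> W0" "u \<in> words S"
  shows "transport (gallery v u) 0 1 (pres_class S Rel u)"
  using assms
proof (induction u arbitrary: v)
  case Nil
  have "transition (v base) (v base) = pres_class S Rel []"
    using cocycle_refl[OF base_in_cmpl[OF Nil(1)] mem_star] by (simp add: presented_group_def)
  moreover have const: "gallery v [] t = v base" for t by (simp add: linepath_refl)
  have "transport (gallery v []) 0 1 (transition (gallery v [] 0) (gallery v [] 1))"
    using base_in_cmpl[OF Nil(1)] mem_star[of "v base"] const
    by (intro transport_in_nbhd[of "v base"]) auto
  ultimately show ?case unfolding const by (simp del: gallery.simps)
next
  case (Cons a u)
  then obtain \<delta> b where \<delta>: "\<delta> \<in> \<Delta>" "a = (reflection \<delta>, b)" by (cases a) (auto simp: S_def)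
  have u: "u \<in> words S" using Cons by simp
  let ?v = "v \<circ> reflection \<delta>" and ?l = "linepath (v base) (v (reflection \<delta> base))"
  have v: "?v \<in> W0" using W0_reflection Cons.prems(1) \<delta>(1) .
  obtain z where z: "z \<in> cmpl" "z \<in> chamber v" "v \<delta> \<bullet> z = 0" "path_image ?l \<subseteq> star z"
    using edge_in_star[OF Cons.prems(1) \<delta>(1)] .
  have "transport ?l 0 1 (transition (?l 0) (?l 1))"
    using z(4) by (intro transport_in_nbhd[OF z(1)]) (auto simp: path_image_def)
  moreover have "transition (?l 0) (?l 1) = \<tau> v (v \<circ> reflection_prod [\<delta>])"
    using chamber_of_base[OF Cons.prems(1)] chamber_of_base[OF v] by (simp add: transition_def linepath_def)
  moreover have "\<dots> = cls [\<delta>]" using \<tau>_eq[OF Cons.prems(1) z(1,2), of "[\<delta>]"] \<delta>(1) z(3) by simp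
  ultimately have l: "transport ?l 0 1 (pres_class S Rel [a])" using pres_class_letter[OF \<delta>(1)] \<delta>(2) by simp
  have "transport (?l +++ gallery ?v u) 0 1 (pres_class S Rel [a] \<otimes>\<^bsub>G'\<^esub> pres_class S Rel u)"
    by (rule transport_joinpaths[OF l Cons.IH[OF v u]]) simp
  moreover have "[a] \<in> words S" using Cons.prems by simp
  ultimately show ?case using pres_mult[of "[a]" S u Rel] u \<delta>(2) by simp
qed

text \<open>The converse of \<open>gallery_pres_eq\<close>: homotopic paths have equal holonomy, and
  the holonomy of a gallery is the class of its word.\<close>

lemma gallery_homotopic_imp_pres_eq:
  assumes "u \<in> words S" "u' \<in> words S" "homotopic_paths cmpl (gallery id u) (gallery id u')"
  shows "pres_class S Rel u = pres_class S Rel u'"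
  using transport_homotopic[OF assms(3) transport_gallery[OF W0_id assms(1)]]
    transport_gallery[OF W0_id assms(2)] transport_unique by fastforce

section \<open>The fundamental group of the complement\<close>

text \<open>The segment from \<open>x\<close> to the centre \<open>v base\<close> of a chamber at
  \<open>x\<close> stays in \<open>star x\<close>, and a gallery leads from that centre to
  \<open>base\<close>.\<close>

lemma path_to_base:
  assumes "x \<in> cmpl"
  obtains c where "path c" "path_image c \<subseteq> cmpl" "pathstart c = x" "pathfinish c = base"
proof -
  obtain v where v: "v \<in> W0" "x \<in> chamber v" using chamber_exists by blast
  then obtain xs where xs: "xs \<in> lists \<Delta>" "v = reflection_prod xs" by (auto simp: W0_def)
  let ?c = "gallery id (word_of xs) +++ linepath (v base) x"
  have "closed_segment (v base) x \<subseteq> star x"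
    using base_in_star[OF v] mem_star convex_star by (simp add: closed_segment_subset)
  then have l: "path_image (linepath (v base) x) \<subseteq> cmpl" using star_subset_cmpl[OF assms] by simp
  have v': "word_map (word_of xs) = v" using xs word_map_word_of by simp
  show ?thesis
    by (rule that[of "reversepath ?c"])
       (use l gallery_in_cmpl[OF W0_id word_of_words[OF xs(1)]] v' in \<open>auto simp: path_image_join\<close>)
qed

lemma loop_homotopic_gallery:
  assumes "p \<in> loops cmpl base"
  obtains u where "u \<in> words S" "word_map u = id" "homotopic_paths cmpl p (gallery id u)"
proof -
  have p: "path p" "path_image p \<subseteq> cmpl" "pathstart p = base" "pathfinish p = base"
    using assms by (auto simp: loops_def)
  obtain u where u: "u \<in> words S" "base \<in> chamber (word_map u)"
      "homotopic_paths cmpl p (gallery id u +++ linepath (word_map u base) base)"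
    using path_homotopic_gallery[OF p(1-3)] p(4) by auto
  have "word_map u \<in> W0" using word_map_in_W0[OF W0_id u(1)] by simp
  \<comment> \<open>The loop ends at \<open>base\<close>, which lies in the fundamental chamber
    only, so the last chamber of the gallery is the first one.\<close>
  then have id: "word_map u = id"
    using simple_roots.chamber_of_base[OF simple_roots_axioms W0_id] u(2) by simp
  have "homotopic_paths cmpl (gallery id u +++ linepath base base) (gallery id u)"
    using homotopic_paths_rid[of "gallery id u" cmpl] gallery_in_cmpl[OF W0_id u(1)] id by simp
  then have "homotopic_paths cmpl p (gallery id u)"
    using u(3) id by (auto intro: homotopic_paths_trans)
  then show ?thesis using that u(1) id by blast
qed

theorem kernel_iso_fundamental_group:
  assumes \<phi>: "\<And>u. u \<in> words S \<Longrightarrow> \<phi> (pres_class S Rel u) = word_map u"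
  shows "G'\<lparr>carrier := kernel G' W \<phi>\<rparr> \<cong> fundamental_group cmpl base"
proof -
  define F where "F A = path_class cmpl (gallery id (SOME u. u \<in> A))" for A
  have F: "F (pres_class S Rel u) = path_class cmpl (gallery id u)" if u: "u \<in> words S" for u
  proof -
    have "(SOME u'. u' \<in> pres_class S Rel u) \<in> pres_class S Rel u"
      by (rule someI[of _ u]) (use u in \<open>simp add: pres_class_def pres_eq.pres_refl\<close>)
    then have "pres_eq S Rel u (SOME u'. u' \<in> pres_class S Rel u)" by (simp add: pres_class_def)
    then show ?thesis unfolding F_def using gallery_pres_eq W0_id path_class_eq by metis
  qed
  have ker: "A \<in> kernel G' W \<phi> \<longleftrightarrow> (\<exists>u\<in>words S. word_map u = id \<and> A = pres_class S Rel u)" for A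
  proof
    assume "A \<in> kernel G' W \<phi>"
    then have "A \<in> pres_class S Rel ` words S" "\<phi> A = id"
      by (simp_all only: kernel_def presented_group_def one_W mem_Collect_eq partial_object.simps)
    then show "\<exists>u\<in>words S. word_map u = id \<and> A = pres_class S Rel u" using \<phi> by (elim imageE) metis
  next
    assume "\<exists>u\<in>words S. word_map u = id \<and> A = pres_class S Rel u"
    then show "A \<in> kernel G' W \<phi>"
      using \<phi> by (elim bexE conjE) (simp add: kernel_def presented_group_def one_W del: in_lists_conv_set)
  qed
  have loop: "gallery id u \<in> loops cmpl base" if "u \<in> words S" "word_map u = id" for u
    using that gallery_in_cmpl[OF W0_id that(1)] by (simp add: loops_def)
  have "F \<in> iso (G'\<lparr>carrier := kernel G' W \<phi>\<rparr>) (fundamental_group cmpl base)"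
  proof (rule isoI)
    show "F \<in> hom (G'\<lparr>carrier := kernel G' W \<phi>\<rparr>) (fundamental_group cmpl base)"
    proof (rule homI)
      fix A assume "A \<in> carrier (G'\<lparr>carrier := kernel G' W \<phi>\<rparr>)"
      then obtain u where u: "u \<in> words S" "word_map u = id" "A = pres_class S Rel u" using ker by auto
      then show "F A \<in> carrier (fundamental_group cmpl base)"
        using F loop by (simp add: fundamental_group_def)
      fix B assume "B \<in> carrier (G'\<lparr>carrier := kernel G' W \<phi>\<rparr>)"
      then obtain u' where u': "u' \<in> words S" "word_map u' = id" "B = pres_class S Rel u'" using ker by auto
      have uu: "u @ u' \<in> words S" using u u' by simp
      have "F (A \<otimes>\<^bsub>G'\<^esub> B) = path_class cmpl (gallery id (u @ u'))"
        unfolding u(3) u'(3) pres_mult[OF u(1) u'(1)] by (rule F[OF uu])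
      \<comment> \<open>As \<open>u\<close> evaluates to the identity, the second gallery starts
        again in the fundamental chamber.\<close>
      also have "\<dots> = path_class cmpl (gallery id u +++ gallery id u')"
        using gallery_append[OF W0_id u(1) u'(1)] u(2) by (intro path_class_eq) simp
      also have "\<dots> = F A \<otimes>\<^bsub>fundamental_group cmpl base\<^esub> F B"
        unfolding u(3) u'(3) F[OF u(1)] F[OF u'(1)] by (rule fundamental_mult[OF loop[OF u(1,2)] loop[OF u'(1,2)], symmetric])
      finally show "F (A \<otimes>\<^bsub>G'\<lparr>carrier := kernel G' W \<phi>\<rparr>\<^esub> B) = F A \<otimes>\<^bsub>fundamental_group cmpl base\<^esub> F B" by simp
    qed
    show "bij_betw F (carrier (G'\<lparr>carrier := kernel G' W \<phi>\<rparr>)) (carrier (fundamental_group cmpl base))"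
    proof (rule bij_betw_imageI)
      show "inj_on F (carrier (G'\<lparr>carrier := kernel G' W \<phi>\<rparr>))"
      proof (rule inj_onI)
        fix A B assume "A \<in> carrier (G'\<lparr>carrier := kernel G' W \<phi>\<rparr>)" "B \<in> carrier (G'\<lparr>carrier := kernel G' W \<phi>\<rparr>)"
          and eq: "F A = F B"
        then obtain u u' where u: "u \<in> words S" "A = pres_class S Rel u" and u': "u' \<in> words S" "B = pres_class S Rel u'"
          using ker by auto
        have "homotopic_paths cmpl (gallery id u) (gallery id u')"
          using eq F u u' path_class_eq_iff[of "gallery id u" cmpl "gallery id u'"] gallery_in_cmpl[OF W0_id u(1)] by simp
        then show "A = B" using gallery_homotopic_imp_pres_eq u u' by blast
      qed
      show "F ` carrier (G'\<lparr>carrier := kernel G' W \<phi>\<rparr>) = carrier (fundamental_group cmpl base)"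
      proof (intro equalityI subsetI)
        fix B assume "B \<in> F ` carrier (G'\<lparr>carrier := kernel G' W \<phi>\<rparr>)"
        then obtain A where "A \<in> kernel G' W \<phi>" "B = F A" by auto
        then obtain u where u: "u \<in> words S" "word_map u = id" "B = F (pres_class S Rel u)"
          using ker[of A] by blast
        then show "B \<in> carrier (fundamental_group cmpl base)"
          using F[OF u(1)] loop[OF u(1,2)] by (simp add: fundamental_group_def)
      next
        fix B assume "B \<in> carrier (fundamental_group cmpl base)"
        then obtain p where p: "p \<in> loops cmpl base" "B = path_class cmpl p" by (auto simp: fundamental_group_def)
        obtain u where u: "u \<in> words S" "word_map u = id" "homotopic_paths cmpl p (gallery id u)"
          using loop_homotopic_gallery[OF p(1)] .
        then have "B = F (pres_class S Rel u)" using p(2) F path_class_eq by metis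
        moreover have "pres_class S Rel u \<in> carrier (G'\<lparr>carrier := kernel G' W \<phi>\<rparr>)" using ker u by auto
        ultimately show "B \<in> F ` carrier (G'\<lparr>carrier := kernel G' W \<phi>\<rparr>)" by blast
      qed
    qed
  qed
  then show ?thesis by (rule is_isoI)
qed

end

theorem theorem4p1:
  fixes W :: "(real ^ 'n \<Rightarrow> real ^ 'n) monoid"
    and \<Phi> \<Delta> :: "(real ^ 'n) set"
    and S :: "(real ^ 'n \<Rightarrow> real ^ 'n) set"
    and \<phi>' :: "(real ^ 'n \<Rightarrow> real ^ 'n) word set \<Rightarrow> (real ^ 'n \<Rightarrow> real ^ 'n)"
    and x\<^sub>0 :: "real ^ 'n"
  assumes "finite_reflection_group W"
    and "root_system_of W \<Phi>"
    and "simple_system \<Phi> \<Delta>"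
    and "span \<Delta> = UNIV"
    and "S = reflection ` \<Delta>"
    and "\<phi>' \<in> epi (commutation_group W S) W"
    and "\<And>s. s \<in> S \<Longrightarrow> \<phi>' (commutation_gen W S s) = s"
    and "x\<^sub>0 \<in> arrangement_complement (three_parabolic_arrangement W S)"
  shows "fundamental_group (arrangement_complement (three_parabolic_arrangement W S)) x\<^sub>0
    \<cong> (commutation_group W S)\<lparr>carrier := kernel (commutation_group W S) W \<phi>'\<rparr>"
proof -
  have W: "group W" "mult W = (\<circ>)" "one W = id"
    using finite_reflection_group_imp_group[OF assms(1)] assms(1)
    by (auto simp: finite_reflection_group_def orthogonal_group_def)
  have hom: "\<phi>' \<in> hom (commutation_group W S) W"
    and surj: "\<phi>' ` carrier (commutation_group W S) = carrier W"
    using assms(6) by (auto simp: epi_def)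
  note \<phi>'_eq = commutation_hom_word_map[OF W hom assms(7)]
  have words_eq: "word_map ` words S = reflection_prod ` lists \<Delta>"
    unfolding assms(5) by (rule word_map_image)
  \<comment> \<open>The hypotheses present W as generated by the reflections in all roots;
    surjectivity of \<open>\<phi>'\<close> shows that products of simple reflections already exhaust
    it.\<close>
  have carrier: "carrier W = reflection_prod ` lists \<Delta>"
    unfolding words_eq[symmetric] surj[symmetric] presented_group_def partial_object.simps image_image
    by (rule image_cong[OF refl \<phi>'_eq])
  have "finite (carrier W)" using assms(1) by (simp add: finite_reflection_group_def)
  then interpret simple_roots \<Phi> \<Delta>
    using assms(2,3) carrier by unfold_locales (auto simp: root_system_of_def)
  interpret reflection_presentation \<Phi> \<Delta> W
    by (intro reflection_presentation.intro reflection_presentation_axioms.intro simple_roots_axioms)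
       (simp_all only: W carrier W0_def)
  have S: "S = reflection_presentation.S \<Delta>" using assms(5) S_def by simp
  let ?G = "commutation_group W S" and ?K = "(commutation_group W S)\<lparr>carrier := kernel (commutation_group W S) W \<phi>'\<rparr>"
  interpret \<phi>': group_hom ?G W \<phi>'
    using W hom group_presented_group by (simp add: group_hom_def group_hom_axioms_def)
  have "group ?K"
    using subgroup.subgroup_is_group[OF \<phi>'.subgroup_kernel group_presented_group] .
  moreover have "?K \<cong> fundamental_group cmpl x\<^sub>0"
  proof (rule iso_trans)
    show "?K \<cong> fundamental_group cmpl base"
      unfolding S by (rule kernel_iso_fundamental_group) (use \<phi>'_eq S in simp)
    have "x\<^sub>0 \<in> cmpl" using assms(8) S arrangement_complement_eq by simp
    then obtain c where "path c" "path_image c \<subseteq> cmpl" "pathstart c = x\<^sub>0" "pathfinish c = base"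
      using path_to_base by metis
    then show "fundamental_group cmpl base \<cong> fundamental_group cmpl x\<^sub>0"
      by (rule fundamental_group_change_basepoint)
  qed
  ultimately have "fundamental_group cmpl x\<^sub>0 \<cong> ?K" by (rule group.iso_sym)
  then show ?thesis using arrangement_complement_eq S by simp
qed

end
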